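(* Let $(M,g)$ be a compact connected $C^\infty$ Riemannian manifold without boundary and let $\{\phi_{\lambda_j}\}$ be a sequence of real-valued $L^2$-normalized eigenfunctions, $\Delta_g\phi_{\lambda_j}=-\lambda_j^2\phi_{\lambda_j}$, which is $L^\infty$ quantum ergodic on the base. Then there exists $C>0$ such that any weak* limit (along any subsequence, tested against $f\in C(M)$) of the sequence of measures $$\frac{1}{\lambda_j^2}|\nabla\phi_{\lambda_j}|\,dS\big|_{Z_{\phi_{\lambda_j}}}$$ has total mass $\ge C>0$.
   Context: $\Delta_g$ is the (negative) Laplace–Beltrami operator and $dV_g$ the Riemannian volume measure. $Z_{\phi}=\{x\in M:\phi(x)=0\}$ is the nodal set and $dS=d\mathcal H^{n-1}$ ($n=\dim M$) is the Riemannian hypersurface measure on it; the measure $|\nabla\phi|\,dS|_{Z_\phi}$ is $f\mapsto\int_{Z_\phi}f|\nabla\phi|\,dS$. The sequence is an infinite sequence of elements of an orthonormal basis of eigenfunctions, so $\lambda_j\to\infty$. It is called $L^\infty$ quantum ergodic on the base if $$\int_M f\,\phi_{\lambda_j}^2\,dV_g\to\frac{1}{\mathrm{Vol}(M)}\int_M f\,dV_g\qquad\text{for all } f\in L^\infty(M).$$ *)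

theory Defs
  imports "HOL-Analysis.Analysis"
begin

text \<open>
  A manifold is a whole type of class \<open>t2_space\<close> and \<open>second_countable_topology\<close> together with an
  atlas \<open>A\<close> of charts \<open>c = (U, x)\<close>, where \<open>x\<close> maps the open set \<open>U\<close> onto an open subset of
  \<open>real ^ 'n\<close>; the dimension is \<open>CARD('n) \<ge> 1\<close> and there is no boundary.
\<close>

type_synonym ('a, 'n) chart = "'a set \<times> ('a \<Rightarrow> real ^ 'n)"

definition coord_rep :: "('a, 'n::finite) chart \<Rightarrow> ('a \<Rightarrow> 'b) \<Rightarrow> real ^ 'n \<Rightarrow> 'b" where
  "coord_rep c f = (\<lambda>y. f (inv_into (fst c) (snd c) y))"

definition partial :: "'n::finite \<Rightarrow> (real ^ 'n \<Rightarrow> real) \<Rightarrow> real ^ 'n \<Rightarrow> real" where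
  "partial i f y = frechet_derivative f (at y) (axis i 1)"

text \<open>\<open>C_on k S f\<close> is used for open \<open>S\<close> only.\<close>

fun C_on :: "nat \<Rightarrow> (real ^ 'n::finite) set \<Rightarrow> (real ^ 'n \<Rightarrow> real) \<Rightarrow> bool" where
  "C_on 0 S f \<longleftrightarrow> continuous_on S f"
| "C_on (Suc k) S f \<longleftrightarrow> f differentiable_on S \<and> (\<forall>i. C_on k S (partial i f))"

definition smooth_on :: "(real ^ 'n::finite) set \<Rightarrow> (real ^ 'n \<Rightarrow> real) \<Rightarrow> bool" where
  "smooth_on S f \<longleftrightarrow> (\<forall>k. C_on k S f)"

definition is_chart :: "('a::topological_space, 'n::finite) chart \<Rightarrow> bool" where
  "is_chart c \<longleftrightarrow> open (fst c) \<and> open (snd c ` fst c) \<and>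
     homeomorphism (fst c) (snd c ` fst c) (snd c) (inv_into (fst c) (snd c))"

definition smooth_atlas :: "('a::topological_space, 'n::finite) chart set \<Rightarrow> bool" where
  "smooth_atlas A \<longleftrightarrow> (\<forall>c\<in>A. is_chart c) \<and> (\<Union>c\<in>A. fst c) = UNIV \<and>
     (\<forall>c\<in>A. \<forall>c'\<in>A. \<forall>i. smooth_on (snd c ` (fst c \<inter> fst c')) (coord_rep c (\<lambda>p. snd c' p $ i)))"

definition smooth_fun :: "('a, 'n::finite) chart set \<Rightarrow> ('a \<Rightarrow> real) \<Rightarrow> bool" where
  "smooth_fun A f \<longleftrightarrow> (\<forall>c\<in>A. smooth_on (snd c ` fst c) (coord_rep c f))"

text \<open>
  A Riemannian metric is given by its Gram matrices: \<open>G c p\<close> is the matrix of \<open>g\<close> at \<open>p\<close> in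
  the coordinate frame of the chart \<open>c\<close>. The last condition is the transformation law of a
  covariant 2-tensor.
\<close>

definition riemannian_metric ::
  "('a, 'n::finite) chart set \<Rightarrow> (('a, 'n) chart \<Rightarrow> 'a \<Rightarrow> real ^ 'n ^ 'n) \<Rightarrow> bool" where
  "riemannian_metric A G \<longleftrightarrow>
     (\<forall>c\<in>A. \<forall>i j. smooth_on (snd c ` fst c) (coord_rep c (\<lambda>p. G c p $ i $ j))) \<and>
     (\<forall>c\<in>A. \<forall>p\<in>fst c. transpose (G c p) = G c p \<and> (\<forall>v. v \<noteq> 0 \<longrightarrow> v \<bullet> (G c p *v v) > 0)) \<and>
     (\<forall>c\<in>A. \<forall>c'\<in>A. \<forall>p\<in>fst c \<inter> fst c'.
        let J = matrix (frechet_derivative (coord_rep c (snd c')) (at (snd c p)))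
        in G c p = transpose J ** G c' p ** J)"

text \<open>
  The expression of \<open>\<Delta>\<^sub>g f\<close> in the chart \<open>c\<close>,
  \<open>|g|\<^sup>-\<^sup>1\<^sup>/\<^sup>2 \<partial>\<^sub>i (|g|\<^sup>1\<^sup>/\<^sup>2 g\<^sup>i\<^sup>j \<partial>\<^sub>j f)\<close>; for \<open>c\<close> around \<open>p\<close> its value at \<open>p\<close> does not depend on \<open>c\<close>.
\<close>

definition laplace_beltrami_in ::
  "(('a, 'n::finite) chart \<Rightarrow> 'a \<Rightarrow> real ^ 'n ^ 'n) \<Rightarrow> ('a, 'n) chart \<Rightarrow> ('a \<Rightarrow> real) \<Rightarrow> 'a \<Rightarrow> real"
where
  "laplace_beltrami_in G c f p =
     (1 / sqrt (det (G c p))) *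
     (\<Sum>i\<in>UNIV. partial i (\<lambda>y. sqrt (det (coord_rep c (G c) y)) *
         (\<Sum>j\<in>UNIV. matrix_inv (coord_rep c (G c) y) $ i $ j * partial j (coord_rep c f) y))
       (snd c p))"

definition eigenfunction ::
  "('a, 'n::finite) chart set \<Rightarrow> (('a, 'n) chart \<Rightarrow> 'a \<Rightarrow> real ^ 'n ^ 'n) \<Rightarrow> ('a \<Rightarrow> real) \<Rightarrow> real \<Rightarrow> bool"
where
  "eigenfunction A G f l \<longleftrightarrow> smooth_fun A f \<and> l \<ge> 0 \<and>
     (\<forall>c\<in>A. \<forall>p\<in>fst c. laplace_beltrami_in G c f p = - l\<^sup>2 * f p)"

text \<open>The quantities below that use \<open>chart_at\<close> do not depend on the chosen chart.\<close>

definition chart_at :: "('a, 'n::finite) chart set \<Rightarrow> 'a \<Rightarrow> ('a, 'n) chart" where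
  "chart_at A p = (SOME c. c \<in> A \<and> p \<in> fst c)"

definition grad_norm ::
  "('a, 'n::finite) chart set \<Rightarrow> (('a, 'n) chart \<Rightarrow> 'a \<Rightarrow> real ^ 'n ^ 'n) \<Rightarrow> ('a \<Rightarrow> real) \<Rightarrow> 'a \<Rightarrow> real"
where
  "grad_norm A G f p =
     (let c = chart_at A p; df = (\<lambda>i. partial i (coord_rep c f) (snd c p))
      in sqrt (\<Sum>i\<in>UNIV. \<Sum>j\<in>UNIV. matrix_inv (G c p) $ i $ j * df i * df j))"

text \<open>
  The Riemannian volume measure is the unique Borel measure with \<open>dV\<^sub>g = |g|\<^sup>1\<^sup>/\<^sup>2 dx\<close> in every chart.
\<close>

definition riemannian_volume ::
  "('a::topological_space, 'n::finite) chart set \<Rightarrow> (('a, 'n) chart \<Rightarrow> 'a \<Rightarrow> real ^ 'n ^ 'n) \<Rightarrow>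
   'a measure \<Rightarrow> bool"
where
  "riemannian_volume A G V \<longleftrightarrow> sets V = sets borel \<and>
     (\<forall>c\<in>A. \<forall>B\<in>sets borel. B \<subseteq> fst c \<longrightarrow>
        emeasure V B = (\<integral>\<^sup>+y\<in>snd c ` B. ennreal (sqrt (det (coord_rep c (G c) y))) \<partial>lborel))"

definition piecewise_C1_curve ::
  "('a::topological_space, 'n::finite) chart set \<Rightarrow> (real \<Rightarrow> 'a) \<Rightarrow> bool" where
  "piecewise_C1_curve A \<gamma> \<longleftrightarrow> continuous_on {0..1} \<gamma> \<and>
     (\<forall>c\<in>A. \<forall>a b. 0 \<le> a \<and> a < b \<and> b \<le> 1 \<and> \<gamma> ` {a..b} \<subseteq> fst c \<longrightarrow>
        (snd c \<circ> \<gamma>) piecewise_C1_differentiable_on {a..b})"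

definition curve_length ::
  "('a, 'n::finite) chart set \<Rightarrow> (('a, 'n) chart \<Rightarrow> 'a \<Rightarrow> real ^ 'n ^ 'n) \<Rightarrow> (real \<Rightarrow> 'a) \<Rightarrow> ennreal"
where
  "curve_length A G \<gamma> =
     (\<integral>\<^sup>+t\<in>{0..1}. (let c = chart_at A (\<gamma> t); v = vector_derivative (snd c \<circ> \<gamma>) (at t)
                    in ennreal (sqrt (v \<bullet> (G c (\<gamma> t) *v v)))) \<partial>lborel)"

definition riemannian_dist ::
  "('a::topological_space, 'n::finite) chart set \<Rightarrow> (('a, 'n) chart \<Rightarrow> 'a \<Rightarrow> real ^ 'n ^ 'n) \<Rightarrow>
   'a \<Rightarrow> 'a \<Rightarrow> ennreal"
where
  "riemannian_dist A G p q =
     (INF \<gamma>\<in>{\<gamma>. piecewise_C1_curve A \<gamma> \<and> \<gamma> 0 = p \<and> \<gamma> 1 = q}. curve_length A G \<gamma>)"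

definition set_diam :: "('a \<Rightarrow> 'a \<Rightarrow> ennreal) \<Rightarrow> 'a set \<Rightarrow> ennreal" where
  "set_diam d S = (SUP p\<in>S. SUP q\<in>S. d p q)"

text \<open>
  The factor \<open>unit_ball_vol s / 2 ^ s\<close> normalizes the \<open>s\<close>-dimensional Hausdorff measure to agree
  with \<open>s\<close>-dimensional Riemannian measure. For \<open>s = 0\<close> this is counting measure, because
  \<open>0 ^ 0 = 1\<close> and empty sets are given weight \<open>0\<close>.
\<close>

definition hausdorff_outer :: "('a \<Rightarrow> 'a \<Rightarrow> ennreal) \<Rightarrow> nat \<Rightarrow> 'a set \<Rightarrow> ennreal" where
  "hausdorff_outer d s E =
     (SUP \<delta>\<in>{0<..}. INF C\<in>{C :: nat \<Rightarrow> 'a set. E \<subseteq> (\<Union>i. C i) \<and> (\<forall>i. set_diam d (C i) \<le> \<delta>)}.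
        \<Sum>i. if C i = {} then 0
             else ennreal (unit_ball_vol (real s) / 2 ^ s) * set_diam d (C i) ^ s)"

definition hausdorff_measure ::
  "('a::topological_space \<Rightarrow> 'a \<Rightarrow> ennreal) \<Rightarrow> nat \<Rightarrow> 'a measure" where
  "hausdorff_measure d s = measure_of UNIV (sets borel) (hausdorff_outer d s)"

definition nodal_set :: "('a \<Rightarrow> real) \<Rightarrow> 'a set" where
  "nodal_set f = {p. f p = 0}"

text \<open>The measure \<open>|\<nabla>f| dS\<close> on the nodal set of \<open>f\<close>, extended by zero to the manifold.\<close>

definition grad_nodal_measure ::
  "('a::topological_space, 'n::finite) chart set \<Rightarrow> (('a, 'n) chart \<Rightarrow> 'a \<Rightarrow> real ^ 'n ^ 'n) \<Rightarrow>
   ('a \<Rightarrow> real) \<Rightarrow> 'a measure"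
where
  "grad_nodal_measure A G f =
     density (hausdorff_measure (riemannian_dist A G) (CARD('n) - 1))
       (\<lambda>p. ennreal (grad_norm A G f p) * indicator (nodal_set f) p)"

definition square_integrable :: "'a measure \<Rightarrow> ('a \<Rightarrow> real) \<Rightarrow> bool" where
  "square_integrable V f \<longleftrightarrow> f \<in> borel_measurable V \<and> integrable V (\<lambda>p. (f p)\<^sup>2)"

definition orthonormal_eigenbasis ::
  "('a, 'n::finite) chart set \<Rightarrow> (('a, 'n) chart \<Rightarrow> 'a \<Rightarrow> real ^ 'n ^ 'n) \<Rightarrow>
   'a measure \<Rightarrow> (nat \<Rightarrow> 'a \<Rightarrow> real) \<Rightarrow> (nat \<Rightarrow> real) \<Rightarrow> bool"
where
  "orthonormal_eigenbasis A G V e l \<longleftrightarrow>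
     (\<forall>k. eigenfunction A G (e k) (l k)) \<and>
     (\<forall>k. square_integrable V (e k)) \<and>
     (\<forall>k m. (\<integral>p. e k p * e m p \<partial>V) = (if k = m then 1 else 0)) \<and>
     (\<forall>f. square_integrable V f \<longrightarrow>
        (\<lambda>N. \<integral>p. (f p - (\<Sum>k<N. (\<integral>q. f q * e k q \<partial>V) * e k p))\<^sup>2 \<partial>V) \<longlonglongrightarrow> 0)"

definition Linfty_quantum_ergodic :: "'a measure \<Rightarrow> (nat \<Rightarrow> 'a \<Rightarrow> real) \<Rightarrow> bool" where
  "Linfty_quantum_ergodic V \<phi> \<longleftrightarrow>
     (\<forall>f\<in>borel_measurable V. (\<exists>B. AE p in V. \<bar>f p\<bar> \<le> B) \<longrightarrow>
        (\<lambda>j. \<integral>p. f p * (\<phi> j p)\<^sup>2 \<partial>V) \<longlonglongrightarrow> (1 / measure V (space V)) * (\<integral>p. f p \<partial>V))"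

text \<open>
  Integrability of the test function is part of convergence, since the Bochner integral of a
  non-integrable function is \<open>0\<close> by convention. Weak* limits of positive measures on a compact
  manifold are finite positive Borel measures.
\<close>

definition weak_star_limit :: "(nat \<Rightarrow> 'a::topological_space measure) \<Rightarrow> 'a measure \<Rightarrow> bool" where
  "weak_star_limit \<mu> \<nu> \<longleftrightarrow> sets \<nu> = sets borel \<and> finite_measure \<nu> \<and>
     (\<forall>f :: 'a \<Rightarrow> real. continuous_on UNIV f \<longrightarrow>
        (\<forall>\<^sub>F j in sequentially. integrable (\<mu> j) f) \<and>
        (\<lambda>j. \<integral>p. f p \<partial>\<mu> j) \<longlonglongrightarrow> (\<integral>p. f p \<partial>\<nu>))"

end

theory Submission
  imports Defs "HOL-Real_Asymp.Real_Asymp"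
begin

text \<open>
  Green's identity for \<open>h(\<phi>) \<nabla>\<phi>\<close>, with \<open>h\<close> approximating the sign function, expresses \<open>\<lambda>\<^sup>2 \<integral>|\<phi>|\<close> as
  the limit of \<open>\<integral> h'(\<phi>) |\<nabla>\<phi>|\<^sup>2\<close>, which concentrates on the nodal set. No regularity of the nodal set
  is needed to bound this limit by a constant times \<open>\<integral>\<^sub>Z |\<nabla>\<phi>| dS\<close>: the part with \<open>|\<nabla>\<phi>|\<close> small is
  negligible because \<open>\<Delta>\<phi> = 0\<close> almost everywhere on \<open>{\<nabla>\<phi> = 0}\<close>, and the rest of the nodal set is covered
  by balls nearly optimal for the Hausdorff measure; localized to a ball of radius \<open>r\<close> about \<open>p\<close>, Green's
  identity bounds the integral by \<open>r\<^sup>n\<^sup>-\<^sup>1 |\<nabla>\<phi>(p)|\<close> up to a constant that depends on the manifold only.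
  Quantum ergodicity keeps \<open>\<integral>|\<phi>\<^sub>j|\<close> away from \<open>0\<close>, and the eigenvalue \<open>0\<close> occurs at most once.
\<close>

section \<open>Differential calculus in coordinates\<close>

text \<open>The sharp formula \<open>\<lambda>^2 \<integral>|\<phi>| = 2 \<integral>_Z
  |\<nabla>\<phi>| dS\<close> would need the divergence theorem on nodal domains, whose boundaries
  may be singular. A lower bound on the mass tolerates a multiplicative loss, provided it is the
  same for all eigenfunctions, and this dictates how constants are organized. Those in the final
  bound depend on charts and compact sets only. Those depending on the eigenfunction (its size,
  eigenvalue, second derivatives) either just justify dominated convergence or come with a factor
  that can be made small: a ball radius, or \<open>1/k\<close> in the choice
  \<open>h(t) = arctan (k t)\<close>. The second-order error in a ball is absorbed by the gradient
  at the centre only where this gradient is bounded below; hence points with small gradient need an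
  argument of their own. In the lower bound for \<open>\<integral>|\<phi>|\<close> the full strength
  of L^infinity test functions matters, because the set on which ergodicity is tested is merely
  measurable.\<close>

definition C1 :: "(real ^ 'n::finite) set \<Rightarrow> (real ^ 'n \<Rightarrow> real) \<Rightarrow> bool" where
  "C1 S f \<longleftrightarrow> (\<forall>x\<in>S. f differentiable (at x)) \<and> (\<forall>i. continuous_on S (partial i f))"

definition gradv :: "(real ^ 'n::finite \<Rightarrow> real) \<Rightarrow> real ^ 'n \<Rightarrow> real ^ 'n" where
  "gradv f y = (\<chi> i. partial i f y)"

text \<open>Smooth data enter only through this class, because the bumps, cut-offs and partition
  functions built from \<open>(max 0 t)^2\<close> are just once continuously differentiable. First
  partials must be \<open>C1\<close> as well, since Green's identity differentiates the
  flux.\<close>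

lemma smooth_on_C1:
  fixes S :: "(real ^ 'a::finite) set"
  assumes "smooth_on S f" "open S"
  shows "C1 S f" "C1 S (partial i f)"
proof -
  have "C_on (Suc 0) S f" "C_on (Suc (Suc 0)) S f" using assms(1) unfolding smooth_on_def by blast+
  moreover have "g differentiable_on S \<longleftrightarrow> (\<forall>x\<in>S. g differentiable (at x))" for g :: "real ^ 'a \<Rightarrow> real"
    using assms(2) by (simp add: differentiable_on_eq_differentiable_at)
  ultimately show "C1 S f" "C1 S (partial i f)"
    unfolding C1_def by simp_all
qed

lemma C1_differentiable: "C1 S f \<Longrightarrow> x \<in> S \<Longrightarrow> f differentiable (at x)"
  by (simp add: C1_def)

lemma C1_continuous_partial: "C1 S f \<Longrightarrow> continuous_on S (partial i f)"
  by (simp add: C1_def)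

lemma C1_continuous: "C1 S f \<Longrightarrow> continuous_on S f"
  by (intro continuous_at_imp_continuous_on ballI differentiable_imp_continuous_within)
     (simp add: C1_def)

lemma C1_subset: "C1 S f \<Longrightarrow> T \<subseteq> S \<Longrightarrow> C1 T f"
  unfolding C1_def using continuous_on_subset by blast

lemma C1_open_Un: "open S \<Longrightarrow> open T \<Longrightarrow> C1 S f \<Longrightarrow> C1 T f \<Longrightarrow> C1 (S \<union> T) f"
  unfolding C1_def by (metis UnE continuous_on_open_Un)

lemma partial_eqI: "(f has_derivative f') (at y) \<Longrightarrow> partial i f y = f' (axis i 1)"
  unfolding partial_def by (simp add: frechet_derivative_at[symmetric])

text \<open>A linear map is determined by its values on the axis vectors, and these are the partial
  derivatives.\<close>

lemma frechet_gradv: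
  assumes "f differentiable (at y)"
  shows "(f has_derivative (\<lambda>v. gradv f y \<bullet> v)) (at y)"
proof -
  let ?f = "frechet_derivative f (at y)"
  have d: "(f has_derivative ?f) (at y)" using assms frechet_derivative_works by blast
  then have l: "linear ?f" using has_derivative_linear by blast
  have "?f v = gradv f y \<bullet> v" for v
  proof -
    have "?f v = ?f (\<Sum>i\<in>UNIV. v$i *\<^sub>R axis i 1)"
      using basis_expansion[of v] by (simp add: scalar_mult_eq_scaleR)
    also have "\<dots> = (\<Sum>i\<in>UNIV. v$i * ?f (axis i 1))"
      by (simp add: linear_sum[OF l] linear_scale[OF l])
    finally show ?thesis by (simp add: inner_vec_def gradv_def partial_def mult.commute)
  qed
  then have "?f = (\<lambda>v. gradv f y \<bullet> v)" by (rule ext)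
  with d show ?thesis by simp
qed

lemma inner_axis_right: "(v::real^'n) \<bullet> axis i 1 = v $ i"
  by (simp add: inner_axis)

lemma gradv_nth [simp]: "gradv f y $ i = partial i f y" by (simp add: gradv_def)

text \<open>\<open>frechet_derivative\<close> is a choice from the set of derivatives, and this set
  depends only on the germ of the function; so the equality also covers points where neither
  function is differentiable.\<close>

lemma partial_cong_open:
  assumes "open S" "y \<in> S" "\<And>x. x \<in> S \<Longrightarrow> f x = g x"
  shows "partial i f y = partial i g y"
proof -
  have "(f has_derivative f') (at y) \<longleftrightarrow> (g has_derivative f') (at y)" for f'
    using assms has_derivative_transform_within_open by metis
  then show ?thesis unfolding partial_def frechet_derivative_def by simp
qed

lemma C1_cong_open:
  assumes "open S" "C1 S g" "\<And>x. x \<in> S \<Longrightarrow> f x = g x"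
  shows "C1 S f"
proof -
  have "partial i f y = partial i g y" if "y \<in> S" for i y
    using partial_cong_open assms that by metis
  moreover have "f differentiable (at y)" if "y \<in> S" for y
    using assms that unfolding C1_def differentiable_def
    by (metis has_derivative_transform_within_open)
  ultimately show ?thesis using assms(2) unfolding C1_def
    by (metis (no_types, lifting) continuous_on_cong)
qed

lemma C1I:
  assumes "\<And>y. y \<in> S \<Longrightarrow> f differentiable (at y)"
    and "\<And>i y. y \<in> S \<Longrightarrow> partial i f y = g i y"
    and "\<And>i. continuous_on S (g i)"
  shows "C1 S f"
  unfolding C1_def using assms by (metis (no_types, lifting) continuous_on_eq)

lemma partial_const [simp]: "partial i (\<lambda>y. k) y = 0"
  using partial_eqI[OF has_derivative_const[of k "at y"]] by simp

lemma partial_add: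
  assumes "f differentiable (at y)" "g differentiable (at y)"
  shows "partial i (\<lambda>y. f y + g y) y = partial i f y + partial i g y"
  using partial_eqI[OF has_derivative_add[OF frechet_gradv[OF assms(1)] frechet_gradv[OF assms(2)]], of i]
  by (simp only: inner_axis_right gradv_nth)

lemma partial_diff:
  assumes "f differentiable (at y)" "g differentiable (at y)"
  shows "partial i (\<lambda>y. f y - g y) y = partial i f y - partial i g y"
  using partial_eqI[OF has_derivative_diff[OF frechet_gradv[OF assms(1)] frechet_gradv[OF assms(2)]], of i]
  by (simp only: inner_axis_right gradv_nth)

lemma partial_mult:
  assumes "f differentiable (at y)" "g differentiable (at y)"
  shows "partial i (\<lambda>y. f y * g y) y = f y * partial i g y + partial i f y * g y"
  using partial_eqI[OF has_derivative_mult[OF frechet_gradv[OF assms(1)] frechet_gradv[OF assms(2)]], of i]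
  by (simp only: inner_axis_right gradv_nth)

lemma partial_sum:
  assumes "\<And>k. k \<in> I \<Longrightarrow> f k differentiable (at y)"
  shows "partial i (\<lambda>y. \<Sum>k\<in>I. f k y) y = (\<Sum>k\<in>I. partial i (f k) y)"
  using partial_eqI[OF has_derivative_sum[of I f "\<lambda>k v. gradv (f k) y \<bullet> v", OF frechet_gradv[OF assms]], of i]
  by (simp only: inner_axis_right gradv_nth)

lemma partial_compose:
  assumes "f differentiable (at y)" "(h has_real_derivative h') (at (f y))"
  shows "partial i (\<lambda>y. h (f y)) y = h' * partial i f y"
    and "(\<lambda>y. h (f y)) differentiable (at y)"
proof -
  have "((\<lambda>y. h (f y)) has_derivative (\<lambda>v. h' * (gradv f y \<bullet> v))) (at y)"
    using has_derivative_compose[OF frechet_gradv[OF assms(1)]] assms(2)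
    unfolding has_field_derivative_def by blast
  then show "partial i (\<lambda>y. h (f y)) y = h' * partial i f y"
      "(\<lambda>y. h (f y)) differentiable (at y)"
    using partial_eqI[of "\<lambda>y. h (f y)" "\<lambda>v. h' * (gradv f y \<bullet> v)" y i]
    by (simp_all only: inner_axis_right gradv_nth) (auto simp: differentiable_def)
qed

lemma C1_const [intro]: "C1 S (\<lambda>y. k)"
  by (simp add: C1_def)

lemma C1_add:
  assumes "C1 S f" "C1 S g" shows "C1 S (\<lambda>y. f y + g y)"
  by (rule C1I[where g="\<lambda>i y. partial i f y + partial i g y"])
     (use assms in \<open>auto simp: C1_def intro: partial_add continuous_on_add\<close>)

lemma C1_diff:
  assumes "C1 S f" "C1 S g" shows "C1 S (\<lambda>y. f y - g y)"
  by (rule C1I[where g="\<lambda>i y. partial i f y - partial i g y"])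
     (use assms in \<open>auto simp: C1_def intro: partial_diff continuous_on_diff\<close>)

lemma C1_mult:
  assumes "C1 S f" "C1 S g" shows "C1 S (\<lambda>y. f y * g y)"
  by (rule C1I[where g="\<lambda>i y. f y * partial i g y + partial i f y * g y"])
     (use assms C1_continuous[OF assms(1)] C1_continuous[OF assms(2)]
       in \<open>auto simp: C1_def intro!: partial_mult continuous_on_mult continuous_on_add\<close>)

lemma C1_sum: "(\<And>k. k \<in> I \<Longrightarrow> C1 S (f k)) \<Longrightarrow> C1 S (\<lambda>y. \<Sum>k\<in>I. f k y)"
  by (induction I rule: infinite_finite_induct) (auto intro: C1_add)

lemma C1_prod: "(\<And>k. k \<in> I \<Longrightarrow> C1 S (f k)) \<Longrightarrow> C1 S (\<lambda>y. \<Prod>k\<in>I. f k y)"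
  by (induction I rule: infinite_finite_induct) (auto intro: C1_mult)

lemma C1_compose:
  assumes f: "C1 S f" and h: "\<And>y. y \<in> S \<Longrightarrow> (h has_real_derivative h' (f y)) (at (f y))"
    and c: "continuous_on (f ` S) h'"
  shows "C1 S (\<lambda>y. h (f y))"
proof -
  have "continuous_on S (\<lambda>y. h' (f y) * partial i f y)" for i
    by (intro continuous_on_mult continuous_on_compose2[OF c C1_continuous[OF f]]
        C1_continuous_partial[OF f]) auto
  then show ?thesis
    using partial_compose[OF C1_differentiable[OF f] h]
    by (intro C1I[where g="\<lambda>i y. h' (f y) * partial i f y"]) auto
qed

lemma C1_inverse:
  assumes "C1 S f" "\<And>y. y \<in> S \<Longrightarrow> f y \<noteq> 0"
  shows "C1 S (\<lambda>y. 1 / f y)"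
  by (rule C1_compose[where h' = "\<lambda>t. - 1 / t\<^sup>2", OF assms(1)])
     (use assms(2) in \<open>auto intro!: derivative_eq_intros continuous_intros simp: power2_eq_square\<close>)

lemma C1_divide:
  assumes "C1 S f" "C1 S g" "\<And>y. y \<in> S \<Longrightarrow> g y \<noteq> 0"
  shows "C1 S (\<lambda>y. f y / g y)"
  using C1_mult[OF assms(1) C1_inverse[OF assms(2,3)]] by simp

lemma C1_sqrt:
  assumes "C1 S f" "\<And>y. y \<in> S \<Longrightarrow> f y > 0"
  shows "C1 S (\<lambda>y. sqrt (f y))"
proof (rule C1_compose[where h' = "\<lambda>t. inverse (sqrt t) / 2", OF assms(1)])
  show "(sqrt has_real_derivative inverse (sqrt (f y)) / 2) (at (f y))" if "y \<in> S" for y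
    using DERIV_real_sqrt assms(2)[OF that] by blast
  show "continuous_on (f ` S) (\<lambda>t. inverse (sqrt t) / 2)"
  proof -
    have "sqrt t \<noteq> 0" if "t \<in> f ` S" for t using that assms(2) by fastforce
    then show ?thesis by (auto intro!: continuous_intros)
  qed
qed

lemma C1_det:
  assumes "\<And>i j. C1 S (\<lambda>y. M y $ i $ j)"
  shows "C1 S (\<lambda>y. det (M y :: real ^ 'n::finite ^ 'n))"
  unfolding det_def by (intro C1_sum C1_mult C1_const C1_prod assms)

text \<open>The open sets \<open>W\<close> and \<open>- K\<close> cover the space, and on the second
  the function vanishes.\<close>

lemma C1_extend_zero:
  assumes "C1 W f" "open W" "compact K" "K \<subseteq> W" "\<And>y. y \<notin> K \<Longrightarrow> f y = 0"
  shows "C1 UNIV f"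
proof -
  have o: "open (- K)" using assms(3) compact_imp_closed by blast
  have "C1 (- K) f" by (rule C1_cong_open[OF o C1_const]) (use assms in auto)
  then have "C1 (W \<union> - K) f" using C1_open_Un assms o by blast
  moreover have "W \<union> - K = UNIV" using assms(4) by auto
  ultimately show ?thesis by simp
qed

text \<open>Coordinate expressions have arbitrary values outside the chart image \<open>W\<close>. A
  factor \<open>f\<close> carried by a compact subset of \<open>W\<close> hides them, so that the
  product can be integrated over the whole space.\<close>

lemma C1_mult_extend_zero:
  assumes "C1 UNIV f" "C1 W g" "open W" "compact K" "K \<subseteq> W" "\<And>y. y \<notin> K \<Longrightarrow> f y = 0"
  shows "C1 UNIV (\<lambda>y. f y * g y)"
  by (rule C1_extend_zero[OF C1_mult[OF C1_subset[OF assms(1) subset_UNIV] assms(2)] assms(3,4,5)])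
     (use assms in auto)

lemma partial_zero_off:
  assumes "compact K" "\<And>y. y \<notin> K \<Longrightarrow> f y = 0" "y \<notin> K"
  shows "partial i f y = 0"
proof -
  have "partial i f y = partial i (\<lambda>y. 0) y"
    by (rule partial_cong_open[of "- K"]) (use assms compact_imp_closed in auto)
  then show ?thesis by simp
qed

lemma continuous_on_mult_extend_zero:
  fixes f g :: "'b::t2_space \<Rightarrow> real"
  assumes "continuous_on UNIV f" "continuous_on W g" "open W" "compact K" "K \<subseteq> W"
    "\<And>y. y \<notin> K \<Longrightarrow> f y = 0"
  shows "continuous_on UNIV (\<lambda>y. f y * g y)"
proof -
  have o: "open (- K)" using assms(4) compact_imp_closed by blast
  have "continuous_on (- K) (\<lambda>y. f y * g y)"
    by (rule continuous_on_cong[THEN iffD1, OF refl _ continuous_on_const[of _ 0]])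
       (use assms(6) in auto)
  moreover have "continuous_on W (\<lambda>y. f y * g y)"
    using assms by (auto intro!: continuous_intros intro: continuous_on_subset)
  ultimately have "continuous_on (W \<union> - K) (\<lambda>y. f y * g y)"
    using continuous_on_open_Un assms o by blast
  moreover have "W \<union> - K = UNIV" using assms(5) by auto
  ultimately show ?thesis by simp
qed

lemma continuous_compact_support_integrable:
  fixes f :: "'b::euclidean_space \<Rightarrow> real"
  assumes "continuous_on UNIV f" "compact K" "\<And>y. y \<notin> K \<Longrightarrow> f y = 0"
  shows "integrable lborel f"
proof -
  have "integrable lborel (\<lambda>x. indicator K x *\<^sub>R f x)"
    using borel_integrable_compact[OF assms(2), of f] assms(1) continuous_on_subset by blast
  moreover have "(\<lambda>x. indicator K x *\<^sub>R f x) = f"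
    using assms(3) by (force simp: indicator_def)
  ultimately show ?thesis by simp
qed

text \<open>Integrals are translation invariant, so the difference quotients of \<open>F\<close> integrate to zero;
  they converge boundedly to the partial derivative.\<close>

lemma integral_partial_eq_0:
  fixes F :: "real ^ 'n::finite \<Rightarrow> real"
  assumes F: "C1 UNIV F" and K: "compact K" and 0: "\<And>y. y \<notin> K \<Longrightarrow> F y = 0"
  shows "(\<integral>y. partial i F y \<partial>lborel) = 0"
proof -
  define e :: "real ^ 'n" where "e = axis i 1"
  have e: "norm e = 1" unfolding e_def by (simp add: norm_axis_1)
  have cp: "continuous_on UNIV (partial i F)" using F by (simp add: C1_def)
  have cF: "continuous_on UNIV F" using C1_continuous[OF F] .
  obtain M where M: "\<And>y. \<bar>partial i F y\<bar> \<le> M" "M \<ge> 0"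
  proof -
    have "bounded (partial i F ` K)"
      using compact_continuous_image[OF continuous_on_subset[OF cp] K] compact_imp_bounded by blast
    then obtain M where "\<And>y. y \<in> K \<Longrightarrow> \<bar>partial i F y\<bar> \<le> M"
      unfolding bounded_iff by auto
    then have "\<bar>partial i F y\<bar> \<le> max M 0" for y
      using partial_zero_off[where y=y and i=i, OF K 0] by (cases "y \<in> K") (auto intro: max.coboundedI1)
    then show thesis using that[of "max M 0"] by simp
  qed
  have deriv: "((\<lambda>t. F (y + t *\<^sub>R e)) has_real_derivative partial i F (y + t *\<^sub>R e)) (at t)" for y t
    proof -
      have "(F has_derivative (\<lambda>v. gradv F (y + t *\<^sub>R e) \<bullet> v)) (at (y + t *\<^sub>R e))"
        by (rule frechet_gradv) (use F in \<open>simp add: C1_def\<close>)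
      moreover have "((\<lambda>t. y + t *\<^sub>R e) has_derivative (\<lambda>s. s *\<^sub>R e)) (at t)"
        by (auto intro!: derivative_eq_intros)
      ultimately have "((\<lambda>t. F (y + t *\<^sub>R e)) has_derivative
          (\<lambda>s. gradv F (y + t *\<^sub>R e) \<bullet> (s *\<^sub>R e))) (at t)"
        using has_derivative_compose[where g=F and f="\<lambda>t. y + t *\<^sub>R e"
            and f'="\<lambda>s. s *\<^sub>R e" and g'="\<lambda>v. gradv F (y + t *\<^sub>R e) \<bullet> v" and x=t and s=UNIV] by blast
      moreover have "(\<lambda>s. gradv F (y + t *\<^sub>R e) \<bullet> (s *\<^sub>R e)) = (*) (partial i F (y + t *\<^sub>R e))"
        by (auto simp: e_def inner_axis_right mult.commute)
      ultimately show ?thesis unfolding has_field_derivative_def by simp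
    qed
  have lip: "\<bar>F (y + h *\<^sub>R e) - F y\<bar> \<le> M * \<bar>h\<bar>" for y h
  proof -
    have "norm (F (y + h *\<^sub>R e) - F (y + 0 *\<^sub>R e)) \<le> M * norm (h - 0)"
      by (intro field_differentiable_bound[of UNIV "\<lambda>t. F (y + t *\<^sub>R e)"
          "\<lambda>t. partial i F (y + t *\<^sub>R e)"] convex_UNIV UNIV_I)
         (simp_all add: M deriv del: add_0_right)
    then show ?thesis by simp
  qed
  obtain R where R: "K \<subseteq> ball 0 R" using bounded_subset_ballD[OF compact_imp_bounded[OF K]] by blast
  define q where "q k y = (F (y + (1 / real (Suc k)) *\<^sub>R e) - F y) * real (Suc k)" for k y
  have intF: "integrable lborel F" using continuous_compact_support_integrable[OF cF K 0] .
  have mF: "F \<in> borel_measurable borel" using cF by (rule borel_measurable_continuous_onI)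
  have mq: "q k \<in> borel_measurable lborel" for k unfolding q_def using mF by measurable
  have q0: "(\<integral>y. q k y \<partial>lborel) = 0" for k
  proof -
    define t where "t = (1 / real (Suc k)) *\<^sub>R e"
    have it: "integrable lborel (\<lambda>y. F (t + y))"
      using integrable_distr_eq[where g="(+) t" and M=lborel and N=borel and f=F] intF mF
      by (simp add: lborel_distr_plus)
    have eq: "(\<integral>y. F (t + y) \<partial>lborel) = (\<integral>y. F y \<partial>lborel)"
      using integral_distr[where g="(+) t" and M=lborel and N=borel and f=F] mF
      by (simp add: lborel_distr_plus)
    have "(\<integral>y. q k y \<partial>lborel) = (\<integral>y. F (t + y) - F y \<partial>lborel) * real (Suc k)"
      unfolding q_def t_def by (simp add: add.commute)
    also have "\<dots> = 0" using it eq intF by simp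
    finally show ?thesis .
  qed
  \<comment> \<open>The shifts have length at most 1, so every difference quotient vanishes outside
    the ball of radius \<open>R + 1\<close>; inside, it is at most \<open>M\<close> by
    \<open>lip\<close>.\<close>
  have "(\<lambda>k. \<integral>y. q k y \<partial>lborel) \<longlonglongrightarrow> (\<integral>y. partial i F y \<partial>lborel)"
  proof (rule integral_dominated_convergence[where w = "\<lambda>y. M * indicator (ball 0 (R + 1)) y"])
    show "partial i F \<in> borel_measurable lborel"
      using borel_measurable_continuous_onI[OF cp] by simp
    show "integrable lborel (\<lambda>y. M * indicator (ball (0::real^'n) (R + 1)) y)"
      by (intro integrable_mult_right integrable_real_indicator emeasure_bounded_finite bounded_ball) simp
    show "AE y in lborel. (\<lambda>k. q k y) \<longlonglongrightarrow> partial i F y"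
    proof (intro AE_I2)
      fix y
      have "((\<lambda>t. F (y + t *\<^sub>R e)) has_real_derivative partial i F y) (at 0)"
        using deriv[of y 0] by simp
      then have "(\<lambda>t. (F (y + t *\<^sub>R e) - F y) / t) \<midarrow>0\<rightarrow> partial i F y"
        unfolding DERIV_def by simp
      moreover have "filterlim (\<lambda>k. 1 / real (Suc k)) (at 0) sequentially"
        unfolding filterlim_at using LIMSEQ_inverse_real_of_nat by (auto simp: inverse_eq_divide)
      ultimately have "(\<lambda>k. (F (y + (1 / real (Suc k)) *\<^sub>R e) - F y) / (1 / real (Suc k))) \<longlonglongrightarrow> partial i F y"
        by (rule filterlim_compose)
      then show "(\<lambda>k. q k y) \<longlonglongrightarrow> partial i F y" by (simp add: q_def)
    qed
    show "AE y in lborel. norm (q k y) \<le> M * indicator (ball 0 (R + 1)) y" for k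
    proof (intro AE_I2)
      fix y
      show "norm (q k y) \<le> M * indicator (ball 0 (R + 1)) y"
      proof (cases "y \<in> ball 0 (R + 1)")
        case True
        have "\<bar>F (y + (1 / real (Suc k)) *\<^sub>R e) - F y\<bar> * real (Suc k) \<le> M * \<bar>1 / real (Suc k)\<bar> * real (Suc k)"
          by (intro mult_right_mono lip) auto
        also have "\<dots> = M" by simp
        finally show ?thesis using True by (simp add: q_def abs_mult)
      next
        case False
        then have n: "norm y \<ge> R + 1" by simp
        have "norm y \<le> norm (y + (1 / real (Suc k)) *\<^sub>R e) + norm ((1 / real (Suc k)) *\<^sub>R e)"
          using norm_triangle_ineq4[of "y + (1 / real (Suc k)) *\<^sub>R e" "(1 / real (Suc k)) *\<^sub>R e"] by simp
        also have "norm ((1 / real (Suc k)) *\<^sub>R e) \<le> 1" using e by simp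
        finally have "norm (y + (1 / real (Suc k)) *\<^sub>R e) \<ge> R" using n by simp
        then have "y + (1 / real (Suc k)) *\<^sub>R e \<notin> K" "y \<notin> K" using R n by auto
        then show ?thesis using False by (simp add: q_def 0)
      qed
    qed
  qed (rule mq)
  then show ?thesis using q0 by (simp add: LIMSEQ_const_iff)
qed

section \<open>Hausdorff outer measures\<close>

text \<open>This and the next two definitions name the pieces of the formula in
  \<open>hausdorff_outer\<close>; \<open>hausdorff_content\<close> is the pre-measure at mesh
  \<open>\<delta>\<close>, which grows as \<open>\<delta>\<close> decreases.\<close>

definition cover_weight :: "('a \<Rightarrow> 'a \<Rightarrow> ennreal) \<Rightarrow> nat \<Rightarrow> 'a set \<Rightarrow> ennreal" where
  "cover_weight d s C =
     (if C = {} then 0 else ennreal (unit_ball_vol (real s) / 2 ^ s) * set_diam d C ^ s)"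

definition fine_covers :: "('a \<Rightarrow> 'a \<Rightarrow> ennreal) \<Rightarrow> ennreal \<Rightarrow> 'a set \<Rightarrow> (nat \<Rightarrow> 'a set) set" where
  "fine_covers d \<delta> E = {C. E \<subseteq> (\<Union>i. C i) \<and> (\<forall>i. set_diam d (C i) \<le> \<delta>)}"

definition hausdorff_content :: "('a \<Rightarrow> 'a \<Rightarrow> ennreal) \<Rightarrow> nat \<Rightarrow> ennreal \<Rightarrow> 'a set \<Rightarrow> ennreal" where
  "hausdorff_content d s \<delta> E = (INF C\<in>fine_covers d \<delta> E. \<Sum>i. cover_weight d s (C i))"

lemma hausdorff_outer_eq:
  "hausdorff_outer d s E = (SUP \<delta>\<in>{0<..}. hausdorff_content d s \<delta> E)"
  unfolding hausdorff_outer_def hausdorff_content_def fine_covers_def cover_weight_def ..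

lemma set_diam_ge: "p \<in> S \<Longrightarrow> q \<in> S \<Longrightarrow> d p q \<le> set_diam d S"
  unfolding set_diam_def by (meson SUP_upper SUP_upper2)

lemma set_diam_empty [simp]: "set_diam d {} = 0"
  by (simp add: set_diam_def bot_ennreal)

lemma cover_weight_empty [simp]: "cover_weight d s {} = 0"
  by (simp add: cover_weight_def)

lemma hausdorff_content_le_outer: "0 < \<delta> \<Longrightarrow> hausdorff_content d s \<delta> E \<le> hausdorff_outer d s E"
  unfolding hausdorff_outer_eq by (rule SUP_upper) simp

lemma hausdorff_content_mono: "E \<subseteq> F \<Longrightarrow> hausdorff_content d s \<delta> E \<le> hausdorff_content d s \<delta> F"
  unfolding hausdorff_content_def fine_covers_def by (rule INF_superset_mono) auto

lemma hausdorff_content_antimono: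
  "\<delta> \<le> \<delta>' \<Longrightarrow> hausdorff_content d s \<delta>' E \<le> hausdorff_content d s \<delta> E"
  unfolding hausdorff_content_def fine_covers_def
  by (rule INF_superset_mono) (auto intro: order_trans)

lemma hausdorff_outer_mono: "E \<subseteq> F \<Longrightarrow> hausdorff_outer d s E \<le> hausdorff_outer d s F"
  unfolding hausdorff_outer_eq by (intro SUP_mono) (auto intro: hausdorff_content_mono)

lemma hausdorff_outer_empty [simp]: "hausdorff_outer d s {} = 0"
proof -
  have "hausdorff_content d s \<delta> {} \<le> 0" for \<delta>
    unfolding hausdorff_content_def
    by (rule INF_lower2[of "\<lambda>i. {}"]) (auto simp: fine_covers_def)
  then have "hausdorff_outer d s {} \<le> 0" unfolding hausdorff_outer_eq by (intro SUP_least)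
  then show ?thesis by simp
qed

lemma fine_cover_approx:
  assumes "hausdorff_content d s \<delta> E < x"
  obtains C where "E \<subseteq> (\<Union>i. C i)" "\<And>i. set_diam d (C i) \<le> \<delta>" "(\<Sum>i. cover_weight d s (C i)) < x"
  using assms unfolding hausdorff_content_def INF_less_iff fine_covers_def by auto

text \<open>Covers of the sets \<open>A n\<close>, optimal up to \<open>e / 2^(n+1)\<close>, are
  merged into a single sequence by the pairing function.\<close>

lemma hausdorff_outer_countable_UN:
  fixes A :: "nat \<Rightarrow> 'a set"
  shows "hausdorff_outer d s (\<Union>i. A i) \<le> (\<Sum>i. hausdorff_outer d s (A i))"
  unfolding hausdorff_outer_eq[of d s "\<Union>i. A i"]
proof (intro SUP_least)
  fix \<delta> :: ennreal assume "\<delta> \<in> {0<..}"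
  then have \<delta>: "\<delta> > 0" by simp
  show "hausdorff_content d s \<delta> (\<Union>i. A i) \<le> (\<Sum>i. hausdorff_outer d s (A i))"
  proof (rule ennreal_le_epsilon)
    fix e :: real assume e: "0 < e" "(\<Sum>n. hausdorff_outer d s (A n)) < top"
    have "hausdorff_content d s \<delta> (A n) < hausdorff_outer d s (A n) + e * (1/2)^Suc n" for n
    proof -
      have "hausdorff_outer d s (A n) < hausdorff_outer d s (A n) + e * (1/2)^Suc n"
        using e by (auto simp add: less_top dest!: ennreal_suminf_lessD)
      then show ?thesis using hausdorff_content_le_outer[OF \<delta>, of d s "A n"] by (rule le_less_trans[rotated])
    qed
    note close = this
    have "\<exists>C. A n \<subseteq> (\<Union>i. C i) \<and> (\<forall>i. set_diam d (C i) \<le> \<delta>) \<and>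
        (\<Sum>i. cover_weight d s (C i)) \<le> hausdorff_outer d s (A n) + e * (1/2)^Suc n" for n
      by (rule fine_cover_approx[OF close[of n]]) (auto intro: less_imp_le)
    then obtain B where B: "\<And>n. A n \<subseteq> (\<Union>i. B n i)" "\<And>n i. set_diam d (B n i) \<le> \<delta>"
      "\<And>n. (\<Sum>i. cover_weight d s (B n i)) \<le> hausdorff_outer d s (A n) + e * (1/2)^Suc n"
      by metis
    define C where "C = case_prod B o prod_decode"
    have A_C: "(\<Union>i. A i) \<subseteq> (\<Union>i. C i)"
    proof
      fix p assume "p \<in> (\<Union>i. A i)"
      then obtain n i where "p \<in> B n i" using B(1) by blast
      then have "p \<in> C (prod_encode (n, i))" by (simp add: C_def)
      then show "p \<in> (\<Union>i. C i)" by blast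
    qed
    have "hausdorff_content d s \<delta> (\<Union>i. A i) \<le> (\<Sum>i. cover_weight d s (C i))"
      unfolding hausdorff_content_def
      by (rule INF_lower) (use A_C B(2) in \<open>auto simp: fine_covers_def C_def split: prod.split\<close>)
    also have "\<dots> = (\<Sum>n. \<Sum>i. cover_weight d s (B n i))"
      unfolding C_def comp_def
      using suminf_ennreal_2dimen[of "\<lambda>m. \<Sum>i. cover_weight d s (B m i)" "\<lambda>p. cover_weight d s (case_prod B p)"]
      by simp
    also have "\<dots> \<le> (\<Sum>n. hausdorff_outer d s (A n) + e * (1/2) ^ Suc n)"
      by (intro suminf_le allI B(3)) auto
    also have "\<dots> = (\<Sum>n. hausdorff_outer d s (A n)) + (\<Sum>n. ennreal e * ennreal ((1/2) ^ Suc n))"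
      using \<open>0 < e\<close> by (subst suminf_add[symmetric])
                       (auto simp del: ennreal_suminf_cmult simp add: ennreal_mult[symmetric])
    also have "\<dots> = (\<Sum>n. hausdorff_outer d s (A n)) + e"
      unfolding ennreal_suminf_cmult
      by (subst suminf_ennreal_eq[OF zero_le_power power_half_series]) auto
    finally show "hausdorff_content d s \<delta> (\<Union>i. A i) \<le> (\<Sum>n. hausdorff_outer d s (A n)) + e" .
  qed
qed

lemma hausdorff_outer_Un: "hausdorff_outer d s (E \<union> F) \<le> hausdorff_outer d s E + hausdorff_outer d s F"
proof -
  have "hausdorff_outer d s (E \<union> F) = hausdorff_outer d s (\<Union>i. binaryset E F i)"
    by (simp add: UN_binaryset_eq)
  also have "\<dots> \<le> (\<Sum>i. hausdorff_outer d s (binaryset E F i))"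
    by (rule hausdorff_outer_countable_UN)
  also have "\<dots> = hausdorff_outer d s E + hausdorff_outer d s F"
    by (intro suminf_binaryset_eq) simp
  finally show ?thesis .
qed

text \<open>A set of diameter below \<open>\<epsilon>\<close> cannot meet both \<open>E\<close> and
  \<open>F\<close>, so every fine cover splits into a cover of \<open>E\<close> and one of
  \<open>F\<close> of no larger total weight.\<close>

lemma hausdorff_outer_separated:
  assumes "0 < \<epsilon>" and sep: "\<And>p q. p \<in> E \<Longrightarrow> q \<in> F \<Longrightarrow> \<epsilon> \<le> d p q"
  shows "hausdorff_outer d s E + hausdorff_outer d s F \<le> hausdorff_outer d s (E \<union> F)"
proof -
  obtain \<epsilon>' where \<epsilon>': "0 < \<epsilon>'" "\<epsilon>' < \<epsilon>" using dense[OF assms(1)] by blast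
  have main: "hausdorff_content d s \<delta> E + hausdorff_content d s \<delta> F \<le> hausdorff_content d s \<delta> (E \<union> F)"
    if "\<delta> \<le> \<epsilon>'" for \<delta>
    unfolding hausdorff_content_def[of d s \<delta> "E \<union> F"]
  proof (rule INF_greatest)
    fix C assume C: "C \<in> fine_covers d \<delta> (E \<union> F)"
    \<comment> \<open>Sets that miss \<open>X\<close> are replaced by the empty set, whose weight is
      0 even for \<open>s = 0\<close>.\<close>
    define P where "P X i = (if C i \<inter> X \<noteq> {} then C i else {})" for X i
    have P: "P X \<in> fine_covers d \<delta> X" if "X \<subseteq> E \<union> F" for X
      using C that by (auto simp: fine_covers_def P_def) blast
    have "cover_weight d s (P E i) + cover_weight d s (P F i) \<le> cover_weight d s (C i)" for i
    proof (cases "C i \<inter> E \<noteq> {} \<and> C i \<inter> F \<noteq> {}")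
      case True
      then obtain p q where "p \<in> C i" "q \<in> C i" "p \<in> E" "q \<in> F" by blast
      then have "\<epsilon> \<le> set_diam d (C i)" using sep set_diam_ge[of p "C i" q d] order_trans by blast
      also have "\<dots> \<le> \<delta>" using C by (auto simp: fine_covers_def)
      finally show ?thesis using that \<epsilon>'(2) by (meson leD order_trans)
    qed (auto simp: P_def)
    then have "(\<Sum>i. cover_weight d s (P E i) + cover_weight d s (P F i)) \<le> (\<Sum>i. cover_weight d s (C i))"
      by (intro suminf_le) auto
    moreover have "(\<Sum>i. cover_weight d s (P E i) + cover_weight d s (P F i)) =
        (\<Sum>i. cover_weight d s (P E i)) + (\<Sum>i. cover_weight d s (P F i))"
      by (intro suminf_add[symmetric]) auto
    moreover have "hausdorff_content d s \<delta> E \<le> (\<Sum>i. cover_weight d s (P E i))"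
      "hausdorff_content d s \<delta> F \<le> (\<Sum>i. cover_weight d s (P F i))"
      unfolding hausdorff_content_def by (auto intro!: INF_lower P)
    ultimately show "hausdorff_content d s \<delta> E + hausdorff_content d s \<delta> F \<le> (\<Sum>i. cover_weight d s (C i))"
      by (auto intro: order_trans[OF add_mono])
  qed
  \<comment> \<open>Independent meshes for the two summands allow the two suprema to be taken one
    after the other.\<close>
  have "hausdorff_content d s \<delta>1 E + hausdorff_content d s \<delta>2 F \<le> hausdorff_outer d s (E \<union> F)"
    if "\<delta>1 > 0" "\<delta>2 > 0" for \<delta>1 \<delta>2
  proof -
    define \<delta> where "\<delta> = min \<epsilon>' (min \<delta>1 \<delta>2)"
    have "hausdorff_content d s \<delta>1 E + hausdorff_content d s \<delta>2 F
        \<le> hausdorff_content d s \<delta> E + hausdorff_content d s \<delta> F"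
      by (intro add_mono hausdorff_content_antimono)
         (simp_all add: \<delta>_def min.coboundedI1 min.coboundedI2)
    also have "\<dots> \<le> hausdorff_content d s \<delta> (E \<union> F)" by (rule main) (simp add: \<delta>_def)
    also have "\<dots> \<le> hausdorff_outer d s (E \<union> F)"
      by (rule hausdorff_content_le_outer) (use that \<epsilon>' in \<open>auto simp: \<delta>_def\<close>)
    finally show ?thesis .
  qed
  moreover have ne: "{0::ennreal<..} \<noteq> {}" by (metis UNIV_I empty_iff greaterThan_iff zero_less_one)
  ultimately have "hausdorff_outer d s E + hausdorff_content d s \<delta>2 F \<le> hausdorff_outer d s (E \<union> F)"
    if "\<delta>2 > 0" for \<delta>2
    unfolding hausdorff_outer_eq[of d s E] using that
    by (subst ennreal_SUP_add_left[symmetric]) (auto intro!: SUP_least)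
  then show ?thesis
    using ne unfolding hausdorff_outer_eq[of d s F]
    by (subst add.commute, subst ennreal_SUP_add_left[symmetric]) (auto intro!: SUP_least simp: add.commute)
qed

text \<open>Caratheodory's criterion for metric outer measures; a Lipschitz function \<open>u\<close> takes over
  the role of the distance to the complement of \<open>{u > 0}\<close>, so that \<open>d\<close> need not be a metric.\<close>

lemma hausdorff_outer_lipschitz_split:
  fixes u :: "'a \<Rightarrow> real"
  assumes L: "L > 0" and lip: "\<And>p q. ennreal \<bar>u p - u q\<bar> \<le> ennreal L * d p q"
  shows "hausdorff_outer d s (E \<inter> {p. u p > 0}) + hausdorff_outer d s (E - {p. u p > 0})
    \<le> hausdorff_outer d s E"
proof (cases "hausdorff_outer d s E = \<infinity>")
  case False
  let ?H = "hausdorff_outer d s"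
  have sep: "?H X + ?H Y \<le> ?H (X \<union> Y)"
    if "a < b" "\<And>p. p \<in> X \<Longrightarrow> u p \<ge> b" "\<And>q. q \<in> Y \<Longrightarrow> u q \<le> a" for X Y and a b :: real
  proof (rule hausdorff_outer_separated[of "ennreal ((b - a) / L)"])
    show "0 < ennreal ((b - a) / L)" using that L by simp
    fix p q assume "p \<in> X" "q \<in> Y"
    then have "b - a \<le> \<bar>u p - u q\<bar>" using that(2)[of p] that(3)[of q] by linarith
    then have "ennreal (b - a) \<le> ennreal \<bar>u p - u q\<bar>" by (rule ennreal_leI)
    then have *: "ennreal (b - a) \<le> ennreal L * d p q" using lip[of p q] by (rule order_trans)
    have "ennreal ((b - a) / L) = ennreal (1 / L) * ennreal (b - a)"
      using L that by (simp flip: ennreal_mult)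
    also have "\<dots> \<le> ennreal (1 / L) * (ennreal L * d p q)" using * by (intro mult_left_mono) auto
    also have "\<dots> = d p q" using L by (simp flip: mult.assoc ennreal_mult)
    finally show "ennreal ((b - a) / L) \<le> d p q" .
  qed
  \<comment> \<open>Shells of \<open>E\<close> inside \<open>{u > 0}\<close>. Between shells of
    equal parity there is a gap in the values of \<open>u\<close>, so they are separated by
    \<open>sep\<close> and their measures add up to at most that of \<open>E\<close>.\<close>
  define R where "R m = E \<inter> {p. 1 / real (m + 2) < u p \<and> u p \<le> 1 / real (m + 1)}" for m
  have par: "(\<Sum>m<n. ?H (R (2 * m + b))) \<le> ?H E" for n b
  proof -
    have "(\<Sum>m<n. ?H (R (2 * m + b))) \<le> ?H (\<Union>m<n. R (2 * m + b))"
    proof (induction n)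
      case (Suc n)
      have "(\<Sum>m<Suc n. ?H (R (2 * m + b))) \<le> ?H (\<Union>m<n. R (2 * m + b)) + ?H (R (2 * n + b))"
        using Suc by (simp add: add_right_mono)
      also have "\<dots> \<le> ?H ((\<Union>m<n. R (2 * m + b)) \<union> R (2 * n + b))"
      proof (cases "n = 0")
        case False
        show ?thesis
        proof (rule sep)
          show "1 / real (2 * n + b + 1) < 1 / real (2 * n + b)"
            using False by (intro divide_strict_left_mono) auto
          show "1 / real (2 * n + b) \<le> u p" if "p \<in> (\<Union>m<n. R (2 * m + b))" for p
          proof -
            obtain m where m: "m < n" "1 / real (2 * m + b + 2) < u p" using \<open>p \<in> _\<close> by (auto simp: R_def)
            have "1 / real (2 * n + b) \<le> 1 / real (2 * m + b + 2)"
              using m(1) by (intro divide_left_mono) auto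
            with m show ?thesis by linarith
          qed
          show "u q \<le> 1 / real (2 * n + b + 1)" if "q \<in> R (2 * n + b)" for q
            using that by (simp add: R_def)
        qed
      qed simp
      also have "(\<Union>m<n. R (2 * m + b)) \<union> R (2 * n + b) = (\<Union>m<Suc n. R (2 * m + b))"
        by (auto simp: less_Suc_eq)
      finally show ?case .
    qed simp
    also have "\<dots> \<le> ?H E" by (rule hausdorff_outer_mono) (auto simp: R_def)
    finally show ?thesis .
  qed
  have tot: "(\<Sum>m<n. ?H (R m)) \<le> 2 * ?H E" for n
  proof -
    have "(\<Sum>m<n. ?H (R m)) \<le> (\<Sum>m<2*n. ?H (R m))" by (intro sum_mono2) auto
    also have "\<dots> = (\<Sum>m<n. ?H (R (2 * m + 0))) + (\<Sum>m<n. ?H (R (2 * m + 1)))"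
      by (induction n) (auto simp: ac_simps)
    also have "\<dots> \<le> ?H E + ?H E" by (intro add_mono par)
    finally show ?thesis by (simp add: mult_2)
  qed
  define X where "X = (\<Sum>m. ?H (R m))"
  have "X + 0 \<le> 2 * ?H E" unfolding X_def by (rule ennreal_suminf_bound_add) (use tot in simp)
  also have "\<dots> < top" using False by (simp add: ennreal_mult_less_top less_top)
  finally have Xfin: "X \<noteq> top" by simp
  \<comment> \<open>The part of \<open>E\<close> in \<open>{u > 0}\<close> consists of
    \<open>Ok\<close>, which is separated from the rest of \<open>E\<close>, and of the shells from
    index \<open>k\<close> on. Only the tail of the convergent series \<open>X\<close> is lost;
    adding its first \<open>k\<close> terms to both sides avoids a subtraction in
    \<open>ennreal\<close> and leaves a supremum over \<open>k\<close>.\<close>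
  have step: "(\<Sum>m<k. ?H (R m)) + (?H (E \<inter> {p. u p > 0}) + ?H (E - {p. u p > 0})) \<le> ?H E + X" for k
  proof -
    define Ok where "Ok = E \<inter> {p. u p > 1 / real (k + 1)}"
    have "E \<inter> {p. u p > 0} \<subseteq> Ok \<union> (\<Union>m. R (m + k))"
    proof
      fix p assume p: "p \<in> E \<inter> {p. u p > 0}"
      show "p \<in> Ok \<union> (\<Union>m. R (m + k))"
      proof (cases "u p > 1 / real (k + 1)")
        case False
        define P where "P n \<longleftrightarrow> 1 / real (n + 1) < u p" for n
        obtain n0 where "inverse (real (Suc n0)) < u p" using reals_Archimedean[of "u p"] p by auto
        then have "P n0" by (simp add: P_def inverse_eq_divide)
        then have "P (LEAST n. P n)" by (rule LeastI)
        define n where "n = (LEAST n. P n)"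
        have 1: "1 / real (n + 1) < u p" using \<open>P (LEAST n. P n)\<close> by (simp add: P_def n_def)
        have nk: "n > k"
        proof (rule ccontr)
          assume "\<not> n > k"
          then have "1 / real (k + 1) \<le> 1 / real (n + 1)" by (intro divide_left_mono) auto
          then show False using 1 False by linarith
        qed
        then have "\<not> P (n - 1)" unfolding n_def by (intro not_less_Least) (simp add: n_def)
        then have "p \<in> R (n - 1 - k + k)" using 1 nk p
          by (auto simp: R_def P_def of_nat_diff)
        then show ?thesis by blast
      qed (use p in \<open>auto simp: Ok_def\<close>)
    qed
    then have "?H (E \<inter> {p. u p > 0}) \<le> ?H (Ok \<union> (\<Union>m. R (m + k)))" by (rule hausdorff_outer_mono)
    also have "\<dots> \<le> ?H Ok + (\<Sum>m. ?H (R (m + k)))"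
      using hausdorff_outer_Un[of d s Ok "\<Union>m. R (m + k)"] hausdorff_outer_countable_UN[of d s "\<lambda>m. R (m + k)"]
      by (meson add_left_mono order_trans)
    finally have "(\<Sum>m<k. ?H (R m)) + (?H (E \<inter> {p. u p > 0}) + ?H (E - {p. u p > 0}))
       \<le> (\<Sum>m<k. ?H (R m)) + ((?H Ok + (\<Sum>m. ?H (R (m + k)))) + ?H (E - {p. u p > 0}))"
      by (intro add_mono) auto
    also have "\<dots> = (?H Ok + ?H (E - {p. u p > 0})) + ((\<Sum>m. ?H (R (m + k))) + (\<Sum>m<k. ?H (R m)))"
      by (simp add: ac_simps)
    also have "(\<Sum>m. ?H (R (m + k))) + (\<Sum>m<k. ?H (R m)) = X"
      unfolding X_def by (rule suminf_offset[symmetric]) simp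
    also have "?H Ok + ?H (E - {p. u p > 0}) \<le> ?H (Ok \<union> (E - {p. u p > 0}))"
      by (rule sep[of 0 "1 / real (k + 1)"]) (auto simp: Ok_def)
    also have "\<dots> \<le> ?H E" by (rule hausdorff_outer_mono) (auto simp: Ok_def)
    finally show ?thesis by (simp add: add_right_mono)
  qed
  have "X + (?H (E \<inter> {p. u p > 0}) + ?H (E - {p. u p > 0})) \<le> ?H E + X"
    unfolding X_def by (rule ennreal_suminf_bound_add) (use step in \<open>simp add: X_def\<close>)
  then have "X + (?H (E \<inter> {p. u p > 0}) + ?H (E - {p. u p > 0})) \<le> X + ?H E" by (simp add: add.commute)
  then show ?thesis using Xfin by (auto simp: ennreal_add_left_cancel_le)
qed simp

text \<open>\<open>measure_of\<close> returns its set function only if that function is countably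
  additive on the sigma-algebra, and otherwise the zero measure. Caratheodory's lemma gives
  additivity on the sets that split every set additively. By the previous lemma these include
  \<open>{u > 0}\<close> for Lipschitz \<open>u\<close>, hence all open sets by the countable unions
  in \<open>base\<close>, hence all Borel sets.\<close>

lemma hausdorff_measure_emeasure:
  fixes d :: "'a::topological_space \<Rightarrow> 'a \<Rightarrow> ennreal"
  assumes base: "\<And>S :: 'a set. open S \<Longrightarrow> \<exists>F. countable F \<and> \<Union>F = S \<and>
     (\<forall>D\<in>F. \<exists>(u :: 'a \<Rightarrow> real) L. L > 0 \<and> D = {p. u p > 0} \<and>
        (\<forall>p q. ennreal \<bar>u p - u q\<bar> \<le> ennreal L * d p q))"
    and B: "B \<in> sets borel"
  shows "emeasure (hausdorff_measure d s) B = hausdorff_outer d s B"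
proof -
  let ?H = "hausdorff_outer d s"
  have oms: "outer_measure_space (Pow UNIV) ?H"
    unfolding outer_measure_space_def positive_def increasing_def countably_subadditive_def
    by (simp add: hausdorff_outer_mono hausdorff_outer_countable_UN)
  interpret S: sigma_algebra UNIV "Pow (UNIV :: 'a set)" by (rule sigma_algebra_Pow)
  define L where "L = lambda_system UNIV (Pow UNIV) ?H"
  have ms: "measure_space UNIV L ?H" unfolding L_def by (rule S.caratheodory_lemma[OF oms])
  then interpret L: sigma_algebra UNIV L by (simp add: measure_space_def)
  have "S \<in> L" if "open S" for S :: "'a set"
  proof -
    obtain F where F: "countable F" "\<Union>F = S"
      "\<forall>D\<in>F. \<exists>(u :: 'a \<Rightarrow> real) L. L > 0 \<and> D = {p. u p > 0} \<and>
        (\<forall>p q. ennreal \<bar>u p - u q\<bar> \<le> ennreal L * d p q)" using base[OF \<open>open S\<close>] by blast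
    have "D \<in> L" if D: "D \<in> F" for D
    proof -
      obtain u :: "'a \<Rightarrow> real" and K where u: "K > 0" "D = {p. u p > 0}"
        "\<And>p q. ennreal \<bar>u p - u q\<bar> \<le> ennreal K * d p q"
      proof -
        from bspec[OF F(3) D] obtain u :: "'a \<Rightarrow> real" and K where
          "K > 0 \<and> D = {p. u p > 0} \<and> (\<forall>p q. ennreal \<bar>u p - u q\<bar> \<le> ennreal K * d p q)"
          by (elim exE)
        then show thesis by (intro that[of K u]) simp_all
      qed
      have "?H (D \<inter> E) + ?H ((UNIV - D) \<inter> E) = ?H E" for E
      proof (rule antisym)
        have "(UNIV - D) \<inter> E = E - D" by auto
        then show "?H (D \<inter> E) + ?H ((UNIV - D) \<inter> E) \<le> ?H E"
          using hausdorff_outer_lipschitz_split[where s=s and E=E, OF u(1,3)] unfolding u(2) by (simp add: Int_commute)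
        have "?H ((D \<inter> E) \<union> ((UNIV - D) \<inter> E)) \<le> ?H (D \<inter> E) + ?H ((UNIV - D) \<inter> E)"
          by (rule hausdorff_outer_Un)
        moreover have "(D \<inter> E) \<union> ((UNIV - D) \<inter> E) = E" by auto
        ultimately show "?H E \<le> ?H (D \<inter> E) + ?H ((UNIV - D) \<inter> E)" by simp
      qed
      then show ?thesis unfolding L_def lambda_system_def by auto
    qed
    then have "\<Union>F \<in> L" using F(1) by (intro L.countable_Union) auto
    then show ?thesis using F(2) by simp
  qed
  then have "sigma_sets UNIV {S :: 'a set. open S} \<subseteq> L" by (intro L.sigma_sets_subset) auto
  then have sub: "sets borel \<subseteq> L" unfolding borel_def by simp
  show ?thesis
    unfolding hausdorff_measure_def
  proof (rule emeasure_measure_of_sigma)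
    show "sigma_algebra UNIV (sets (borel :: 'a measure))"
      using sets.sigma_algebra_axioms[of "borel :: 'a measure"] by simp
    show "positive (sets borel) ?H" by (simp add: positive_def)
    show "countably_additive (sets borel) ?H"
      using ms sub unfolding measure_space_def countably_additive_def by blast
  qed (rule B)
qed

section \<open>Riemannian metrics in charts\<close>

definition posdef :: "real ^ 'n ^ 'n::finite \<Rightarrow> bool" where
  "posdef M \<longleftrightarrow> transpose M = M \<and> (\<forall>v. v \<noteq> 0 \<longrightarrow> v \<bullet> (M *v v) > 0)"

lemma inner_matrix_left: "(M *v v) \<bullet> w = v \<bullet> (transpose M *v w)"
  for M :: "real ^ 'm ^ 'n"
  by (metis dot_lmul_matrix inner_commute transpose_matrix_vector)

lemma posdef_det_nonzero:
  assumes "posdef M" shows "det M \<noteq> 0"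
proof -
  have "M *v v = 0 \<Longrightarrow> v = 0" for v
    using assms unfolding posdef_def by (metis inner_zero_right less_irrefl)
  then show ?thesis
    by (metis invertible_det_nz invertible_left_inverse matrix_left_invertible_ker)
qed

text \<open>On the segment from the identity to \<open>M\<close> all matrices are positive definite,
  hence have nonzero determinant; the determinant is 1 at the identity, so by the intermediate value
  theorem it cannot become negative.\<close>

lemma posdef_det_pos:
  fixes M :: "real ^ 'n ^ 'n"
  assumes M: "posdef M" shows "det M > 0"
proof (rule ccontr)
  assume n: "\<not> det M > 0"
  define P where "P t = (\<chi> i j. t * M $ i $ j + (1 - t) * mat 1 $ i $ j)" for t :: real
  have P: "P t *v v = t *\<^sub>R (M *v v) + (1 - t) *\<^sub>R v" for t and v :: "real ^ 'n"
    unfolding P_def vec_eq_iff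
    by (simp add: matrix_vector_mult_def mat_def sum.distrib sum_distrib_left algebra_simps sum_subtractf
        if_distrib[of "\<lambda>x. _ * x"] cong: if_cong)
  have pd: "det (P t) \<noteq> 0" if t: "0 \<le> t" "t \<le> 1" for t
  proof -
    have "v = 0" if "P t *v v = 0" for v
    proof (rule ccontr)
      assume v: "v \<noteq> 0"
      have "0 = v \<bullet> (P t *v v)" using that by simp
      also have "\<dots> = t * (v \<bullet> (M *v v)) + (1 - t) * (v \<bullet> v)" by (simp add: P inner_add_right)
      also have "\<dots> > 0"
      proof (cases "t = 0")
        case True then show ?thesis using v by simp
      next
        case False
        then have "t * (v \<bullet> (M *v v)) > 0" using t v M by (simp add: posdef_def)
        moreover have "(1 - t) * (v \<bullet> v) \<ge> 0" using t by simp
        ultimately show ?thesis by linarith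
      qed
      finally show False by simp
    qed
    then show ?thesis
      by (metis invertible_det_nz invertible_left_inverse matrix_left_invertible_ker)
  qed
  have "continuous_on {0..1} (\<lambda>t. det (P t))"
    unfolding det_def P_def by (auto intro!: continuous_intros)
  moreover have "P 1 = M" "P 0 = mat 1" by (simp_all add: P_def vec_eq_iff)
  ultimately obtain t where "0 \<le> t" "t \<le> 1" "det (P t) = 0"
    using IVT2'[of "\<lambda>t. det (P t)" 1 0 0] n by (auto simp: det_I not_less)
  then show False using pd by blast
qed

lemma posdef_matrix_inv:
  assumes "posdef M"
  shows "M ** matrix_inv M = mat 1" "matrix_inv M ** M = mat 1"
proof -
  have "invertible M" using posdef_det_nonzero[OF assms] by (simp add: invertible_det_nz)
  then show "M ** matrix_inv M = mat 1" "matrix_inv M ** M = mat 1"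
    unfolding invertible_def matrix_inv_def by (metis (mono_tags, lifting) someI_ex)+
qed

lemma posdef_matrix_inv_mult:
  assumes "posdef M"
  shows "M *v (matrix_inv M *v v) = v" "matrix_inv M *v (M *v v) = v"
  by (simp_all add: matrix_vector_mul_assoc posdef_matrix_inv[OF assms])

lemma posdef_inv_pos:
  assumes M: "posdef M" and v: "v \<noteq> 0"
  shows "v \<bullet> (matrix_inv M *v v) > 0"
proof -
  define w where "w = matrix_inv M *v v"
  have vw: "v = M *v w" by (simp add: w_def posdef_matrix_inv_mult[OF M])
  then have "w \<noteq> 0" using v by auto
  then have "w \<bullet> (M *v w) > 0" using M by (simp add: posdef_def)
  then show ?thesis using vw w_def by (metis inner_commute)
qed

lemma posdef_inv_nonneg: "posdef M \<Longrightarrow> v \<bullet> (matrix_inv M *v v) \<ge> 0"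
  using posdef_inv_pos[of M v] by (cases "v = 0") auto

text \<open>Cramer's rule exhibits the entries of the inverse as rational functions of the entries
  of \<open>M\<close>; the regularity of the inverse metric rests on this.\<close>

lemma matrix_inv_cramer:
  assumes "posdef M"
  shows "matrix_inv M $ i $ j = det (\<chi> a b. if b = i then axis j 1 $ a else M $ a $ b) / det M"
proof -
  have "matrix_inv M *v axis j 1 = (\<chi> k. det (\<chi> a b. if b = k then axis j 1 $ a else M $ a $ b) / det M)"
    using cramer[OF posdef_det_nonzero[OF assms], of "matrix_inv M *v axis j 1" "axis j 1"]
      posdef_matrix_inv_mult[OF assms] by simp
  moreover have "(matrix_inv M *v axis j 1) $ i = matrix_inv M $ i $ j"
    by (simp add: matrix_vector_mul_component inner_axis)
  ultimately show ?thesis by simp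
qed

text \<open>The inner product that a metric induces on covectors does not depend on coordinates:
  metrics pull back by \<open>J\<close> and covectors by its transpose. Invertibility of
  \<open>J\<close> follows from that of \<open>M\<close>.\<close>

lemma posdef_congruence_inv:
  fixes M N J :: "real ^ 'n ^ 'n"
  assumes M: "posdef M" and N: "posdef N" and MN: "M = transpose J ** N ** J"
    and v: "v = transpose J *v v'" and w: "w = transpose J *v w'"
  shows "v \<bullet> (matrix_inv M *v w) = v' \<bullet> (matrix_inv N *v w')"
proof -
  define z where "z = matrix_inv M *v w"
  have "det (transpose J) \<noteq> 0"
    using posdef_det_nonzero[OF M] unfolding MN by (auto simp: det_mul)
  then have inj: "transpose J *v a = transpose J *v b \<Longrightarrow> a = b" for a b
    by (metis inj_eq invertible_det_nz inj_matrix_vector_mult)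
  have "M *v z = w" by (simp add: z_def posdef_matrix_inv_mult[OF M])
  then have "transpose J *v (N *v (J *v z)) = transpose J *v w'"
    unfolding MN w by (simp only: matrix_vector_mul_assoc matrix_mul_assoc)
  then have "N *v (J *v z) = w'" by (rule inj)
  then have "J *v z = matrix_inv N *v w'" using posdef_matrix_inv_mult[OF N] by metis
  moreover have "v \<bullet> z = v' \<bullet> (J *v z)" unfolding v by (simp only: inner_matrix_left transpose_transpose)
  ultimately show ?thesis by (simp add: z_def)
qed

lemma continuous_on_matrix:
  fixes M :: "'b::topological_space \<Rightarrow> real ^ 'm ^ 'k"
  assumes "\<And>i j. continuous_on S (\<lambda>y. M y $ i $ j)"
  shows "continuous_on S M"
proof -
  have "continuous_on S (\<lambda>y. \<chi> i j. M y $ i $ j)"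
    by (intro continuous_on_vec_lambda assms)
  then show ?thesis by simp
qed

lemma continuous_matrix_vector:
  fixes M :: "'b::topological_space \<Rightarrow> real ^ 'm ^ 'k" and v :: "'b \<Rightarrow> real ^ 'm"
  assumes "continuous_on S M" "continuous_on S v"
  shows "continuous_on S (\<lambda>y. M y *v v y)"
  unfolding matrix_vector_mult_def using assms by (intro continuous_intros) auto

section \<open>Coordinate calculus on a closed Riemannian manifold\<close>

locale riem =
  fixes A :: "('a::{t2_space, second_countable_topology}, 'n::finite) chart set"
    and G :: "('a, 'n) chart \<Rightarrow> 'a \<Rightarrow> real ^ 'n ^ 'n"
  assumes compact_M: "compact (UNIV :: 'a set)"
    and atlas: "smooth_atlas A"
    and metric: "riemannian_metric A G"
begin

abbreviation img :: "('a, 'n) chart \<Rightarrow> (real ^ 'n) set" where "img c \<equiv> snd c ` fst c"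
abbreviation iv :: "('a, 'n) chart \<Rightarrow> real ^ 'n \<Rightarrow> 'a" where "iv c \<equiv> inv_into (fst c) (snd c)"

lemma chart:
  assumes "c \<in> A"
  shows open_dom: "open (fst c)" and open_img: "open (img c)"
    and cont_chart: "continuous_on (fst c) (snd c)" and cont_iv: "continuous_on (img c) (iv c)"
    and iv_chart: "p \<in> fst c \<Longrightarrow> iv c (snd c p) = p"
  using assms atlas unfolding smooth_atlas_def is_chart_def homeomorphism_def by auto

lemma chart_iv: "y \<in> img c \<Longrightarrow> snd c (iv c y) = y"
  by (rule f_inv_into_f)

lemma iv_in: "y \<in> img c \<Longrightarrow> iv c y \<in> fst c"
  by (rule inv_into_into)

lemma chart_at: "chart_at A p \<in> A" "p \<in> fst (chart_at A p)"
proof -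
  have "\<exists>c. c \<in> A \<and> p \<in> fst c" using atlas unfolding smooth_atlas_def by blast
  then have "chart_at A p \<in> A \<and> p \<in> fst (chart_at A p)" unfolding chart_at_def by (rule someI_ex)
  then show "chart_at A p \<in> A" "p \<in> fst (chart_at A p)" by auto
qed

lemma img_Int: "c \<in> A \<Longrightarrow> snd c ` (fst c \<inter> S) = img c \<inter> iv c -` S"
  using iv_chart chart_iv iv_in by (auto simp: image_iff)

lemma open_img_Int: "c \<in> A \<Longrightarrow> open S \<Longrightarrow> open (snd c ` (fst c \<inter> S))"
  using continuous_open_preimage[OF cont_iv open_img] by (simp add: img_Int)

lemma posdef_G: "c \<in> A \<Longrightarrow> p \<in> fst c \<Longrightarrow> posdef (G c p)"
  using metric unfolding riemannian_metric_def posdef_def by blast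

definition Gr :: "('a, 'n) chart \<Rightarrow> real ^ 'n \<Rightarrow> real ^ 'n ^ 'n" where "Gr c = coord_rep c (G c)"

lemma posdef_Gr: "c \<in> A \<Longrightarrow> y \<in> img c \<Longrightarrow> posdef (Gr c y)"
  unfolding Gr_def coord_rep_def by (intro posdef_G iv_in)

lemma C1_Gr: "c \<in> A \<Longrightarrow> C1 (img c) (\<lambda>y. Gr c y $ i $ j)"
  using metric smooth_on_C1(1)[OF _ open_img] unfolding riemannian_metric_def Gr_def coord_rep_def by blast

definition sg :: "('a, 'n) chart \<Rightarrow> real ^ 'n \<Rightarrow> real" where "sg c y = sqrt (det (Gr c y))"

lemma sg_pos: "c \<in> A \<Longrightarrow> y \<in> img c \<Longrightarrow> sg c y > 0"
  unfolding sg_def using posdef_det_pos[OF posdef_Gr] by simp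

lemma C1_sg: "c \<in> A \<Longrightarrow> C1 (img c) (sg c)"
  unfolding sg_def by (intro C1_sqrt C1_det C1_Gr posdef_det_pos posdef_Gr)

lemma C1_matrix_inv:
  assumes c: "c \<in> A" shows "C1 (img c) (\<lambda>y. matrix_inv (Gr c y) $ i $ j)"
proof (rule C1_cong_open[OF open_img[OF c]])
  show "C1 (img c) (\<lambda>y. det (\<chi> a b. if b = i then axis j 1 $ a else Gr c y $ a $ b) / det (Gr c y))"
  proof (intro C1_divide C1_det C1_Gr c)
    show "C1 (img c) (\<lambda>y. (\<chi> a b. if b = i then axis j 1 $ a else Gr c y $ a $ b) $ a $ b)" for a b
      by (cases "b = i") (auto intro: C1_Gr c)
    show "det (Gr c y) \<noteq> 0" if "y \<in> img c" for y
      using posdef_det_nonzero[OF posdef_Gr[OF c that]] .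
  qed
qed (use matrix_inv_cramer posdef_Gr[OF c] in blast)

lemma continuous_matrix_inv:
  assumes c: "c \<in> A" shows "continuous_on (img c) (\<lambda>y. matrix_inv (Gr c y))"
  by (intro continuous_on_matrix C1_continuous[OF C1_matrix_inv[OF c]])

lemma continuous_Gr:
  assumes c: "c \<in> A" shows "continuous_on (img c) (Gr c)"
  by (intro continuous_on_matrix C1_continuous[OF C1_Gr[OF c]])

text \<open>The density \<open>|g|\<^sup>1\<^sup>/\<^sup>2 \<nabla>f\<close>, whose Euclidean divergence is \<open>|g|\<^sup>1\<^sup>/\<^sup>2 \<Delta>f\<close>.\<close>

definition flux :: "('a, 'n) chart \<Rightarrow> ('a \<Rightarrow> real) \<Rightarrow> real ^ 'n \<Rightarrow> real ^ 'n" where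
  "flux c f y = sg c y *\<^sub>R (matrix_inv (Gr c y) *v gradv (coord_rep c f) y)"

lemma flux_nth:
  "flux c f y $ i = sg c y * (\<Sum>j\<in>UNIV. matrix_inv (Gr c y) $ i $ j * partial j (coord_rep c f) y)"
  by (simp add: flux_def matrix_vector_mult_def)

lemma C1_coord_rep:
  assumes "c \<in> A" "smooth_fun A f"
  shows "C1 (img c) (coord_rep c f)" "C1 (img c) (partial i (coord_rep c f))"
  using smooth_on_C1[OF _ open_img[OF assms(1)]] assms unfolding smooth_fun_def by blast+

lemma C1_flux:
  assumes "c \<in> A" "smooth_fun A f" shows "C1 (img c) (\<lambda>y. flux c f y $ i)"
  unfolding flux_nth using assms by (intro C1_mult C1_sum C1_sg C1_matrix_inv C1_coord_rep)

text \<open>\<open>laplace_beltrami_in\<close> is the divergence of \<open>flux\<close> divided by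
  the positive density \<open>sg\<close>, so the eigenvalue equation takes divergence form.\<close>

lemma div_flux:
  assumes c: "c \<in> A" and f: "eigenfunction A G f l" and y: "y \<in> img c"
  shows "(\<Sum>i\<in>UNIV. partial i (\<lambda>y. flux c f y $ i) y) = - l\<^sup>2 * sg c y * coord_rep c f y"
proof -
  have "laplace_beltrami_in G c f (iv c y) = - l\<^sup>2 * f (iv c y)"
    using f c iv_in[OF y] unfolding eigenfunction_def by blast
  then have "(1 / sg c y) * (\<Sum>i\<in>UNIV. partial i (\<lambda>y. flux c f y $ i) y) = - l\<^sup>2 * coord_rep c f y"
    unfolding laplace_beltrami_in_def flux_nth sg_def Gr_def chart_iv[OF y] by (simp add: coord_rep_def)
  then show ?thesis using sg_pos[OF c y] by (simp add: field_simps)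
qed

text \<open>The Riemannian inner product of the gradients of \<open>f\<close> and \<open>g\<close>
  at \<open>p\<close>, computed from their differentials by the inverse Gram matrix of the chart
  \<open>c\<close>.\<close>

definition gip :: "('a, 'n) chart \<Rightarrow> ('a \<Rightarrow> real) \<Rightarrow> ('a \<Rightarrow> real) \<Rightarrow> 'a \<Rightarrow> real" where
  "gip c f g p = gradv (coord_rep c f) (snd c p) \<bullet> (matrix_inv (G c p) *v gradv (coord_rep c g) (snd c p))"

lemma grad_norm_gip: "grad_norm A G f p = sqrt (gip (chart_at A p) f f p)"
  unfolding grad_norm_def gip_def Let_def
  by (simp add: inner_vec_def matrix_vector_mult_def sum_distrib_left mult_ac)

lemma transition_derivative:
  assumes c: "c \<in> A" "c' \<in> A" and p: "p \<in> fst c" "p \<in> fst c'"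
  defines "J \<equiv> matrix (frechet_derivative (coord_rep c (snd c')) (at (snd c p)))"
  shows "(coord_rep c (snd c') has_derivative (\<lambda>v. J *v v)) (at (snd c p))"
    and "G c p = transpose J ** G c' p ** J"
proof -
  have o: "open (snd c ` (fst c \<inter> fst c'))" using open_img_Int c open_dom by blast
  have "C1 (snd c ` (fst c \<inter> fst c')) (coord_rep c (\<lambda>p. snd c' p $ i))" for i
    using atlas c smooth_on_C1(1)[OF _ o] unfolding smooth_atlas_def by blast
  then have "(\<lambda>y. coord_rep c (snd c') y $ i) differentiable (at (snd c p))" for i
    using p by (auto simp: C1_def coord_rep_def)
  then have "coord_rep c (snd c') differentiable (at (snd c p))"
    by (subst differentiable_componentwise_within) (auto simp: Basis_vec_def inner_axis)
  then have "(coord_rep c (snd c') has_derivative frechet_derivative (coord_rep c (snd c')) (at (snd c p))) (at (snd c p))"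
    using frechet_derivative_works by blast
  moreover have "frechet_derivative (coord_rep c (snd c')) (at (snd c p)) = (\<lambda>v. J *v v)"
    unfolding J_def using has_derivative_linear[OF calculation] by simp
  ultimately show "(coord_rep c (snd c') has_derivative (\<lambda>v. J *v v)) (at (snd c p))" by simp
  show "G c p = transpose J ** G c' p ** J"
    using metric c p unfolding riemannian_metric_def J_def Let_def by blast
qed

text \<open>By the chain rule, differentials transform by the transpose of the Jacobian.\<close>

lemma gradv_transition:
  assumes c: "c \<in> A" "c' \<in> A" and p: "p \<in> fst c" "p \<in> fst c'"
    and d: "coord_rep c' f differentiable (at (snd c' p))"
  defines "J \<equiv> matrix (frechet_derivative (coord_rep c (snd c')) (at (snd c p)))"
  shows "gradv (coord_rep c f) (snd c p) = transpose J *v gradv (coord_rep c' f) (snd c' p)"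
    and "coord_rep c f differentiable (at (snd c p))"
proof -
  let ?S = "snd c ` (fst c \<inter> fst c')"
  have o: "open ?S" using open_img_Int c open_dom by blast
  have at: "coord_rep c (snd c') (snd c p) = snd c' p" using iv_chart c p by (simp add: coord_rep_def)
  have eq: "coord_rep c f y = coord_rep c' f (coord_rep c (snd c') y)" if "y \<in> ?S" for y
    using that iv_chart c by (auto simp: coord_rep_def)
  have "((\<lambda>y. coord_rep c' f (coord_rep c (snd c') y)) has_derivative
      (\<lambda>v. gradv (coord_rep c' f) (snd c' p) \<bullet> (J *v v))) (at (snd c p))"
    using has_derivative_compose[OF transition_derivative(1)[OF c p]] frechet_gradv[OF d] at
    unfolding J_def by metis
  then have *: "(coord_rep c f has_derivative (\<lambda>v. gradv (coord_rep c' f) (snd c' p) \<bullet> (J *v v))) (at (snd c p))"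
    by (rule has_derivative_transform_within_open[OF _ o]) (use p eq in auto)
  then show "coord_rep c f differentiable (at (snd c p))" by (auto simp: differentiable_def)
  have "partial i (coord_rep c f) (snd c p) = (transpose J *v gradv (coord_rep c' f) (snd c' p)) $ i" for i
  proof -
    have "partial i (coord_rep c f) (snd c p) = gradv (coord_rep c' f) (snd c' p) \<bullet> (J *v axis i 1)"
      using partial_eqI[OF *] .
    also have "\<dots> = (transpose J *v gradv (coord_rep c' f) (snd c' p)) \<bullet> axis i 1"
      by (simp only: inner_matrix_left transpose_transpose)
    finally show ?thesis by (simp only: inner_axis_right)
  qed
  then show "gradv (coord_rep c f) (snd c p) = transpose J *v gradv (coord_rep c' f) (snd c' p)"
    by (simp add: vec_eq_iff)
qed

lemma gip_invariant:
  assumes c: "c \<in> A" "c' \<in> A" and p: "p \<in> fst c" "p \<in> fst c'"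
    and d: "coord_rep c' f differentiable (at (snd c' p))" "coord_rep c' g differentiable (at (snd c' p))"
  shows "gip c f g p = gip c' f g p"
  unfolding gip_def
  by (rule posdef_congruence_inv[OF posdef_G[OF c(1) p(1)] posdef_G[OF c(2) p(2)]
      transition_derivative(2)[OF c p] gradv_transition(1)[OF c p d(1)] gradv_transition(1)[OF c p d(2)]])

lemma grad_norm_chart:
  assumes c: "c \<in> A" and p: "p \<in> fst c" and f: "smooth_fun A f"
  shows "grad_norm A G f p = sqrt (gip c f f p)"
proof -
  have "coord_rep c f differentiable (at (snd c p))"
    using C1_coord_rep(1)[OF c f] p by (auto simp: C1_def)
  then show ?thesis
    using gip_invariant[OF chart_at(1) c chart_at(2) p] by (simp add: grad_norm_gip)
qed

lemma gip_iv:
  "c \<in> A \<Longrightarrow> y \<in> img c \<Longrightarrow> gip c f g (iv c y) = gradv (coord_rep c f) y \<bullet> (matrix_inv (Gr c y) *v gradv (coord_rep c g) y)"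
  unfolding gip_def Gr_def coord_rep_def by (simp add: chart_iv)

lemma flux_gip:
  assumes "c \<in> A" "y \<in> img c"
  shows "gradv (coord_rep c h) y \<bullet> flux c f y = sg c y * gip c h f (iv c y)"
  unfolding gip_iv[OF assms] flux_def by simp

lemma continuous_on_charts:
  assumes "\<And>c. c \<in> A \<Longrightarrow> continuous_on (fst c) F"
  shows "continuous_on UNIV F"
proof -
  have "isCont F p" for p
    using assms[OF chart_at(1)] chart_at(2) open_dom[OF chart_at(1)] continuous_on_eq_continuous_at by blast
  then show ?thesis by (simp add: continuous_at_imp_continuous_on)
qed

lemma C1_all_charts_continuous:
  assumes "\<And>c. c \<in> A \<Longrightarrow> C1 (img c) (coord_rep c f)"
  shows "continuous_on UNIV f"
proof (rule continuous_on_charts)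
  fix c assume c: "c \<in> A"
  have "continuous_on (fst c) (\<lambda>q. coord_rep c f (snd c q))"
    by (rule continuous_on_compose2[OF C1_continuous[OF assms[OF c]] cont_chart[OF c]]) auto
  then show "continuous_on (fst c) f"
    by (rule continuous_on_eq) (simp add: coord_rep_def iv_chart[OF c])
qed

lemma smooth_fun_continuous:
  assumes "smooth_fun A f" shows "continuous_on UNIV f"
  by (rule C1_all_charts_continuous[OF C1_coord_rep(1)[OF _ assms]])

lemma continuous_gradv:
  assumes "c \<in> A" "smooth_fun A f" shows "continuous_on (img c) (gradv (coord_rep c f))"
  unfolding gradv_def by (intro continuous_on_vec_lambda C1_continuous_partial C1_coord_rep(1)[OF assms])

text \<open>\<open>chart_at\<close> may change arbitrarily from point to point. Within one chart
  \<open>c\<close> the invariance of \<open>gip\<close> replaces it by \<open>c\<close>, where all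
  ingredients are continuous. The function \<open>u\<close> is only \<open>C1\<close> in charts,
  since it will also be a partition function.\<close>

lemma gip_continuous:
  assumes u: "\<And>c. c \<in> A \<Longrightarrow> C1 (img c) (coord_rep c u)" and f: "smooth_fun A f"
  shows "continuous_on UNIV (\<lambda>p. gip (chart_at A p) u f p)"
proof (rule continuous_on_charts)
  fix c assume c: "c \<in> A"
  have "continuous_on (img c) (gradv (coord_rep c u))"
    unfolding gradv_def by (intro continuous_on_vec_lambda C1_continuous_partial u c)
  then have "continuous_on (img c) (\<lambda>y. gradv (coord_rep c u) y \<bullet> (matrix_inv (Gr c y) *v gradv (coord_rep c f) y))"
    by (intro continuous_intros continuous_matrix_vector continuous_gradv[OF c f] continuous_matrix_inv[OF c])
  then have "continuous_on (fst c) (\<lambda>q. gradv (coord_rep c u) (snd c q) \<bullet>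
      (matrix_inv (Gr c (snd c q)) *v gradv (coord_rep c f) (snd c q)))"
    by (rule continuous_on_compose2[OF _ cont_chart[OF c]]) auto
  then show "continuous_on (fst c) (\<lambda>p. gip (chart_at A p) u f p)"
  proof (rule continuous_on_eq)
    fix q assume q: "q \<in> fst c"
    have "gip (chart_at A q) u f q = gip c u f q"
      by (rule gip_invariant[OF chart_at(1) c chart_at(2) q])
         (use q C1_differentiable[OF u[OF c]] C1_differentiable[OF C1_coord_rep(1)[OF c f]] in blast)+
    then show "gradv (coord_rep c u) (snd c q) \<bullet> (matrix_inv (Gr c (snd c q)) *v gradv (coord_rep c f) (snd c q))
      = gip (chart_at A q) u f q"
      by (simp add: gip_def Gr_def coord_rep_def iv_chart[OF c q])
  qed
qed

lemma grad_norm_continuous: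
  assumes f: "smooth_fun A f" shows "continuous_on UNIV (grad_norm A G f)"
  unfolding grad_norm_gip[abs_def]
  by (intro continuous_on_real_sqrt gip_continuous C1_coord_rep(1) f)

lemma gip_nonneg: "c \<in> A \<Longrightarrow> p \<in> fst c \<Longrightarrow> gip c f f p \<ge> 0"
  unfolding gip_def by (intro posdef_inv_nonneg posdef_G)

end

section \<open>Riemannian distance and coordinate distance\<close>

text \<open>The quadratic form attains a positive minimum on the product of \<open>K\<close> with
  the unit sphere; homogeneity gives the rest.\<close>

lemma posdef_family_lower_bound:
  fixes M :: "'b::topological_space \<Rightarrow> real ^ 'n ^ 'n::finite"
  assumes K: "compact K" and M: "continuous_on K M"
    and pos: "\<And>y v. y \<in> K \<Longrightarrow> v \<noteq> 0 \<Longrightarrow> v \<bullet> (M y *v v) > 0"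
  obtains m where "m > 0" "\<And>y v. y \<in> K \<Longrightarrow> m * (norm v)\<^sup>2 \<le> v \<bullet> (M y *v v)"
proof (cases "K = {}")
  case False
  let ?S = "K \<times> sphere (0 :: real ^ 'n) 1"
  have ne: "?S \<noteq> {}"
  proof -
    have "axis undefined 1 \<in> sphere (0 :: real ^ 'n) 1" by (simp add: norm_axis_1)
    then show ?thesis using False by blast
  qed
  have "continuous_on ?S (\<lambda>z. snd z \<bullet> (M (fst z) *v snd z))"
    by (intro continuous_intros continuous_matrix_vector continuous_on_compose2[OF M]) auto
  moreover have "compact ?S" using K by (intro compact_Times) auto
  ultimately obtain z where z: "z \<in> ?S"
    "\<And>z'. z' \<in> ?S \<Longrightarrow> snd z \<bullet> (M (fst z) *v snd z) \<le> snd z' \<bullet> (M (fst z') *v snd z')"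
    using continuous_attains_inf[OF _ ne] by blast
  define m where "m = snd z \<bullet> (M (fst z) *v snd z)"
  have "m > 0" unfolding m_def using z(1) by (intro pos) auto
  moreover have "m * (norm v)\<^sup>2 \<le> v \<bullet> (M y *v v)" if y: "y \<in> K" for y v
  proof (cases "v = 0")
    case False
    define w where "w = (1 / norm v) *\<^sub>R v"
    have "norm w = 1" using False by (simp add: w_def)
    then have "m \<le> w \<bullet> (M y *v w)" unfolding m_def using z(2)[of "(y, w)"] y by simp
    also have "\<dots> = (v \<bullet> (M y *v v)) / (norm v)\<^sup>2"
      by (simp add: w_def matrix_vector_mult_scaleR power2_eq_square)
    finally show ?thesis using False by (simp add: field_simps)
  qed simp
  ultimately show thesis using that by blast
qed (use that[of 1] in auto)

context riem begin

lemma metric_lower_bound: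
  assumes c: "c \<in> A" and K: "compact K" "K \<subseteq> img c"
  obtains m where "m > 0" "\<And>y v. y \<in> K \<Longrightarrow> m * (norm v)\<^sup>2 \<le> v \<bullet> (Gr c y *v v)"
  by (rule posdef_family_lower_bound[OF K(1) continuous_on_subset[OF continuous_Gr[OF c] K(2)]])
     (use posdef_Gr[OF c] K(2) in \<open>auto simp: posdef_def\<close>)

text \<open>The length integrand picks a chart anew at each time. The transformation law of the
  metric cancels the Jacobian in the velocity, so a fixed chart may be used instead. Times are
  interior because \<open>at t\<close> is two-sided, while \<open>\<gamma>\<close> is controlled on
  \<open>{0..1}\<close> only.\<close>

lemma speed_invariant:
  assumes c: "c \<in> A" and \<gamma>: "continuous_on {0..1} \<gamma>" and t: "0 < t" "t < 1" "\<gamma> t \<in> fst c"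
    and v: "(snd c \<circ> \<gamma> has_vector_derivative v) (at t)"
  shows "(let c = chart_at A (\<gamma> t); v = vector_derivative (snd c \<circ> \<gamma>) (at t)
          in v \<bullet> (G c (\<gamma> t) *v v)) = v \<bullet> (G c (\<gamma> t) *v v)"
proof -
  define c' where "c' = chart_at A (\<gamma> t)"
  have c': "c' \<in> A" "\<gamma> t \<in> fst c'" unfolding c'_def by (rule chart_at)+
  define J where "J = matrix (frechet_derivative (coord_rep c (snd c')) (at (snd c (\<gamma> t))))"
  define T where "T = {0<..<1} \<inter> \<gamma> -` (fst c \<inter> fst c')"
  have T: "open T" unfolding T_def
    by (intro continuous_open_preimage continuous_on_subset[OF \<gamma>] open_Int open_dom c c') auto
  have "((\<lambda>s. coord_rep c (snd c') ((snd c \<circ> \<gamma>) s)) has_derivative (\<lambda>s. J *v (s *\<^sub>R v))) (at t)"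
    using has_derivative_compose[OF v[unfolded has_vector_derivative_def]]
      transition_derivative(1)[OF c c'(1) t(3) c'(2)] unfolding J_def by simp
  moreover have "(\<lambda>s. J *v (s *\<^sub>R v)) = (\<lambda>s. s *\<^sub>R (J *v v))"
    by (simp add: matrix_vector_mult_scaleR)
  ultimately have "((\<lambda>s. coord_rep c (snd c') ((snd c \<circ> \<gamma>) s)) has_vector_derivative J *v v) (at t)"
    unfolding has_vector_derivative_def by simp
  then have "(snd c' \<circ> \<gamma> has_vector_derivative J *v v) (at t)"
    by (rule has_vector_derivative_transform_within_open[OF _ T])
       (use t c' c iv_chart in \<open>auto simp: T_def coord_rep_def\<close>)
  then have "vector_derivative (snd c' \<circ> \<gamma>) (at t) = J *v v" by (rule vector_derivative_at)
  moreover have "v \<bullet> (G c (\<gamma> t) *v v) = (J *v v) \<bullet> (G c' (\<gamma> t) *v (J *v v))"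
    using transition_derivative(2)[OF c c'(1) t(3) c'(2)] unfolding J_def[symmetric]
    by (simp only: inner_matrix_left matrix_vector_mul_assoc matrix_mul_assoc)
  ultimately show ?thesis unfolding Let_def c'_def[symmetric] by simp
qed

text \<open>The fundamental theorem of calculus in the chart bounds the displacement by the integral
  of the Euclidean speed, and \<open>m\<close> compares this with the Riemannian speed.\<close>

lemma curve_segment_length:
  assumes c: "c \<in> A" and m: "m > 0" "\<And>y v. y \<in> K \<Longrightarrow> m * (norm v)\<^sup>2 \<le> v \<bullet> (Gr c y *v v)"
    and \<gamma>: "piecewise_C1_curve A \<gamma>" and ab: "0 \<le> a" "a < b" "b \<le> 1"
    and sub: "\<And>t. t \<in> {a..b} \<Longrightarrow> \<gamma> t \<in> fst c \<and> snd c (\<gamma> t) \<in> K"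
  shows "ennreal (sqrt m * norm (snd c (\<gamma> b) - snd c (\<gamma> a))) \<le> curve_length A G \<gamma>"
proof -
  define h where "h = snd c \<circ> \<gamma>"
  have cont\<gamma>: "continuous_on {0..1} \<gamma>" using \<gamma> by (simp add: piecewise_C1_curve_def)
  have "h piecewise_C1_differentiable_on {a..b}"
    unfolding h_def using \<gamma> c ab sub unfolding piecewise_C1_curve_def by (meson image_subsetI)
  then obtain S where S: "finite S" "continuous_on {a..b} h" "h C1_differentiable_on ({a..b} - S)"
    unfolding piecewise_C1_differentiable_on_def by blast
  then obtain D where D: "\<And>t. t \<in> {a..b} - S \<Longrightarrow> (h has_vector_derivative D t) (at t)"
    "continuous_on ({a..b} - S) D" unfolding C1_differentiable_on_def by blast
  \<comment> \<open>Break points and end points are removed; the derivative extended by zero is then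
    Borel on the whole line.\<close>
  define T where "T = {a<..<b} - S"
  have T: "T \<in> sets borel" 
    using S(1) by (simp add: T_def sets.Diff borel_closed finite_imp_closed)
  define f where "f = (\<lambda>t. indicator T t *\<^sub>R D t)"
  have fm: "f \<in> borel_measurable lborel"
  proof -
    have "continuous_on T D" by (rule continuous_on_subset[OF D(2)]) (auto simp: T_def)
    then show ?thesis unfolding f_def using borel_measurable_continuous_on_indicator[OF T] by simp
  qed
  then have [measurable]: "f \<in> borel_measurable borel" by simp
  have speed: "sqrt m * norm (D t) \<le> (let c = chart_at A (\<gamma> t); v = vector_derivative (snd c \<circ> \<gamma>) (at t)
                    in sqrt (v \<bullet> (G c (\<gamma> t) *v v)))" if "t \<in> T" for t
  proof -
    have t: "t \<in> {a..b}" "t \<in> {a..b} - S" "0 < t" "t < 1" using that ab by (auto simp: T_def)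
    have "m * (norm (D t))\<^sup>2 \<le> D t \<bullet> (Gr c (snd c (\<gamma> t)) *v D t)" by (rule m(2)) (use sub t in blast)
    also have "\<dots> = D t \<bullet> (G c (\<gamma> t) *v D t)"
      using sub[OF t(1)] by (simp add: Gr_def coord_rep_def iv_chart[OF c])
    finally have "sqrt (m * (norm (D t))\<^sup>2) \<le> sqrt (D t \<bullet> (G c (\<gamma> t) *v D t))" by simp
    moreover have "sqrt (m * (norm (D t))\<^sup>2) = sqrt m * norm (D t)" by (simp add: real_sqrt_mult)
    ultimately show ?thesis
      using speed_invariant[OF c cont\<gamma> t(3,4) _ D(1)[OF t(2), unfolded h_def]] sub[OF t(1)]
      unfolding Let_def by simp
  qed
  have le: "(\<integral>\<^sup>+t. ennreal (sqrt m) * ennreal (norm (f t)) \<partial>lborel) \<le> curve_length A G \<gamma>"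
    unfolding curve_length_def
  proof (rule nn_integral_mono)
    fix t
    show "ennreal (sqrt m) * ennreal (norm (f t)) \<le>
      (let c = chart_at A (\<gamma> t); v = vector_derivative (snd c \<circ> \<gamma>) (at t)
       in ennreal (sqrt (v \<bullet> (G c (\<gamma> t) *v v)))) * indicator {0..1} t"
    proof (cases "t \<in> T")
      case True
      then have "t \<in> {0..1}" using ab by (auto simp: T_def)
      then show ?thesis using True speed[OF True] m(1)
        by (auto simp: f_def Let_def ennreal_mult[symmetric] intro!: ennreal_leI)
    qed (simp add: f_def)
  qed
  show ?thesis
  proof (cases "integrable lborel f")
    case True
    have "(f has_integral (\<integral>t. f t \<partial>lborel)) UNIV" by (rule has_integral_integral_lborel[OF True])
    moreover have "(f has_integral (h b - h a)) {a..b}"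
      by (rule fundamental_theorem_of_calculus_interior_strong[OF S(1) less_imp_le[OF ab(2)] _ S(2)])
         (use D(1) in \<open>auto simp: f_def T_def\<close>)
    then have "(f has_integral (h b - h a)) UNIV"
      by (rule has_integral_on_superset) (auto simp: f_def T_def)
    ultimately have "h b - h a = (\<integral>t. f t \<partial>lborel)" using has_integral_unique by blast
    then have "norm (h b - h a) \<le> (\<integral>t. norm (f t) \<partial>lborel)" using integral_norm_bound by metis
    then have "ennreal (sqrt m * norm (h b - h a)) \<le> ennreal (sqrt m * (\<integral>t. norm (f t) \<partial>lborel))"
      using m(1) by (intro ennreal_leI mult_left_mono) auto
    also have "\<dots> = ennreal (sqrt m) * (\<integral>\<^sup>+t. ennreal (norm (f t)) \<partial>lborel)"
      using True m(1) by (subst nn_integral_eq_integral) (auto simp: ennreal_mult)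
    also have "\<dots> = (\<integral>\<^sup>+t. ennreal (sqrt m) * ennreal (norm (f t)) \<partial>lborel)"
      by (intro nn_integral_cmult[symmetric]) measurable
    finally show ?thesis using le by (simp add: h_def)
  next
    \<comment> \<open>A non-integrable speed makes the length infinite.\<close>
    case False
    then have "(\<integral>\<^sup>+t. ennreal (norm (f t)) \<partial>lborel) = \<infinity>"
      using fm unfolding integrable_iff_bounded infinity_ennreal_def by (metis top.not_eq_extremum)
    then have "(\<integral>\<^sup>+t. ennreal (sqrt m) * ennreal (norm (f t)) \<partial>lborel) = \<infinity>"
      using m(1) by (subst nn_integral_cmult) (auto simp: ennreal_mult_top)
    then show ?thesis using le by (simp add: top_unique)
  qed
qed

lemma continuous_extend_zero:
  fixes F :: "'a \<Rightarrow> real"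
  assumes c: "c \<in> A" and K: "compact K" "K \<subseteq> img c"
    and F: "continuous_on (fst c) F" and 0: "\<And>p. p \<notin> iv c ` K \<Longrightarrow> F p = 0"
  shows "continuous_on UNIV F"
proof -
  have "compact (iv c ` K)"
    by (rule compact_continuous_image[OF continuous_on_subset[OF cont_iv[OF c] K(2)] K(1)])
  then have o: "open (- iv c ` K)" using compact_imp_closed by blast
  have "continuous_on (- iv c ` K) F"
    by (rule continuous_on_eq[OF continuous_on_const[of _ 0]]) (simp add: 0)
  then have "continuous_on (fst c \<union> - iv c ` K) F"
    using continuous_on_open_Un[OF open_dom[OF c] o F] by blast
  moreover have "fst c \<union> - iv c ` K = UNIV" using K(2) iv_in by auto
  ultimately show ?thesis by simp
qed

text \<open>Stands in for the Riemannian distance from a point: a Euclidean cone in a chart is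
  positive exactly on a coordinate ball and will be Lipschitz for \<open>riemannian_dist\<close>.
  This ties the distance to the topology and localizes sets of small diameter.\<close>

definition cone_fun :: "('a, 'n) chart \<Rightarrow> real ^ 'n \<Rightarrow> real \<Rightarrow> 'a \<Rightarrow> real" where
  "cone_fun c y r p = (if p \<in> fst c then max 0 (r - dist (snd c p) y) else 0)"

lemma cone_fun_continuous:
  assumes c: "c \<in> A" and r: "cball y r \<subseteq> img c"
  shows "continuous_on UNIV (cone_fun c y r)"
proof (rule continuous_extend_zero[OF c compact_cball r])
  show "continuous_on (fst c) (cone_fun c y r)"
    by (rule continuous_on_eq[of _ "\<lambda>p. max 0 (r - dist (snd c p) y)"])
       (auto simp: cone_fun_def intro!: continuous_intros cont_chart[OF c])
  fix p assume p: "p \<notin> iv c ` cball y r"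
  show "cone_fun c y r p = 0"
  proof (cases "p \<in> fst c")
    case True
    then have "snd c p \<notin> cball y r" using p iv_chart[OF c True] by (metis imageI)
    then show ?thesis by (simp add: cone_fun_def dist_commute)
  qed (simp add: cone_fun_def)
qed

text \<open>A curve joining the levels \<open>u s\<close> and \<open>u t\<close> of the cone function contains a segment inside the
  chart along which the function decreases from \<open>u s\<close> to any prescribed intermediate value.\<close>

lemma cone_fun_curve:
  assumes c: "c \<in> A" and m: "m > 0" "\<And>y v. y \<in> K \<Longrightarrow> m * (norm v)\<^sup>2 \<le> v \<bullet> (Gr c y *v v)"
    and K: "K \<subseteq> img c" and r: "cball y r \<subseteq> K"
    and \<gamma>: "piecewise_C1_curve A \<gamma>" and st: "s \<in> {0..1}" "t \<in> {0..1}"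
    and lt: "cone_fun c y r (\<gamma> t) < cone_fun c y r (\<gamma> s)"
  shows "ennreal (sqrt m * (cone_fun c y r (\<gamma> s) - cone_fun c y r (\<gamma> t))) \<le> curve_length A G \<gamma>"
proof -
  define f where "f = (\<lambda>\<tau>. cone_fun c y r (\<gamma> \<tau>))"
  have "continuous_on {0..1} \<gamma>" using \<gamma> by (simp add: piecewise_C1_curve_def)
  then have contf: "continuous_on {0..1} f" unfolding f_def
    by (intro continuous_on_compose2[OF cone_fun_continuous[OF c]]) (use r K in auto)
  have nonneg: "f \<tau> \<ge> 0" for \<tau> by (simp add: f_def cone_fun_def)
  \<comment> \<open>A level \<open>a\<close> above \<open>f t\<close> is positive, so the part of
    the curve where \<open>f \<ge> a\<close> stays inside the chart.\<close>
  have mid: "ennreal (sqrt m * (f s - a)) \<le> curve_length A G \<gamma>" if a: "f t < a" "a < f s" for a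
  proof -
    have ivt: "\<exists>\<tau>'\<in>closed_segment s \<tau>. f \<tau>' = a" if "\<tau> \<in> {0..1}" "f \<tau> \<le> a" for \<tau>
    proof -
      have "closed_segment s \<tau> \<subseteq> {0..1}" using st that by (intro closed_segment_subset) auto
      then have "connected (f ` closed_segment s \<tau>)"
        by (intro connected_continuous_image continuous_on_subset[OF contf]) auto
      then have "is_interval (f ` closed_segment s \<tau>)" by (simp add: is_interval_connected_1)
      then have "a \<in> f ` closed_segment s \<tau>"
        using mem_is_interval_1_I[of "f ` closed_segment s \<tau>" "f \<tau>" "f s" a] that a by auto
      then show ?thesis by auto
    qed
    \<comment> \<open>Among the times at level \<open>a\<close> the one nearest to \<open>s\<close>
      is taken; between it and \<open>s\<close> the function \<open>f\<close> does not fall below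
      \<open>a\<close>.\<close>
    define Z where "Z = {0..1} \<inter> f -` {a}"
    have "closed Z" unfolding Z_def
      by (rule continuous_closed_preimage[OF contf closed_atLeastAtMost closed_singleton])
    moreover have "bounded Z" by (rule bounded_subset[of "{0..1}"]) (auto simp: Z_def)
    ultimately have "compact Z" by (simp add: compact_eq_bounded_closed)
    moreover have "Z \<noteq> {}"
    proof -
      obtain \<tau>' where "\<tau>' \<in> closed_segment s t" "f \<tau>' = a" using ivt[OF st(2)] a by auto
      moreover have "closed_segment s t \<subseteq> {0..1}" using st by (intro closed_segment_subset) auto
      ultimately show ?thesis by (auto simp: Z_def)
    qed
    moreover have "continuous_on Z (\<lambda>\<tau>. dist \<tau> s)" by (intro continuous_intros)
    ultimately obtain \<tau> where \<tau>: "\<tau> \<in> Z" "\<And>\<tau>'. \<tau>' \<in> Z \<Longrightarrow> dist \<tau> s \<le> dist \<tau>' s"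
      using continuous_attains_inf[of Z "\<lambda>\<tau>. dist \<tau> s"] by blast
    have \<tau>01: "\<tau> \<in> {0..1}" "f \<tau> = a" using \<tau>(1) by (auto simp: Z_def)
    have ne: "s \<noteq> \<tau>" using \<tau>01 a by auto
    have ge: "f \<sigma> \<ge> a" if \<sigma>: "\<sigma> \<in> closed_segment s \<tau>" for \<sigma>
    proof (rule ccontr)
      assume n: "\<not> f \<sigma> \<ge> a"
      have \<sigma>01: "\<sigma> \<in> {0..1}" using \<sigma> st \<tau>01 by (auto simp: closed_segment_eq_real_ivl split: if_splits)
      obtain \<tau>' where t': "\<tau>' \<in> closed_segment s \<sigma>" "f \<tau>' = a" using ivt[OF \<sigma>01] n by auto
      then have "\<tau>' \<in> Z" using st \<sigma>01 by (auto simp: Z_def closed_segment_eq_real_ivl split: if_splits)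
      then have "dist \<tau> s \<le> dist \<tau>' s" by (rule \<tau>(2))
      then have "\<tau>' = \<sigma>" using t'(1) \<sigma>
        by (auto simp: closed_segment_eq_real_ivl dist_real_def split: if_splits)
      then show False using t'(2) n by simp
    qed
    have seg: "\<gamma> \<sigma> \<in> fst c \<and> snd c (\<gamma> \<sigma>) \<in> K" if "\<sigma> \<in> closed_segment s \<tau>" for \<sigma>
    proof -
      have "f \<sigma> > 0" using ge[OF that] a(1) nonneg[of t] by linarith
      then have "\<gamma> \<sigma> \<in> fst c" "dist (snd c (\<gamma> \<sigma>)) y < r"
        by (auto simp: f_def cone_fun_def split: if_splits)
      then show ?thesis using r by (auto simp: dist_commute subset_eq)
    qed
    have fs: "f s > 0" using a nonneg[of t] by linarith
    have f\<tau>: "f \<tau> > 0" using a nonneg[of t] \<tau>01 by linarith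
    have "f s - a \<le> norm (snd c (\<gamma> s) - snd c (\<gamma> \<tau>))"
      using fs f\<tau> \<tau>01(2) dist_triangle[of "snd c (\<gamma> \<tau>)" y "snd c (\<gamma> s)"]
      by (auto simp: f_def cone_fun_def dist_norm norm_minus_commute max_def split: if_splits)
    then have "ennreal (sqrt m * (f s - a)) \<le> ennreal (sqrt m * norm (snd c (\<gamma> s) - snd c (\<gamma> \<tau>)))"
      using m(1) by (intro ennreal_leI mult_left_mono) auto
    also have "\<dots> \<le> curve_length A G \<gamma>"
    proof (cases "s < \<tau>")
      case True
      then have "{s..\<tau>} = closed_segment s \<tau>" by (simp add: closed_segment_eq_real_ivl)
      then have "ennreal (sqrt m * norm (snd c (\<gamma> \<tau>) - snd c (\<gamma> s))) \<le> curve_length A G \<gamma>"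
        using seg st \<tau>01 True by (intro curve_segment_length[OF c m \<gamma>]) auto
      then show ?thesis by (simp add: norm_minus_commute)
    next
      case False
      then have "{\<tau>..s} = closed_segment s \<tau>" using ne by (simp add: closed_segment_eq_real_ivl)
      then show ?thesis
        using seg st \<tau>01 False ne by (intro curve_segment_length[OF c m \<gamma>]) auto
    qed
    finally show ?thesis .
  qed
  \<comment> \<open>This is \<open>mid\<close> for \<open>a\<close> decreasing to
    \<open>f t\<close>, phrased as a contradiction.\<close>
  have "ennreal (sqrt m * (f s - f t)) \<le> curve_length A G \<gamma>"
  proof (rule ccontr)
    assume n: "\<not> ennreal (sqrt m * (f s - f t)) \<le> curve_length A G \<gamma>"
    then obtain l where l: "curve_length A G \<gamma> = ennreal l" "l \<ge> 0"
      by (cases "curve_length A G \<gamma>") auto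
    have "l < sqrt m * (f s - f t)" using n l by (auto simp: ennreal_le_iff2)
    then have "l / sqrt m < f s - f t" using m(1) by (simp add: field_simps)
    then have "f t < f s - l / sqrt m" by simp
    then obtain a where a: "f t < a" "a < f s - l / sqrt m" using dense by blast
    moreover have "l / sqrt m \<ge> 0" using l m by simp
    ultimately have "ennreal (sqrt m * (f s - a)) \<le> ennreal l" using mid[of a] l by simp
    then have "sqrt m * (f s - a) \<le> l" using l by (simp add: ennreal_le_iff)
    then have "f s - a \<le> l / sqrt m" using m(1) by (simp add: field_simps)
    then show False using a by simp
  qed
  then show ?thesis by (simp add: f_def)
qed

text \<open>\<open>cone_fun_curve\<close> gives the bound along each curve, and the infimum over
  curves passes it to the distance. The constant \<open>1 / sqrt m\<close> depends on
  \<open>K\<close> only, not on centre and radius, which keeps the covering constants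
  uniform.\<close>

lemma cone_fun_lipschitz:
  assumes c: "c \<in> A" and K: "compact K" "K \<subseteq> img c"
  obtains L where "L > 0"
    "\<And>y r p q. cball y r \<subseteq> K \<Longrightarrow>
       ennreal \<bar>cone_fun c y r p - cone_fun c y r q\<bar> \<le> ennreal L * riemannian_dist A G p q"
proof -
  obtain m where m: "m > 0" "\<And>y v. y \<in> K \<Longrightarrow> m * (norm v)\<^sup>2 \<le> v \<bullet> (Gr c y *v v)"
    using metric_lower_bound[OF c K] by blast
  have "ennreal \<bar>cone_fun c y r p - cone_fun c y r q\<bar> \<le> ennreal (1 / sqrt m) * riemannian_dist A G p q"
    if r: "cball y r \<subseteq> K" for y r p q
  proof -
    have "ennreal (sqrt m * \<bar>cone_fun c y r p - cone_fun c y r q\<bar>) \<le> riemannian_dist A G p q"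
      unfolding riemannian_dist_def
    proof (rule INF_greatest)
      fix \<gamma> assume "\<gamma> \<in> {\<gamma>. piecewise_C1_curve A \<gamma> \<and> \<gamma> 0 = p \<and> \<gamma> 1 = q}"
      then have \<gamma>: "piecewise_C1_curve A \<gamma>" "\<gamma> 0 = p" "\<gamma> 1 = q" by auto
      consider "cone_fun c y r p = cone_fun c y r q" | "cone_fun c y r (\<gamma> 0) < cone_fun c y r (\<gamma> 1)"
        | "cone_fun c y r (\<gamma> 1) < cone_fun c y r (\<gamma> 0)" using \<gamma> by fastforce
      then show "ennreal (sqrt m * \<bar>cone_fun c y r p - cone_fun c y r q\<bar>) \<le> curve_length A G \<gamma>"
      proof cases
        case 2
        then show ?thesis using cone_fun_curve[OF c m K(2) r \<gamma>(1), of 1 0] \<gamma> by simp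
      next
        case 3
        then show ?thesis using cone_fun_curve[OF c m K(2) r \<gamma>(1), of 0 1] \<gamma> by simp
      qed simp
    qed
    then have "ennreal (1 / sqrt m) * ennreal (sqrt m * \<bar>cone_fun c y r p - cone_fun c y r q\<bar>)
        \<le> ennreal (1 / sqrt m) * riemannian_dist A G p q" by (rule mult_left_mono) simp
    moreover have "ennreal (1 / sqrt m) * ennreal (sqrt m * \<bar>cone_fun c y r p - cone_fun c y r q\<bar>)
        = ennreal \<bar>cone_fun c y r p - cone_fun c y r q\<bar>"
      using m(1) by (subst ennreal_mult[symmetric]) auto
    ultimately show ?thesis by simp
  qed
  then show thesis using that[of "1 / sqrt m"] m(1) by simp
qed

text \<open>The cone centred at \<open>p0\<close> has value \<open>r\<close> there and changes by at
  most \<open>L * \<delta> < r\<close> within \<open>S\<close>, so it stays positive: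
  \<open>q\<close> lies in the chart, and the value of the cone at \<open>q\<close> gives its
  coordinate distance from \<open>p0\<close>.\<close>

lemma small_diam_in_ball:
  assumes c: "c \<in> A"
    and lip: "\<And>p q. ennreal \<bar>cone_fun c (snd c p0) r p - cone_fun c (snd c p0) r q\<bar> \<le> ennreal L * riemannian_dist A G p q"
    and p0: "p0 \<in> fst c" "p0 \<in> S" and q: "q \<in> S"
    and d: "set_diam (riemannian_dist A G) S \<le> ennreal \<delta>" and L: "L > 0" and \<delta>: "0 \<le> \<delta>" "L * \<delta> < r"
  shows "q \<in> fst c" "dist (snd c p0) (snd c q) \<le> L * \<delta>"
proof -
  have "riemannian_dist A G p0 q \<le> ennreal \<delta>" using set_diam_ge[OF p0(2) q] d order_trans by blast
  then have "ennreal \<bar>cone_fun c (snd c p0) r p0 - cone_fun c (snd c p0) r q\<bar> \<le> ennreal L * ennreal \<delta>"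
    using lip[of p0 q] by (meson mult_left_mono order_trans zero_le)
  then have "\<bar>cone_fun c (snd c p0) r p0 - cone_fun c (snd c p0) r q\<bar> \<le> L * \<delta>"
    using L \<delta> by (simp add: ennreal_mult[symmetric] ennreal_le_iff)
  moreover have "cone_fun c (snd c p0) r p0 = r"
  proof -
    have "0 \<le> L * \<delta>" using L \<delta> by (intro mult_nonneg_nonneg) auto
    then have "r > 0" using \<delta> by linarith
    then show ?thesis using p0 by (simp add: cone_fun_def)
  qed
  ultimately show "q \<in> fst c" "dist (snd c p0) (snd c q) \<le> L * \<delta>"
    using \<delta> by (auto simp: cone_fun_def dist_commute split: if_splits)
qed

text \<open>The sets \<open>{u > 0}\<close> for cone functions \<open>u\<close> in charts form a
  base of the topology, and second countability reduces any union of them to a countable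
  one.\<close>

lemma emeasure_hausdorff_riemannian:
  assumes "B \<in> sets borel"
  shows "emeasure (hausdorff_measure (riemannian_dist A G) s) B = hausdorff_outer (riemannian_dist A G) s B"
proof (rule hausdorff_measure_emeasure[OF _ assms])
  fix S :: "'a set" assume S: "open S"
  let ?P = "\<lambda>D. \<exists>(u :: 'a \<Rightarrow> real) L. L > 0 \<and> D = {p. u p > 0} \<and>
        (\<forall>p q. ennreal \<bar>u p - u q\<bar> \<le> ennreal L * riemannian_dist A G p q)"
  have "\<exists>D. open D \<and> p \<in> D \<and> D \<subseteq> S \<and> ?P D" if p: "p \<in> S" for p
  proof -
    let ?c = "chart_at A p"
    have c: "?c \<in> A" and pc: "p \<in> fst ?c" using chart_at by auto
    have "open (snd ?c ` (fst ?c \<inter> S))" by (rule open_img_Int[OF c S])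
    then obtain r where r: "r > 0" "cball (snd ?c p) r \<subseteq> snd ?c ` (fst ?c \<inter> S)"
      using p pc open_contains_cball by blast
    then have r': "cball (snd ?c p) r \<subseteq> img ?c" by auto
    define u where "u = cone_fun ?c (snd ?c p) r"
    obtain L where L: "L > 0" "\<And>y' r' p' q. cball y' r' \<subseteq> cball (snd ?c p) r \<Longrightarrow>
       ennreal \<bar>cone_fun ?c y' r' p' - cone_fun ?c y' r' q\<bar> \<le> ennreal L * riemannian_dist A G p' q"
      using cone_fun_lipschitz[OF c compact_cball r'] by blast
    have "continuous_on UNIV u" unfolding u_def by (rule cone_fun_continuous[OF c r'])
    then have "open {q. u q > 0}" by (intro open_Collect_less continuous_on_const)
    moreover have "u p > 0" using pc r by (simp add: u_def cone_fun_def)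
    moreover have "{q. u q > 0} \<subseteq> S"
    proof
      fix q assume "q \<in> {q. u q > 0}"
      then have q: "q \<in> fst ?c" "snd ?c q \<in> cball (snd ?c p) r"
        by (auto simp: u_def cone_fun_def dist_commute split: if_splits)
      then have "snd ?c q \<in> snd ?c ` (fst ?c \<inter> S)" using r by blast
      then show "q \<in> S" using iv_chart[OF c] q(1) by auto (metis)
    qed
    moreover have "\<forall>p' q. ennreal \<bar>u p' - u q\<bar> \<le> ennreal L * riemannian_dist A G p' q"
      unfolding u_def using L(2) by blast
    then have "?P {q. u q > 0}" using L(1) by blast
    ultimately show ?thesis by (intro exI[of _ "{q. u q > 0}"]) auto
  qed
  then have "\<forall>p\<in>S. \<exists>D. open D \<and> p \<in> D \<and> D \<subseteq> S \<and> ?P D" by (intro ballI)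
  then obtain D where D: "\<forall>p\<in>S. open (D p) \<and> p \<in> D p \<and> D p \<subseteq> S \<and> ?P (D p)"
    unfolding bchoice_iff by (elim exE)
  have 1: "openin (top_of_set UNIV) X" if "X \<in> D ` S" for X
    using that D by (elim imageE) simp
  obtain F where F: "F \<subseteq> D ` S" "countable F" "\<Union>F = \<Union>(D ` S)" by (rule Lindelof_openin[OF 1])
  have "\<Union>(D ` S) = S"
  proof
    show "\<Union>(D ` S) \<subseteq> S" using D by (intro UN_least) simp
    show "S \<subseteq> \<Union>(D ` S)"
    proof
      fix x assume x: "x \<in> S"
      then have "x \<in> D x" using bspec[OF D x] by (elim conjE)
      with x show "x \<in> \<Union>(D ` S)" by (rule UN_I)
    qed
  qed
  moreover have "\<forall>X\<in>F. ?P X"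
  proof
    fix X assume "X \<in> F"
    then obtain p where "p \<in> S" "X = D p" using F(1) by (elim subsetD[THEN imageE])
    then show "?P X" using D by simp
  qed
  ultimately show "\<exists>F. countable F \<and> \<Union>F = S \<and> (\<forall>D\<in>F. ?P D)"
    using F by (intro exI[of _ F] conjI) simp_all
qed

end

section \<open>Partitions of unity and the volume measure\<close>

lemma C1_component: "C1 S (\<lambda>y. y $ i)"
proof (rule C1I[where g = "\<lambda>j y. axis j 1 $ i"])
  have "((\<lambda>y :: real ^ 'a. y $ i) has_derivative (\<lambda>y. y $ i)) (at y)" for y
    by (intro bounded_linear_imp_has_derivative bounded_linear_vec_nth)
  then show "(\<lambda>y :: real ^ 'a. y $ i) differentiable (at y)"
    "partial j (\<lambda>y :: real ^ 'a. y $ i) y = axis j 1 $ i" for y j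
    by (auto simp: differentiable_def intro: partial_eqI)
qed auto

lemma C1_compose_vec:
  fixes \<tau> :: "real ^ 'm::finite \<Rightarrow> real ^ 'k::finite"
  assumes \<tau>: "\<And>i. C1 S (\<lambda>y. \<tau> y $ i)" and b: "C1 T b" and sub: "\<And>y. y \<in> S \<Longrightarrow> \<tau> y \<in> T"
  shows "C1 S (\<lambda>y. b (\<tau> y))"
proof (rule C1I[where g = "\<lambda>i y. \<Sum>m\<in>UNIV. partial m b (\<tau> y) * partial i (\<lambda>y. \<tau> y $ m) y"])
  fix y i assume y: "y \<in> S"
  define D where "D v = (\<chi> m. gradv (\<lambda>y. \<tau> y $ m) y \<bullet> v)" for v
  have "(\<tau> has_derivative D) (at y)"
    unfolding has_derivative_componentwise_within[of \<tau>]
    using frechet_gradv[OF C1_differentiable[OF \<tau> y]]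
    by (auto simp: Basis_vec_def inner_axis D_def)
  then have *: "((\<lambda>y. b (\<tau> y)) has_derivative (\<lambda>v. gradv b (\<tau> y) \<bullet> D v)) (at y)"
    by (rule has_derivative_compose) (rule frechet_gradv[OF C1_differentiable[OF b sub[OF y]]])
  then show "(\<lambda>y. b (\<tau> y)) differentiable (at y)" unfolding differentiable_def by blast
  show "partial i (\<lambda>y. b (\<tau> y)) y = (\<Sum>m\<in>UNIV. partial m b (\<tau> y) * partial i (\<lambda>y. \<tau> y $ m) y)"
    unfolding partial_eqI[OF *] D_def by (subst inner_vec_def) (simp add: inner_axis_right)
next
  have "continuous_on S (\<lambda>y. \<chi> i. \<tau> y $ i)" by (intro continuous_on_vec_lambda C1_continuous[OF \<tau>])
  then have "continuous_on S \<tau>" by simp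
  then have "continuous_on S (\<lambda>y. partial m b (\<tau> y))" for m
    by (rule continuous_on_compose2[OF C1_continuous_partial[OF b]]) (use sub in auto)
  then show "continuous_on S (\<lambda>y. \<Sum>m\<in>UNIV. partial m b (\<tau> y) * partial i (\<lambda>y. \<tau> y $ m) y)" for i
    by (intro continuous_on_sum continuous_on_mult C1_continuous_partial[OF \<tau>])
qed

text \<open>Squaring removes the corner of \<open>max 0 t\<close>: at 0 the difference quotient is
  bounded by \<open>\<bar>h\<bar>\<close>.\<close>

lemma DERIV_max0_square: "((\<lambda>t::real. (max 0 t)\<^sup>2) has_real_derivative 2 * max 0 t) (at t)"
proof -
  consider "t > 0" | "t < 0" | "t = 0" by linarith
  then show ?thesis
  proof cases
    case 1
    have "((\<lambda>t::real. t\<^sup>2) has_real_derivative 2 * t) (at t)" by (auto intro!: derivative_eq_intros)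
    then have "((\<lambda>t::real. (max 0 t)\<^sup>2) has_real_derivative 2 * t) (at t)"
      by (rule has_field_derivative_transform_within_open[of _ _ _ "{0<..}"]) (use 1 in auto)
    then show ?thesis using 1 by simp
  next
    case 2
    have "((\<lambda>t::real. 0) has_real_derivative 0) (at t)" by auto
    then have "((\<lambda>t::real. (max 0 t)\<^sup>2) has_real_derivative 0) (at t)"
      by (rule has_field_derivative_transform_within_open[of _ _ _ "{..<0}"]) (use 2 in auto)
    then show ?thesis using 2 by simp
  next
    case 3
    have "(\<lambda>h::real. (max 0 h)\<^sup>2 / h) \<midarrow>0\<rightarrow> 0"
    proof (rule Lim_null_comparison)
      show "\<forall>\<^sub>F h in at 0. norm ((max 0 h)\<^sup>2 / h) \<le> \<bar>h::real\<bar>"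
        by (auto simp: eventually_at max_def power2_eq_square intro!: exI[of _ 1])
      show "(\<lambda>h::real. \<bar>h\<bar>) \<midarrow>0\<rightarrow> 0" by (auto intro!: tendsto_eq_intros)
    qed
    then show ?thesis using 3 by (simp add: DERIV_def)
  qed
qed

lemma C1_max0_square: "C1 S f \<Longrightarrow> C1 S (\<lambda>y. (max 0 (f y))\<^sup>2)"
  by (rule C1_compose[of S f "\<lambda>t. (max 0 t)\<^sup>2" "\<lambda>t. 2 * max 0 t"])
     (auto intro: DERIV_max0_square intro!: continuous_intros)

text \<open>A radial \<open>C1\<close> bump that is a polynomial inside its ball, which makes the
  constants in later estimates explicit. Its height is \<open>r^4\<close> rather than 1.\<close>

definition bump :: "real ^ 'n::finite \<Rightarrow> real \<Rightarrow> real ^ 'n \<Rightarrow> real" where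
  "bump y0 r y = (max 0 (r\<^sup>2 - (y - y0) \<bullet> (y - y0)))\<^sup>2"

lemma C1_bump: "C1 S (bump y0 r)"
  unfolding bump_def inner_vec_def
  by (auto intro!: C1_max0_square C1_diff C1_const C1_sum C1_mult C1_component)

lemma bump_pos_iff: "r > 0 \<Longrightarrow> bump y0 r y > 0 \<longleftrightarrow> y \<in> ball y0 r"
proof -
  assume r: "r > 0"
  have "(y - y0) \<bullet> (y - y0) = (dist y0 y)\<^sup>2" by (simp add: dot_square_norm dist_norm norm_minus_commute)
  moreover have "(dist y0 y)\<^sup>2 < r\<^sup>2 \<longleftrightarrow> dist y0 y < r"
    using r by (metis abs_of_nonneg abs_of_pos abs_square_le_1 power2_less_imp_less power_strict_mono
        less_imp_le zero_le_dist zero_less_numeral pos2)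
  ultimately show ?thesis by (auto simp: bump_def max_def)
qed

lemma bump_nonneg: "bump y0 r y \<ge> 0" by (simp add: bump_def)

context riem begin

definition bump_fun :: "('a, 'n) chart \<Rightarrow> real ^ 'n \<Rightarrow> real \<Rightarrow> 'a \<Rightarrow> real" where
  "bump_fun c y r p = (if p \<in> fst c then bump y r (snd c p) else 0)"

text \<open>The image of \<open>c'\<close> is covered by two open sets: the overlap with
  \<open>c\<close>, where the bump is composed with a transition map, and the complement of the
  carrier, where the function vanishes. The carrier is compact, hence closed because the space is
  Hausdorff.\<close>

lemma C1_bump_fun:
  assumes c: "c \<in> A" and c': "c' \<in> A" and r: "r > 0" "cball y r \<subseteq> img c"
  shows "C1 (img c') (coord_rep c' (bump_fun c y r))"
proof -
  let ?b = "coord_rep c' (bump_fun c y r)"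
  have K: "compact (iv c ` cball y r)"
    by (rule compact_continuous_image[OF continuous_on_subset[OF cont_iv[OF c] r(2)] compact_cball])
  define S1 where "S1 = snd c' ` (fst c' \<inter> fst c)"
  define S2 where "S2 = snd c' ` (fst c' \<inter> - iv c ` cball y r)"
  have o1: "open S1" unfolding S1_def by (intro open_img_Int c' open_dom c)
  have o2: "open S2" unfolding S2_def by (intro open_img_Int c') (use K compact_imp_closed in blast)
  have "C1 S1 (\<lambda>z. bump y r (coord_rep c' (snd c) z))"
  proof (rule C1_compose_vec[OF _ C1_bump])
    show "C1 S1 (\<lambda>z. coord_rep c' (snd c) z $ i)" for i
    proof -
      have "smooth_on S1 (coord_rep c' (\<lambda>p. snd c p $ i))"
        using atlas c c' unfolding smooth_atlas_def S1_def by blast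
      then show ?thesis using smooth_on_C1(1)[OF _ o1] by (simp add: coord_rep_def)
    qed
  qed auto
  then have 1: "C1 S1 ?b"
    by (rule C1_cong_open[OF o1]) (auto simp: S1_def coord_rep_def bump_fun_def iv_chart[OF c'])
  have 2: "C1 S2 ?b"
  proof (rule C1_cong_open[OF o2 C1_const])
    fix z assume "z \<in> S2"
    then obtain p where p: "p \<in> fst c'" "p \<notin> iv c ` cball y r" "z = snd c' p" by (auto simp: S2_def)
    have "bump_fun c y r p = 0"
    proof (cases "p \<in> fst c")
      case True
      then have "snd c p \<notin> cball y r" using p(2) iv_chart[OF c True] by (metis imageI)
      then have "\<not> bump y r (snd c p) > 0" by (subst bump_pos_iff[OF r(1)]) auto
      then show ?thesis using True bump_nonneg[of y r "snd c p"] by (simp add: bump_fun_def)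
    qed (simp add: bump_fun_def)
    then show "?b z = 0" using p by (simp add: coord_rep_def iv_chart[OF c'])
  qed
  have "img c' \<subseteq> S1 \<union> S2"
  proof
    fix z assume "z \<in> img c'"
    then obtain p where p: "p \<in> fst c'" "z = snd c' p" by blast
    have "p \<in> fst c \<or> p \<notin> iv c ` cball y r" using r(2) iv_in by auto
    then show "z \<in> S1 \<union> S2" using p unfolding S1_def S2_def by blast
  qed
  then show ?thesis using C1_subset C1_open_Un[OF o1 o2 1 2] by blast
qed

text \<open>The indices are points of the manifold: \<open>i\<close> refers to the chart
  \<open>chart_at A i\<close>, and \<open>K i\<close> is a compact set in its coordinates that
  carries \<open>th i\<close>. Regularity is demanded in every chart, because the gradients of the
  \<open>th i\<close> will be added up in a common one.\<close>

definition chart_partition :: "'a set \<Rightarrow> ('a \<Rightarrow> (real ^ 'n) set) \<Rightarrow> ('a \<Rightarrow> 'a \<Rightarrow> real) \<Rightarrow> bool" where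
  "chart_partition I K th \<longleftrightarrow> finite I \<and> (\<forall>i. compact (K i) \<and> K i \<subseteq> img (chart_at A i)) \<and>
     (\<forall>i p. 0 \<le> th i p) \<and> (\<forall>p. (\<Sum>i\<in>I. th i p) = 1) \<and>
     (\<forall>i p. p \<notin> iv (chart_at A i) ` K i \<longrightarrow> th i p = 0) \<and>
     (\<forall>i. \<forall>c\<in>A. C1 (img c) (coord_rep c (th i)))"

lemma chart_partitionD:
  assumes "chart_partition I K th"
  shows "finite I" "\<And>i. compact (K i)" "\<And>i. K i \<subseteq> img (chart_at A i)"
    "\<And>i p. 0 \<le> th i p" "\<And>p. (\<Sum>i\<in>I. th i p) = 1"
    "\<And>i p. p \<notin> iv (chart_at A i) ` K i \<Longrightarrow> th i p = 0"
    "\<And>i c. c \<in> A \<Longrightarrow> C1 (img c) (coord_rep c (th i))"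
  using assms unfolding chart_partition_def by simp_all

text \<open>Each point gets a bump that is positive there; compactness selects finitely many whose
  positivity sets cover the manifold, and dividing by their sum normalizes them.\<close>

lemma partition_of_unity:
  obtains I K th where "chart_partition I K th"
proof -
  have "\<exists>r>0. cball (snd (chart_at A p) p) r \<subseteq> img (chart_at A p)" for p
    using open_img[OF chart_at(1)] chart_at(2) open_contains_cball by blast
  then obtain r where r: "\<And>p. r p > 0" "\<And>p. cball (snd (chart_at A p) p) (r p) \<subseteq> img (chart_at A p)"
    by metis
  define K where "K p = cball (snd (chart_at A p) p) (r p)" for p
  define b where "b p = bump_fun (chart_at A p) (snd (chart_at A p) p) (r p)" for p
  have C1b: "C1 (img c) (coord_rep c (b p))" if "c \<in> A" for c p
    unfolding b_def by (rule C1_bump_fun[OF chart_at(1) that r])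
  have contb: "continuous_on UNIV (b p)" for p by (rule C1_all_charts_continuous[OF C1b])
  have nb: "b p q \<ge> 0" for p q by (simp add: b_def bump_fun_def bump_nonneg)
  have supp: "b i p = 0" if "p \<notin> iv (chart_at A i) ` K i" for i p
  proof (cases "p \<in> fst (chart_at A i)")
    case True
    then have "snd (chart_at A i) p \<notin> K i" using that iv_chart[OF chart_at(1) True] by (metis imageI)
    then have "\<not> bump (snd (chart_at A i) i) (r i) (snd (chart_at A i) p) > 0"
      by (subst bump_pos_iff[OF r(1)]) (auto simp: K_def)
    then have "\<not> b i p > 0" using True by (simp add: b_def bump_fun_def)
    then show ?thesis using nb[of i p] by simp
  qed (simp add: b_def bump_fun_def)
  have "bump (snd (chart_at A p) p) (r p) (snd (chart_at A p) p) > 0" for p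
    by (subst bump_pos_iff[OF r(1)]) (simp add: r(1))
  then have "b p p > 0" for p
    using chart_at(2) by (simp add: b_def bump_fun_def)
  then have cov: "UNIV \<subseteq> (\<Union>p\<in>UNIV. {q. b p q > 0})" by blast
  have op: "open {q. b p q > 0}" for p by (intro open_Collect_less continuous_on_const contb)
  obtain I where I: "finite I" "UNIV \<subseteq> (\<Union>p\<in>I. {q. b p q > 0})"
    by (rule compactE_image[OF compact_M _ cov]) (use op in auto)
  define B where "B q = (\<Sum>i\<in>I. b i q)" for q
  have Bpos: "B q > 0" for q
  proof -
    obtain i where "i \<in> I" "b i q > 0" using I(2) by blast
    then show ?thesis unfolding B_def using I(1) nb by (intro sum_pos2[of I i]) auto
  qed
  have "chart_partition I K (\<lambda>i q. b i q / B q)"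
    unfolding chart_partition_def
  proof (intro conjI allI ballI impI)
    show "finite I" by fact
    show "compact (K i)" "K i \<subseteq> img (chart_at A i)" for i using r by (auto simp: K_def)
    show "0 \<le> b i p / B p" for i p using nb[of i p] Bpos[of p] by simp
    show "(\<Sum>i\<in>I. b i p / B p) = 1" for p
      using Bpos[of p] by (simp add: sum_divide_distrib[symmetric] B_def[symmetric])
    show "b i p / B p = 0" if "p \<notin> iv (chart_at A i) ` K i" for i p using supp[OF that] by simp
    show "C1 (img c) (coord_rep c (\<lambda>q. b i q / B q))" if c: "c \<in> A" for i c
    proof -
      have "C1 (img c) (\<lambda>y. coord_rep c (b i) y / (\<Sum>i\<in>I. coord_rep c (b i) y))"
        by (intro C1_divide C1_sum C1b c) (use Bpos in \<open>simp add: coord_rep_def B_def[symmetric] less_imp_neq[symmetric]\<close>)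
      then show ?thesis by (simp add: coord_rep_def B_def)
    qed
  qed
  then show thesis by (rule that)
qed

text \<open>\<open>inv_into\<close> is unspecified outside the image of the chart; a constant value
  there makes the map Borel on the whole space.\<close>

lemma iv_extended_measurable:
  assumes c: "c \<in> A"
  shows "(\<lambda>y. if y \<in> img c then iv c y else undefined) \<in> borel_measurable borel"
proof (rule borel_measurableI)
  fix S :: "'a set" assume S: "open S"
  have "(\<lambda>y. if y \<in> img c then iv c y else undefined) -` S =
      (img c \<inter> iv c -` S) \<union> (if undefined \<in> S then - img c else {})" by (auto split: if_splits)
  moreover have "open (img c \<inter> iv c -` S)" by (rule continuous_open_preimage[OF cont_iv[OF c] open_img[OF c] S])
  ultimately show "(\<lambda>y. if y \<in> img c then iv c y else undefined) -` S \<inter> space borel \<in> sets borel"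
    using open_img[OF c] by simp
qed

lemma sg_measurable:
  assumes c: "c \<in> A" shows "(\<lambda>y. indicator (img c) y * sg c y) \<in> borel_measurable borel"
  using borel_measurable_continuous_on_indicator[OF borel_open[OF open_img[OF c]] C1_continuous[OF C1_sg[OF c]]]
  by simp

end

section \<open>The volume measure in charts\<close>

locale riem_vol = riem A G for A :: "('a::{t2_space, second_countable_topology}, 'n::finite) chart set" and G +
  fixes V :: "'a measure"
  assumes vol: "riemannian_volume A G V"
begin

lemma sets_V [simp, measurable_cong]: "sets V = sets borel"
  using vol by (simp add: riemannian_volume_def)

lemma space_V [simp]: "space V = UNIV"
  using sets_eq_imp_space_eq[OF sets_V] by simp

lemma emeasure_V_chart:
  assumes "c \<in> A" "B \<in> sets borel" "B \<subseteq> fst c"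
  shows "emeasure V B = (\<integral>\<^sup>+y. ennreal (sg c y) * indicator (snd c ` B) y \<partial>lborel)"
  using vol assms unfolding riemannian_volume_def sg_def Gr_def by blast

text \<open>Restricted to the chart domain, the volume measure is the image under the inverse chart
  of Lebesgue measure with density \<open>sg c\<close>.\<close>

lemma integral_V_chart:
  fixes F :: "'a \<Rightarrow> real"
  assumes c: "c \<in> A" and F: "F \<in> borel_measurable borel" and 0: "\<And>p. p \<notin> fst c \<Longrightarrow> F p = 0"
  shows "(\<integral>p. F p \<partial>V) = (\<integral>y. indicator (img c) y * sg c y * coord_rep c F y \<partial>lborel)"
proof -
  define ivx where "ivx y = (if y \<in> img c then iv c y else undefined)" for y
  have ivm [measurable]: "ivx \<in> borel_measurable borel"
    unfolding ivx_def by (rule iv_extended_measurable[OF c])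
  have sm [measurable]: "(\<lambda>y. indicator (img c) y * sg c y) \<in> borel_measurable borel" by (rule sg_measurable[OF c])
  have snn: "0 \<le> indicator (img c) y * sg c y" for y
    using sg_pos[OF c, of y] by (auto simp: indicator_def)
  define D where "D = density lborel (\<lambda>y. ennreal (indicator (img c) y * sg c y))"
  have dom: "fst c \<in> sets borel" using open_dom[OF c] by simp
  have ivm': "ivx \<in> measurable D borel" by (simp add: D_def)
  have "distr D borel ivx = density V (\<lambda>p. ennreal (indicator (fst c) p))"
  proof (rule measure_eqI)
    fix B assume "B \<in> sets (distr D borel ivx)"
    then have B: "B \<in> sets borel" by simp
    have pre: "ivx -` B \<in> sets borel" using measurable_sets[OF ivm B] by simp
    have "emeasure (distr D borel ivx) B = emeasure D (ivx -` B)"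
      by (subst emeasure_distr[OF ivm' B]) (simp add: D_def)
    also have "\<dots> = (\<integral>\<^sup>+y. ennreal (indicator (img c) y * sg c y) * indicator (ivx -` B) y \<partial>lborel)"
      unfolding D_def by (rule emeasure_density) (use pre in auto)
    also have "\<dots> = (\<integral>\<^sup>+y. ennreal (sg c y) * indicator (snd c ` (fst c \<inter> B)) y \<partial>lborel)"
      unfolding img_Int[OF c] by (rule nn_integral_cong) (auto simp: indicator_def ivx_def)
    also have "\<dots> = emeasure V (fst c \<inter> B)"
      using B dom by (intro emeasure_V_chart[OF c, symmetric]) auto
    also have "\<dots> = (\<integral>\<^sup>+p. indicator (fst c \<inter> B) p \<partial>V)"
      using B dom by (subst nn_integral_indicator) auto
    also have "\<dots> = (\<integral>\<^sup>+p. ennreal (indicator (fst c) p) * indicator B p \<partial>V)"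
      by (rule nn_integral_cong) (auto simp: indicator_def)
    also have "\<dots> = emeasure (density V (\<lambda>p. ennreal (indicator (fst c) p))) B"
      by (rule emeasure_density[symmetric]) (use B dom in auto)
    finally show "emeasure (distr D borel ivx) B = emeasure (density V (\<lambda>p. ennreal (indicator (fst c) p))) B" .
  qed simp
  then have "(\<integral>p. F p \<partial>distr D borel ivx) = (\<integral>p. indicator (fst c) p *\<^sub>R F p \<partial>V)"
    using F dom by (simp only:) (subst integral_density, auto)
  moreover have "(\<lambda>p. indicator (fst c) p *\<^sub>R F p) = F"
  proof
    show "indicator (fst c) p *\<^sub>R F p = F p" for p by (cases "p \<in> fst c") (simp_all add: 0)
  qed
  moreover have "(\<integral>p. F p \<partial>distr D borel ivx) = (\<integral>y. F (ivx y) \<partial>D)"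
    by (rule integral_distr[OF ivm' F])
  moreover have "(\<integral>y. F (ivx y) \<partial>D) = (\<integral>y. (indicator (img c) y * sg c y) *\<^sub>R F (ivx y) \<partial>lborel)"
    unfolding D_def using F snn by (subst integral_density) auto
  moreover have "(\<lambda>y. (indicator (img c) y * sg c y) *\<^sub>R F (ivx y)) = (\<lambda>y. indicator (img c) y * sg c y * coord_rep c F y)"
    by (auto simp: indicator_def ivx_def coord_rep_def)
  ultimately show ?thesis by simp
qed

text \<open>The compact carriers of a partition of unity cover the manifold, and each has finite
  volume because \<open>sg\<close> is bounded on compact sets.\<close>

lemma finite_V: "finite_measure V"
proof
  obtain I K th where part: "chart_partition I K th" by (rule partition_of_unity)
  note P = chart_partitionD(1,2,3,5,6)[OF part]
  have cov: "UNIV \<subseteq> (\<Union>i\<in>I. iv (chart_at A i) ` K i)"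
  proof
    fix p :: 'a
    show "p \<in> (\<Union>i\<in>I. iv (chart_at A i) ` K i)"
    proof (rule ccontr)
      assume "p \<notin> (\<Union>i\<in>I. iv (chart_at A i) ` K i)"
      then have "(\<Sum>i\<in>I. th i p) = 0" using P(5) by (intro sum.neutral) auto
      then show False using P(4) by simp
    qed
  qed
  have fin: "emeasure V (iv (chart_at A i) ` K i) < \<infinity> \<and> iv (chart_at A i) ` K i \<in> sets V" for i
  proof -
    let ?c = "chart_at A i"
    have c: "?c \<in> A" by (rule chart_at)
    have cpt: "compact (iv ?c ` K i)"
      by (rule compact_continuous_image[OF continuous_on_subset[OF cont_iv[OF c] P(3)] P(2)])
    have "bounded (sg ?c ` K i)"
      by (intro compact_imp_bounded compact_continuous_image continuous_on_subset[OF C1_continuous[OF C1_sg[OF c]] P(3)] P(2))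
    then obtain M where M: "\<And>y. y \<in> K i \<Longrightarrow> \<bar>sg ?c y\<bar> \<le> M" unfolding bounded_iff by auto
    have im: "snd ?c ` iv ?c ` K i = K i"
      using P(3)[of i] by (force simp: image_image chart_iv)
    have "emeasure V (iv ?c ` K i) = (\<integral>\<^sup>+y. ennreal (sg ?c y) * indicator (K i) y \<partial>lborel)"
      using emeasure_V_chart[OF c borel_compact[OF cpt]] P(3)[of i] iv_in unfolding im by (force simp: im)
    also have "\<dots> \<le> (\<integral>\<^sup>+y. ennreal M * indicator (K i) y \<partial>lborel)"
      using M by (intro nn_integral_mono) (force simp: indicator_def intro!: ennreal_leI)
    also have "\<dots> = ennreal M * emeasure lborel (K i)"
      using borel_compact[OF P(2)] by (intro nn_integral_cmult_indicator) simp
    also have "\<dots> < \<infinity>"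
      using emeasure_compact_finite[OF P(2)] by (simp add: ennreal_mult_less_top)
    finally show ?thesis using borel_compact[OF cpt] by simp
  qed
  have "emeasure V UNIV \<le> emeasure V (\<Union>i\<in>I. iv (chart_at A i) ` K i)"
    using cov P(1) fin by (intro emeasure_mono sets.finite_UN) auto
  also have "\<dots> \<le> (\<Sum>i\<in>I. emeasure V (iv (chart_at A i) ` K i))"
    using P(1) fin by (intro emeasure_subadditive_finite) auto
  also have "\<dots> < \<infinity>" using P(1) fin by (simp add: less_top)
  finally show "emeasure V (space V) \<noteq> \<infinity>" by simp
qed

lemma continuous_integrable_V:
  fixes F :: "'a \<Rightarrow> real"
  assumes F: "continuous_on UNIV F" shows "integrable V F"
proof -
  interpret finite_measure V by (rule finite_V)
  have "bounded (F ` UNIV)" by (intro compact_imp_bounded compact_continuous_image F compact_M)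
  then obtain B where "\<And>p. \<bar>F p\<bar> \<le> B" unfolding bounded_iff by auto
  moreover have "F \<in> borel_measurable V" using borel_measurable_continuous_onI[OF F] by simp
  ultimately show ?thesis by (intro integrable_const_bound[of _ B]) auto
qed

end

section \<open>Green's identities\<close>

context riem begin

text \<open>The coordinate density of \<open>|\<nabla>f|^2 dV\<close>.\<close>

definition energy :: "('a, 'n) chart \<Rightarrow> ('a \<Rightarrow> real) \<Rightarrow> real ^ 'n \<Rightarrow> real" where
  "energy c f y = gradv (coord_rep c f) y \<bullet> flux c f y"

lemma energy_gip: "c \<in> A \<Longrightarrow> y \<in> img c \<Longrightarrow> energy c f y = sg c y * gip c f f (iv c y)"
  unfolding energy_def by (rule flux_gip)

lemma energy_nonneg: "c \<in> A \<Longrightarrow> y \<in> img c \<Longrightarrow> 0 \<le> energy c f y"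
  by (simp add: energy_gip gip_nonneg iv_in less_imp_le[OF sg_pos])

lemma continuous_flux:
  assumes "c \<in> A" "smooth_fun A f" shows "continuous_on (img c) (flux c f)"
proof -
  have "continuous_on (img c) (\<lambda>y. \<chi> i. flux c f y $ i)"
    by (intro continuous_on_vec_lambda C1_continuous[OF C1_flux[OF assms]])
  then show ?thesis by simp
qed

lemma continuous_energy:
  assumes "c \<in> A" "smooth_fun A f" shows "continuous_on (img c) (energy c f)"
  unfolding energy_def by (intro continuous_intros continuous_gradv continuous_flux assms)

lemma eigen_smooth: "eigenfunction A G f l \<Longrightarrow> smooth_fun A f"
  by (simp add: eigenfunction_def)

text \<open>The divergence of \<open>F h(f) flux\<close> integrates to zero by
  \<open>integral_partial_eq_0\<close>; its three terms come from differentiating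
  \<open>h(f)\<close>, the flux (where the eigenvalue equation is used) and
  \<open>F\<close>.\<close>

lemma local_green:
  assumes c: "c \<in> A" and f: "eigenfunction A G f l"
    and F: "C1 UNIV F" and K: "compact K" "K \<subseteq> img c" and F0: "\<And>y. y \<notin> K \<Longrightarrow> F y = 0"
    and h: "\<And>t. (h has_real_derivative h' t) (at t)" "continuous_on UNIV h'"
  shows "(\<integral>y. F y * (h' (coord_rep c f y) * energy c f y) \<partial>lborel) =
     l\<^sup>2 * (\<integral>y. F y * (h (coord_rep c f y) * coord_rep c f y * sg c y) \<partial>lborel)
     - (\<integral>y. h (coord_rep c f y) * (gradv F y \<bullet> flux c f y) \<partial>lborel)" (is "?L = ?R1 - ?R2")
    and "integrable lborel (\<lambda>y. F y * (h' (coord_rep c f y) * energy c f y))"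
    and "integrable lborel (\<lambda>y. F y * (h (coord_rep c f y) * coord_rep c f y * sg c y))"
    and "integrable lborel (\<lambda>y. h (coord_rep c f y) * (gradv F y \<bullet> flux c f y))"
proof -
  have sm: "smooth_fun A f" using f by (rule eigen_smooth)
  let ?f = "coord_rep c f"
  have cf: "continuous_on (img c) ?f" using C1_continuous[OF C1_coord_rep(1)[OF c sm]] .
  have hcont: "continuous_on UNIV h" 
    by (rule DERIV_continuous_on[where D=h']) (simp add: h(1))
  have ch: "continuous_on (img c) (\<lambda>y. h (?f y))" by (rule continuous_on_compose2[OF hcont cf]) auto
  have ch': "continuous_on (img c) (\<lambda>y. h' (?f y))" by (rule continuous_on_compose2[OF h(2) cf]) auto
  have csg: "continuous_on (img c) (sg c)" using C1_continuous[OF C1_sg[OF c]] .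
  have cF: "continuous_on UNIV F" by (rule C1_continuous[OF F])
  have cpF: "continuous_on UNIV (partial i F)" for i by (rule C1_continuous_partial[OF F])
  have pF0: "y \<notin> K \<Longrightarrow> partial i F y = 0" for i y by (rule partial_zero_off[OF K(1) F0])
  note intg = continuous_compact_support_integrable[OF continuous_on_mult_extend_zero[OF _ _ open_img[OF c] K] K(1)]
  show i1: "integrable lborel (\<lambda>y. F y * (h' (?f y) * energy c f y))"
    by (rule intg) (auto intro!: cF continuous_intros ch' continuous_energy c sm simp: F0)
  show i2: "integrable lborel (\<lambda>y. F y * (h (?f y) * ?f y * sg c y))"
    by (rule intg) (auto intro!: cF continuous_intros ch cf csg simp: F0)
  have eq3: "h (?f y) * (gradv F y \<bullet> flux c f y) = (\<Sum>i\<in>UNIV. partial i F y * (h (?f y) * flux c f y $ i))" for y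
    by (simp add: inner_vec_def sum_distrib_left mult_ac)
  show i3: "integrable lborel (\<lambda>y. h (?f y) * (gradv F y \<bullet> flux c f y))"
    unfolding eq3
    by (intro Bochner_Integration.integrable_sum intg)
       (auto intro!: cpF continuous_on_mult ch C1_continuous[OF C1_flux[OF c sm]] simp: pF0)
  define g where "g i y = h (?f y) * flux c f y $ i" for i y
  have C1hf: "C1 (img c) (\<lambda>y. h (?f y))"
    by (rule C1_compose[OF C1_coord_rep(1)[OF c sm] h(1)]) (use h(2) continuous_on_subset in auto)
  have C1g: "C1 (img c) (g i)" for i
    unfolding g_def by (intro C1_mult C1hf C1_flux c sm)
  have C1Fg: "C1 UNIV (\<lambda>y. F y * g i y)" for i
    by (rule C1_mult_extend_zero[OF F C1g open_img[OF c] K F0])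
  have int0: "(\<integral>y. partial i (\<lambda>y. F y * g i y) y \<partial>lborel) = 0" for i
    by (rule integral_partial_eq_0[OF C1Fg K(1)]) (simp add: F0)
  have int: "integrable lborel (partial i (\<lambda>y. F y * g i y))" for i
    by (rule continuous_compact_support_integrable[OF C1_continuous_partial[OF C1Fg] K(1)])
       (rule partial_zero_off[OF K(1)], auto simp: F0)
  have pw: "(\<Sum>i\<in>UNIV. partial i (\<lambda>y. F y * g i y) y) =
      F y * (h' (?f y) * energy c f y) - l\<^sup>2 * (F y * (h (?f y) * ?f y * sg c y))
      + h (?f y) * (gradv F y \<bullet> flux c f y)" for y
  proof (cases "y \<in> img c")
    case True
    have dF: "F differentiable (at y)" using F by (simp add: C1_def)
    have dfl: "(\<lambda>y. flux c f y $ i) differentiable (at y)" for i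
      using C1_differentiable[OF C1_flux[OF c sm] True] .
    have df: "?f differentiable (at y)" using C1_differentiable[OF C1_coord_rep(1)[OF c sm] True] .
    have "partial i (\<lambda>y. F y * g i y) y = F y * (h (?f y) * partial i (\<lambda>y. flux c f y $ i) y
        + h' (?f y) * partial i ?f y * flux c f y $ i) + h (?f y) * (partial i F y * flux c f y $ i)" for i
    proof -
      have "partial i (g i) y = h (?f y) * partial i (\<lambda>y. flux c f y $ i) y + h' (?f y) * partial i ?f y * flux c f y $ i"
        unfolding g_def using partial_mult[OF partial_compose(2)[OF df h(1)] dfl]
          partial_compose(1)[OF df h(1)] by simp
      then show ?thesis
        using partial_mult[OF dF C1_differentiable[OF C1g True]] by (simp add: g_def algebra_simps)
    qed
    then have "(\<Sum>i\<in>UNIV. partial i (\<lambda>y. F y * g i y) y) =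
       F y * (h (?f y) * (\<Sum>i\<in>UNIV. partial i (\<lambda>y. flux c f y $ i) y) + h' (?f y) * energy c f y)
       + h (?f y) * (gradv F y \<bullet> flux c f y)"
      by (simp add: sum.distrib sum_distrib_left energy_def inner_vec_def algebra_simps)
    then show ?thesis unfolding div_flux[OF c f True] by (simp add: algebra_simps)
  next
    case False
    then have y: "y \<notin> K" using K(2) by blast
    have "partial i (\<lambda>y. F y * g i y) y = 0" for i
      by (rule partial_zero_off[OF K(1) _ y]) (simp add: F0)
    moreover have "gradv F y = 0" using pF0[OF y] by (simp add: vec_eq_iff)
    ultimately show ?thesis using F0[OF y] by simp
  qed
  have "0 = (\<integral>y. (\<Sum>i\<in>UNIV. partial i (\<lambda>y. F y * g i y) y) \<partial>lborel)"
    using int int0 by (simp add: Bochner_Integration.integral_sum)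
  also have "\<dots> = ?L - ?R1 + ?R2"
    unfolding pw using i1 i2 i3 by simp
  finally show "?L = ?R1 - ?R2" by simp
qed

text \<open>Unlike \<open>coord_rep\<close>, this is zero outside the image of the chart, where
  \<open>inv_into\<close> is unspecified.\<close>

definition chart_part :: "('a, 'n) chart \<Rightarrow> ('a \<Rightarrow> real) \<Rightarrow> real ^ 'n \<Rightarrow> real" where
  "chart_part c u y = (if y \<in> img c then u (iv c y) else 0)"

lemma chart_part_C1:
  assumes c: "c \<in> A" and u: "C1 (img c) (coord_rep c u)" and K: "compact K" "K \<subseteq> img c"
    and 0: "\<And>p. p \<notin> iv c ` K \<Longrightarrow> u p = 0"
  shows "C1 UNIV (chart_part c u)" "y \<notin> K \<Longrightarrow> chart_part c u y = 0"
proof -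
  show z: "chart_part c u y = 0" if "y \<notin> K" for y
  proof (cases "y \<in> img c")
    case True
    have "iv c y \<notin> iv c ` K"
    proof
      assume "iv c y \<in> iv c ` K"
      then obtain y' where "y' \<in> K" "iv c y = iv c y'" by auto
      then have "y = y'" using chart_iv[OF True] chart_iv[of y' c] K(2) by (metis subsetD)
      then show False using that \<open>y' \<in> K\<close> by simp
    qed
    then show ?thesis using 0 by (simp add: chart_part_def)
  qed (simp add: chart_part_def)
  have "C1 (img c) (chart_part c u)"
    by (rule C1_cong_open[OF open_img[OF c] u]) (simp add: chart_part_def coord_rep_def)
  then show "C1 UNIV (chart_part c u)" by (rule C1_extend_zero[OF _ open_img[OF c] K z])
qed

end

context riem_vol begin

text \<open>When \<open>local_green\<close> is summed over the partition, the terms with the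
  gradients of the \<open>th i\<close> cancel because the \<open>th i\<close> add up to 1. They live
  in different charts, so each is rewritten as a volume integral of the global function
  \<open>\<Gamma> i p * h (f p)\<close>.\<close>

lemma global_green:
  assumes part: "chart_partition I K th"
  and f: "eigenfunction A G f l"
  and h: "\<And>t. (h has_real_derivative h' t) (at t)" "continuous_on UNIV h'"
  shows "l\<^sup>2 * (\<integral>p. f p * h (f p) \<partial>V) =
     (\<Sum>i\<in>I. \<integral>y. chart_part (chart_at A i) (th i) y *
        (h' (coord_rep (chart_at A i) f y) * energy (chart_at A i) f y) \<partial>lborel)"
proof -
  note P = chart_partitionD(1,2,3,5,6,7)[OF part]
  have sm: "smooth_fun A f" using f by (rule eigen_smooth)
  have cf: "continuous_on UNIV f" by (rule smooth_fun_continuous[OF sm])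
  have hcont: "continuous_on UNIV h" 
    by (rule DERIV_continuous_on[where D=h']) (simp add: h(1))
  have chf: "continuous_on UNIV (\<lambda>p. h (f p))" by (rule continuous_on_compose2[OF hcont cf]) auto
  have cth: "continuous_on UNIV (th i)" for i by (rule C1_all_charts_continuous[OF P(6)])
  define \<Gamma> where "\<Gamma> i p = gip (chart_at A p) (th i) f p" for i p
  have c\<Gamma>: "continuous_on UNIV (\<Gamma> i)" for i unfolding \<Gamma>_def by (rule gip_continuous[OF P(6) sm])
  have \<Gamma>0: "\<Gamma> i p = 0" if p: "p \<notin> iv (chart_at A i) ` K i" for i p
  proof -
    let ?d = "chart_at A p" and ?c = "chart_at A i"
    define S where "S = snd ?d ` (fst ?d \<inter> - iv ?c ` K i)"
    have "compact (iv ?c ` K i)"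
      by (rule compact_continuous_image[OF continuous_on_subset[OF cont_iv[OF chart_at(1)] P(3)] P(2)])
    then have S: "open S" unfolding S_def
      by (intro open_img_Int chart_at) (use compact_imp_closed in blast)
    have "partial j (coord_rep ?d (th i)) (snd ?d p) = partial j (\<lambda>y. 0) (snd ?d p)" for j
      by (rule partial_cong_open[OF S])
         (use p chart_at(2)[of p] P(5) in \<open>auto simp: S_def coord_rep_def iv_chart[OF chart_at(1)]\<close>)
    then have "gradv (coord_rep ?d (th i)) (snd ?d p) = 0" by (simp add: vec_eq_iff)
    then show ?thesis by (simp add: \<Gamma>_def gip_def)
  qed
  have \<Gamma>sum: "(\<Sum>i\<in>I. \<Gamma> i p) = 0" for p
  proof -
    let ?d = "chart_at A p"
    have d: "?d \<in> A" "p \<in> fst ?d" by (rule chart_at)+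
    have "(\<Sum>i\<in>I. partial j (coord_rep ?d (th i)) (snd ?d p)) = 0" for j
    proof -
      have "(\<Sum>i\<in>I. partial j (coord_rep ?d (th i)) (snd ?d p)) = partial j (\<lambda>y. \<Sum>i\<in>I. coord_rep ?d (th i) y) (snd ?d p)"
        by (rule partial_sum[symmetric]) (use C1_differentiable[OF P(6)[OF d(1)]] d(2) in blast)
      also have "(\<lambda>y. \<Sum>i\<in>I. coord_rep ?d (th i) y) = (\<lambda>y. 1)" using P(4) by (simp add: coord_rep_def)
      finally show ?thesis by simp
    qed
    then have "(\<Sum>i\<in>I. gradv (coord_rep ?d (th i)) (snd ?d p)) = 0" by (simp add: vec_eq_iff)
    moreover have "(\<Sum>i\<in>I. \<Gamma> i p) = (\<Sum>i\<in>I. gradv (coord_rep ?d (th i)) (snd ?d p)) \<bullet>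
        (matrix_inv (G ?d p) *v gradv (coord_rep ?d f) (snd ?d p))"
      by (simp add: \<Gamma>_def gip_def inner_sum_left)
    ultimately show ?thesis by simp
  qed
  have green_i: "(\<integral>y. chart_part (chart_at A i) (th i) y *
        (h' (coord_rep (chart_at A i) f y) * energy (chart_at A i) f y) \<partial>lborel) =
      l\<^sup>2 * (\<integral>p. th i p * (h (f p) * f p) \<partial>V) - (\<integral>p. \<Gamma> i p * h (f p) \<partial>V)" for i
  proof -
    let ?c = "chart_at A i"
    have c: "?c \<in> A" by (rule chart_at)
    note cp = chart_part_C1[OF c P(6)[OF c] P(2) P(3) P(5)]
    have off: "p \<notin> iv ?c ` K i" if "p \<notin> fst ?c" for p using that P(3)[of i] iv_in[of _ ?c] by auto
    have "(\<integral>p. th i p * (h (f p) * f p) \<partial>V) =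
        (\<integral>y. indicator (img ?c) y * sg ?c y * coord_rep ?c (\<lambda>p. th i p * (h (f p) * f p)) y \<partial>lborel)"
      by (rule integral_V_chart[OF c])
         (auto intro!: borel_measurable_continuous_onI continuous_on_mult cth chf cf simp: P(5)[OF off])
    also have "\<dots> = (\<integral>y. chart_part ?c (th i) y * (h (coord_rep ?c f y) * coord_rep ?c f y * sg ?c y) \<partial>lborel)"
      by (rule Bochner_Integration.integral_cong) (auto simp: chart_part_def coord_rep_def indicator_def)
    finally have 1: "(\<integral>p. th i p * (h (f p) * f p) \<partial>V) =
      (\<integral>y. chart_part ?c (th i) y * (h (coord_rep ?c f y) * coord_rep ?c f y * sg ?c y) \<partial>lborel)" .
    have "(\<integral>p. \<Gamma> i p * h (f p) \<partial>V) =
        (\<integral>y. indicator (img ?c) y * sg ?c y * coord_rep ?c (\<lambda>p. \<Gamma> i p * h (f p)) y \<partial>lborel)"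
      by (rule integral_V_chart[OF c])
         (auto intro!: borel_measurable_continuous_onI continuous_on_mult c\<Gamma> chf simp: \<Gamma>0[OF off])
    also have "\<dots> = (\<integral>y. h (coord_rep ?c f y) * (gradv (chart_part ?c (th i)) y \<bullet> flux ?c f y) \<partial>lborel)"
    proof (rule Bochner_Integration.integral_cong[OF refl])
      fix y
      show "indicator (img ?c) y * sg ?c y * coord_rep ?c (\<lambda>p. \<Gamma> i p * h (f p)) y =
         h (coord_rep ?c f y) * (gradv (chart_part ?c (th i)) y \<bullet> flux ?c f y)"
      proof (cases "y \<in> img ?c")
        case True
        have "partial j (chart_part ?c (th i)) y = partial j (coord_rep ?c (th i)) y" for j
          by (rule partial_cong_open[OF open_img[OF c] True]) (simp add: chart_part_def coord_rep_def)
        then have "gradv (chart_part ?c (th i)) y = gradv (coord_rep ?c (th i)) y" by (simp add: vec_eq_iff)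
        then have "gradv (chart_part ?c (th i)) y \<bullet> flux ?c f y = sg ?c y * gip ?c (th i) f (iv ?c y)"
          using flux_gip[OF c True] by simp
        also have "gip ?c (th i) f (iv ?c y) = \<Gamma> i (iv ?c y)" unfolding \<Gamma>_def
          by (rule gip_invariant[OF chart_at(1) c chart_at(2) iv_in[OF True], symmetric])
             (use chart_iv[OF True] True C1_differentiable[OF P(6)[OF c]] C1_differentiable[OF C1_coord_rep(1)[OF c sm]] in simp_all)
        finally show ?thesis using True by (simp add: coord_rep_def)
      next
        case False
        then have "y \<notin> K i" using P(3) by blast
        then have "gradv (chart_part ?c (th i)) y = 0"
          using partial_zero_off[OF P(2) cp(2)] by (simp add: vec_eq_iff)
        then show ?thesis using False by simp
      qed
    qed
    finally have 2: "(\<integral>p. \<Gamma> i p * h (f p) \<partial>V) =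
       (\<integral>y. h (coord_rep ?c f y) * (gradv (chart_part ?c (th i)) y \<bullet> flux ?c f y) \<partial>lborel)" .
    show ?thesis unfolding 1 2 by (rule local_green(1)[OF c f cp(1) P(2) P(3) cp(2) h])
  qed
  have i1: "integrable V (\<lambda>p. th i p * (h (f p) * f p))" for i
    by (intro continuous_integrable_V continuous_on_mult cth chf cf)
  have i2: "integrable V (\<lambda>p. \<Gamma> i p * h (f p))" for i
    by (intro continuous_integrable_V continuous_on_mult c\<Gamma> chf)
  have "(\<Sum>i\<in>I. \<integral>p. th i p * (h (f p) * f p) \<partial>V) = (\<integral>p. (\<Sum>i\<in>I. th i p * (h (f p) * f p)) \<partial>V)"
    using i1 by (simp add: Bochner_Integration.integral_sum)
  also have "\<dots> = (\<integral>p. f p * h (f p) \<partial>V)"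
    by (simp add: sum_distrib_right[symmetric] P(4) mult.commute)
  finally have s1: "(\<Sum>i\<in>I. \<integral>p. th i p * (h (f p) * f p) \<partial>V) = (\<integral>p. f p * h (f p) \<partial>V)" .
  have "(\<Sum>i\<in>I. \<integral>p. \<Gamma> i p * h (f p) \<partial>V) = (\<integral>p. (\<Sum>i\<in>I. \<Gamma> i p * h (f p)) \<partial>V)"
    using i2 by (simp add: Bochner_Integration.integral_sum)
  also have "\<dots> = 0" by (simp add: sum_distrib_right[symmetric] \<Gamma>sum)
  finally have s2: "(\<Sum>i\<in>I. \<integral>p. \<Gamma> i p * h (f p) \<partial>V) = 0" .
  show ?thesis unfolding green_i sum_subtractf sum_distrib_left[symmetric] s1 s2 by simp
qed

end

section \<open>The region of small gradient\<close>

text \<open>The admissible approximations of the sign function and their derivatives. The bound 2 is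
  a round number above \<open>pi / 2\<close>, the supremum of the arctangent; estimates stated for
  all such pairs are uniform in the steepness of \<open>h\<close>.\<close>

definition bounded_C1_pair :: "(real \<Rightarrow> real) \<Rightarrow> (real \<Rightarrow> real) \<Rightarrow> bool" where
  "bounded_C1_pair h h' \<longleftrightarrow>
     (\<forall>t. (h has_real_derivative h' t) (at t)) \<and> continuous_on UNIV h' \<and> (\<forall>t. \<bar>h t\<bar> \<le> 2)"

lemma bounded_C1_pairD:
  assumes "bounded_C1_pair h h'"
  shows "(h has_real_derivative h' t) (at t)" "continuous_on UNIV h'" "\<bar>h t\<bar> \<le> 2"
  using assms by (simp_all add: bounded_C1_pair_def)

lemma one_plus_square_pos: "1 + (x::real)\<^sup>2 > 0"
  by (simp add: add_pos_nonneg)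

lemma bounded_C1_pair_arctan: "bounded_C1_pair (\<lambda>t. arctan (k * t)) (\<lambda>t. k / (1 + (k * t)\<^sup>2))"
  unfolding bounded_C1_pair_def
proof (intro conjI allI)
  fix t
  have "((\<lambda>t. arctan (k * t)) has_real_derivative inverse (1 + (k * t)\<^sup>2) * k) (at t)"
    by (rule DERIV_chain2[OF DERIV_arctan]) (auto intro!: derivative_eq_intros)
  then show "((\<lambda>t. arctan (k * t)) has_real_derivative k / (1 + (k * t)\<^sup>2)) (at t)"
    by (simp add: field_simps)
  show "\<bar>arctan (k * t)\<bar> \<le> 2" using arctan_bounded[of "k * t"] pi_half_less_two by linarith
  show "continuous_on UNIV (\<lambda>t. k / (1 + (k * t)\<^sup>2))"
    using less_imp_neq[OF one_plus_square_pos, symmetric] by (intro continuous_intros) auto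
qed

text \<open>Equal to 1 up to \<open>t = 1\<close>, then decaying like \<open>t^-2\<close>. What
  counts is that \<open>t * cutoff' t\<close> is bounded and that \<open>cutoff (k a)\<close> and
  \<open>k * cutoff' (k a)\<close> tend to 0 for every \<open>a > 0\<close>.\<close>

definition cutoff :: "real \<Rightarrow> real" where "cutoff t = 1 / (1 + (max 0 (t - 1))\<^sup>2)"

definition cutoff' :: "real \<Rightarrow> real" where
  "cutoff' t = - (2 * max 0 (t - 1)) / (1 + (max 0 (t - 1))\<^sup>2)\<^sup>2"

lemma cutoff_bounds: "0 < cutoff t" "cutoff t \<le> 1"
  using one_plus_square_pos[of "max 0 (t - 1)"] by (simp_all add: cutoff_def)

lemma cutoff_eq_1: "t \<le> 1 \<Longrightarrow> cutoff t = 1" "t \<le> 1 \<Longrightarrow> cutoff' t = 0"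
  by (simp_all add: cutoff_def cutoff'_def)

lemma cutoff_deriv: "(cutoff has_real_derivative cutoff' t) (at t)"
proof -
  have *: "((\<lambda>t. (max 0 (t - 1))\<^sup>2) has_real_derivative 2 * max 0 (t - 1) * 1) (at t)"
    by (rule DERIV_chain2[OF DERIV_max0_square]) (auto intro!: derivative_eq_intros)
  have "((\<lambda>t. 1 / (1 + (max 0 (t - 1))\<^sup>2)) has_real_derivative
      (0 * (1 + (max 0 (t - 1))\<^sup>2) - 1 * (0 + 2 * max 0 (t - 1) * 1)) /
      ((1 + (max 0 (t - 1))\<^sup>2) * (1 + (max 0 (t - 1))\<^sup>2))) (at t)"
    by (rule DERIV_divide[OF DERIV_const DERIV_add[OF DERIV_const *]])
       (rule less_imp_neq[symmetric, OF one_plus_square_pos])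
  then have "((\<lambda>t. 1 / (1 + (max 0 (t - 1))\<^sup>2)) has_real_derivative cutoff' t) (at t)"
    by (simp add: cutoff'_def power2_eq_square[of "1 + (max 0 (t - 1))\<^sup>2"])
  then show ?thesis by (simp add: cutoff_def[abs_def])
qed

lemma continuous_cutoff': "continuous_on S cutoff'"
  unfolding cutoff'_def using one_plus_square_pos
  by (auto intro!: continuous_intros simp: less_imp_neq[symmetric])

text \<open>The factor \<open>t\<close> arises in the gradient of \<open>cutoff (k q)\<close>, once
  the derivative of \<open>q\<close> along the flux is bounded by a multiple of \<open>q\<close>.
  The constant comes from \<open>2 m (m + 1) \<le> 3 (1 + m^2)\<close>.\<close>

lemma cutoff'_bound: "\<bar>cutoff' t * t\<bar> \<le> 3"
proof (cases "t \<le> 1")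
  case False
  define m where "m = t - 1"
  have m: "m > 0" "t = m + 1" using False by (auto simp: m_def)
  have p: "1 + m\<^sup>2 > 0" by (rule one_plus_square_pos)
  have "\<bar>cutoff' t * t\<bar> = (2 * m * (m + 1)) / (1 + m\<^sup>2)\<^sup>2"
    using m by (simp add: cutoff'_def abs_mult)
  also have "\<dots> \<le> 3"
  proof -
    have "2 * m * (m + 1) \<le> 3 * (1 + m\<^sup>2)"
      using sum_squares_bound[of m 1] by (simp add: power2_eq_square algebra_simps)
    also have "\<dots> \<le> 3 * (1 + m\<^sup>2)\<^sup>2"
      using mult_left_mono[of 1 "1 + m\<^sup>2" "1 + m\<^sup>2"] by (simp add: power2_eq_square[of "1 + m\<^sup>2"])
    finally show ?thesis using p by (simp add: divide_le_eq)
  qed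
  finally show ?thesis .
qed (simp add: cutoff_eq_1)

lemma cutoff_lim: "a > 0 \<Longrightarrow> (\<lambda>k. cutoff (real (Suc k) * a)) \<longlonglongrightarrow> 0"
  unfolding cutoff_def by real_asymp

lemma cutoff'_lim: "a > 0 \<Longrightarrow> (\<lambda>k. cutoff' (real (Suc k) * a) * real (Suc k)) \<longlonglongrightarrow> 0"
  unfolding cutoff'_def by real_asymp

lemma compact_bounded_real:
  fixes f :: "'b::topological_space \<Rightarrow> real"
  assumes "compact K" "continuous_on K f"
  obtains M where "M \<ge> 0" "\<And>y. y \<in> K \<Longrightarrow> \<bar>f y\<bar> \<le> M"
proof -
  have "bounded (f ` K)" using assms compact_continuous_image compact_imp_bounded by blast
  then obtain M where "\<And>y. y \<in> K \<Longrightarrow> \<bar>f y\<bar> \<le> M" unfolding bounded_iff by auto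
  then show thesis using that[of "max 0 M"] by (meson max.cobounded1 max.coboundedI2)
qed

lemma matrix_family_upper_bound:
  fixes M :: "'b::topological_space \<Rightarrow> real ^ 'n ^ 'n::finite"
  assumes K: "compact K" and M: "continuous_on K M"
  obtains B where "B \<ge> 0" "\<And>y v. y \<in> K \<Longrightarrow> norm (M y *v v) \<le> B * norm v"
proof -
  let ?S = "K \<times> sphere (0 :: real ^ 'n) 1"
  have "continuous_on ?S (\<lambda>z. norm (M (fst z) *v snd z))"
    by (intro continuous_intros continuous_matrix_vector continuous_on_compose2[OF M]) auto
  moreover have "compact ?S" using K by (intro compact_Times) auto
  ultimately obtain B where B: "B \<ge> 0" "\<And>z. z \<in> ?S \<Longrightarrow> \<bar>norm (M (fst z) *v snd z)\<bar> \<le> B"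
    using compact_bounded_real by blast
  have "norm (M y *v v) \<le> B * norm v" if y: "y \<in> K" for y v
  proof (cases "v = 0")
    case False
    define w where "w = (1 / norm v) *\<^sub>R v"
    have "norm w = 1" using False by (simp add: w_def)
    then have "norm (M y *v w) \<le> B" using B(2)[of "(y, w)"] y by simp
    then show ?thesis using False by (simp add: w_def matrix_vector_mult_scaleR field_simps)
  qed simp
  then show thesis using that B(1) by blast
qed

context riem begin

text \<open>Bounds for the inverse metric and for \<open>sg\<close> on a compact set, applied to the
  differential of \<open>f\<close>. The constant does not involve \<open>f\<close>, which makes the
  final constant uniform over eigenfunctions.\<close>

lemma flux_bounds:
  assumes c: "c \<in> A" and K: "compact K" "K \<subseteq> img c"
  obtains C where "C > 0" "\<And>y f. y \<in> K \<Longrightarrow> norm (flux c f y) \<le> C * norm (gradv (coord_rep c f) y)"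
    "\<And>y f. y \<in> K \<Longrightarrow> norm (gradv (coord_rep c f) y) \<le> C * sqrt (gip c f f (iv c y))"
    "\<And>y. y \<in> K \<Longrightarrow> sg c y \<le> C"
proof -
  have csg: "continuous_on K (sg c)" using C1_continuous[OF C1_sg[OF c]] continuous_on_subset K(2) by blast
  have cinv: "continuous_on K (\<lambda>y. matrix_inv (Gr c y))"
    by (rule continuous_on_subset[OF continuous_matrix_inv[OF c] K(2)])
  obtain B where B: "B \<ge> 0" "\<And>y v. y \<in> K \<Longrightarrow> norm (matrix_inv (Gr c y) *v v) \<le> B * norm v"
    by (rule matrix_family_upper_bound[OF K(1) cinv]) blast
  obtain S where S: "S \<ge> 0" "\<And>y. y \<in> K \<Longrightarrow> \<bar>sg c y\<bar> \<le> S" by (rule compact_bounded_real[OF K(1) csg]) blast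
  obtain m where m: "m > 0" "\<And>y v. y \<in> K \<Longrightarrow> m * (norm v)\<^sup>2 \<le> v \<bullet> (matrix_inv (Gr c y) *v v)"
    by (rule posdef_family_lower_bound[OF K(1) cinv])
       (use posdef_inv_pos[OF posdef_Gr[OF c]] K(2) in blast)+
  define C where "C = S * B + 1 / sqrt m + S + 1"
  have C: "S * B \<le> C" "1 / sqrt m \<le> C" "S \<le> C" "C > 0"
    using S(1) B(1) m(1) by (auto simp: C_def add_nonneg_nonneg intro!: add_nonneg_pos)
  show thesis
  proof (rule that[of C])
    show "C > 0" by fact
    show "norm (flux c f y) \<le> C * norm (gradv (coord_rep c f) y)" if y: "y \<in> K" for y f
    proof -
      have "norm (flux c f y) = \<bar>sg c y\<bar> * norm (matrix_inv (Gr c y) *v gradv (coord_rep c f) y)"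
        by (simp add: flux_def)
      also have "\<dots> \<le> S * (B * norm (gradv (coord_rep c f) y))"
        by (intro mult_mono S B y) (use S(1) in auto)
      also have "\<dots> \<le> C * norm (gradv (coord_rep c f) y)"
        using mult_right_mono[OF C(1), of "norm (gradv (coord_rep c f) y)"] by (simp add: mult.assoc)
      finally show ?thesis .
    qed
    show "norm (gradv (coord_rep c f) y) \<le> C * sqrt (gip c f f (iv c y))" if y: "y \<in> K" for y f
    proof -
      have yi: "y \<in> img c" using y K(2) by blast
      have "m * (norm (gradv (coord_rep c f) y))\<^sup>2 \<le> gip c f f (iv c y)"
        unfolding gip_iv[OF c yi] by (rule m(2)[OF y])
      then have "sqrt (m * (norm (gradv (coord_rep c f) y))\<^sup>2) \<le> sqrt (gip c f f (iv c y))" by simp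
      then have "sqrt m * norm (gradv (coord_rep c f) y) \<le> sqrt (gip c f f (iv c y))"
        by (simp add: real_sqrt_mult)
      then have "norm (gradv (coord_rep c f) y) \<le> 1 / sqrt m * sqrt (gip c f f (iv c y))"
        using m(1) by (simp add: field_simps)
      also have "\<dots> \<le> C * sqrt (gip c f f (iv c y))"
        by (rule mult_right_mono[OF C(2)]) (simp add: gip_nonneg[OF c iv_in[OF yi]])
      finally show ?thesis .
    qed
    show "sg c y \<le> C" if "y \<in> K" for y using S(2)[OF that] C(3) by simp
  qed
qed

text \<open>The Euclidean rather than the Riemannian square of the differential: it vanishes at the
  same points, and differentiating it does not involve the metric.\<close>

definition grad_sq :: "('a, 'n) chart \<Rightarrow> ('a \<Rightarrow> real) \<Rightarrow> real ^ 'n \<Rightarrow> real" where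
  "grad_sq c f y = (\<Sum>j\<in>UNIV. partial j (coord_rep c f) y * partial j (coord_rep c f) y)"

lemma grad_sq_norm: "grad_sq c f y = (norm (gradv (coord_rep c f) y))\<^sup>2"
  by (simp add: grad_sq_def power2_norm_eq_inner inner_vec_def)

lemma grad_sq_nonneg: "grad_sq c f y \<ge> 0"
  by (simp add: grad_sq_norm)

lemma C1_grad_sq: "c \<in> A \<Longrightarrow> smooth_fun A f \<Longrightarrow> C1 (img c) (grad_sq c f)"
  unfolding grad_sq_def[abs_def] by (intro C1_sum C1_mult C1_coord_rep(2))

lemma grad_sq_zero:
  assumes "grad_sq c f y = 0" shows "flux c f y = 0" "energy c f y = 0"
proof -
  have "gradv (coord_rep c f) y = 0" using assms by (simp add: grad_sq_norm)
  then show "flux c f y = 0" "energy c f y = 0" by (simp_all add: flux_def energy_def)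
qed

text \<open>The gradient of \<open>|df|^2\<close> is twice the Hessian applied to \<open>df\<close>,
  and \<open>flux\<close> is linear in \<open>df\<close>, so the product is quadratic in
  \<open>df\<close>. The constant contains the Hessian of \<open>f\<close>; it serves only to
  dominate a limit.\<close>

lemma grad_sq_flux_bound:
  assumes c: "c \<in> A" and f: "smooth_fun A f" and K: "compact K" "K \<subseteq> img c"
  obtains C where "C \<ge> 0" "\<And>y. y \<in> K \<Longrightarrow> \<bar>gradv (grad_sq c f) y \<bullet> flux c f y\<bar> \<le> C * grad_sq c f y"
proof -
  obtain C1 where C1: "C1 > 0" "\<And>y f. y \<in> K \<Longrightarrow> norm (flux c f y) \<le> C1 * norm (gradv (coord_rep c f) y)"
    by (rule flux_bounds[OF c K]) blast
  have "\<exists>M\<ge>0. \<forall>y\<in>K. \<bar>partial i (partial j (coord_rep c f)) y\<bar> \<le> M" for i j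
    by (rule compact_bounded_real[OF K(1)
        continuous_on_subset[OF C1_continuous_partial[OF C1_coord_rep(2)[OF c f]] K(2)]]) blast
  then obtain M where M: "\<And>i j. M i j \<ge> 0" "\<And>i j y. y \<in> K \<Longrightarrow> \<bar>partial i (partial j (coord_rep c f)) y\<bar> \<le> M i j"
    by metis
  define C where "C = (\<Sum>i\<in>UNIV. \<Sum>j\<in>UNIV. 2 * M i j * C1)"
  have "\<bar>gradv (grad_sq c f) y \<bullet> flux c f y\<bar> \<le> C * grad_sq c f y" if y: "y \<in> K" for y
  proof -
    define D where "D = norm (gradv (coord_rep c f) y)"
    have pj: "\<bar>partial j (coord_rep c f) y\<bar> \<le> D" for j
      unfolding D_def using component_le_norm_cart[of "gradv (coord_rep c f) y" j] by simp
    have fl: "\<bar>flux c f y $ i\<bar> \<le> C1 * D" for i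
      unfolding D_def using component_le_norm_cart[of "flux c f y" i] C1(2)[OF y, of f] by linarith
    have dj: "partial j (coord_rep c f) differentiable (at y)" for j
      using C1_differentiable[OF C1_coord_rep(2)[OF c f]] y K(2) by blast
    have "partial i (grad_sq c f) y = (\<Sum>j\<in>UNIV. 2 * partial j (coord_rep c f) y * partial i (partial j (coord_rep c f)) y)" for i
      unfolding grad_sq_def[abs_def]
      by (subst partial_sum) (auto intro: differentiable_mult dj simp: partial_mult[OF dj dj] mult.assoc)
    then have "\<bar>gradv (grad_sq c f) y \<bullet> flux c f y\<bar> =
        \<bar>\<Sum>i\<in>UNIV. \<Sum>j\<in>UNIV. 2 * partial j (coord_rep c f) y * partial i (partial j (coord_rep c f)) y * flux c f y $ i\<bar>"
      by (simp add: inner_vec_def sum_distrib_right)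
    also have "\<dots> \<le> (\<Sum>i\<in>UNIV. \<Sum>j\<in>UNIV. \<bar>2 * partial j (coord_rep c f) y * partial i (partial j (coord_rep c f)) y * flux c f y $ i\<bar>)"
      by (intro order_trans[OF sum_abs] sum_mono sum_abs)
    also have "\<dots> \<le> (\<Sum>i\<in>UNIV. \<Sum>j\<in>UNIV. 2 * D * M i j * (C1 * D))"
    proof (intro sum_mono)
      fix i j
      show "\<bar>2 * partial j (coord_rep c f) y * partial i (partial j (coord_rep c f)) y * flux c f y $ i\<bar>
          \<le> 2 * D * M i j * (C1 * D)"
        unfolding abs_mult
        by (intro mult_mono pj M(2)[OF y] fl mult_nonneg_nonneg) (use M(1) in \<open>auto simp: D_def\<close>)
    qed
    also have "\<dots> = C * grad_sq c f y"
      unfolding C_def grad_sq_norm D_def[symmetric] by (simp add: sum_distrib_left sum_distrib_right power2_eq_square mult_ac)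
    finally show ?thesis .
  qed
  moreover have "C \<ge> 0" unfolding C_def using M(1) C1(1) by (intro sum_nonneg) simp
  ultimately show thesis using that by blast
qed

text \<open>The region of small gradient is negligible: with the cut-off to \<open>{|\<nabla>f|\<^sup>2 < 1/k}\<close> the divergences
  converge boundedly to the density of \<open>-\<Delta>f\<close> on \<open>{\<nabla>f = 0}\<close>. The same limit taken with \<open>h = id\<close>
  shows that \<open>f = 0\<close> almost everywhere there, which makes this density vanish.\<close>

lemma small_gradient:
  assumes c: "c \<in> A" and f: "eigenfunction A G f l"
    and F: "C1 UNIV F" and K: "compact K" "K \<subseteq> img c" and F0: "\<And>y. y \<notin> K \<Longrightarrow> F y = 0"
    and Fnn: "\<And>y. 0 \<le> F y" and \<tau>: "\<tau> > 0"
  obtains N :: nat where "N > 0"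
    "C1 UNIV (\<lambda>y. F y * cutoff (real N * grad_sq c f y))"
    "\<And>h h'. bounded_C1_pair h h' \<Longrightarrow>
       (\<integral>y. F y * cutoff (real N * grad_sq c f y) * (h' (coord_rep c f y) * energy c f y) \<partial>lborel) \<le> \<tau>"
proof -
  have sm: "smooth_fun A f" using f by (rule eigen_smooth)
  let ?f = "coord_rep c f" and ?g = "grad_sq c f" and ?b = "flux c f"
  define Gk where "Gk k y = F y * cutoff (real (Suc k) * ?g y)" for k y
  have C1cut: "C1 (img c) (\<lambda>y. cutoff (real (Suc k) * ?g y))" for k
    by (rule C1_compose[where f = "\<lambda>y. real (Suc k) * ?g y" and h' = cutoff'])
       (intro C1_mult C1_const C1_grad_sq c sm cutoff_deriv continuous_cutoff')+
  have C1G: "C1 UNIV (Gk k)" for k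
    unfolding Gk_def[abs_def] by (rule C1_mult_extend_zero[OF F C1cut open_img[OF c] K F0])
  have G0: "y \<notin> K \<Longrightarrow> Gk k y = 0" for k y by (simp add: Gk_def F0)
  have gG0: "y \<notin> K \<Longrightarrow> gradv (Gk k) y = 0" for k y
    using partial_zero_off[OF K(1) G0] by (simp add: vec_eq_iff)
  note green = local_green[OF c f C1G K]
  \<comment> \<open>\<open>E k\<close> is minus the divergence of \<open>Gk k\<close> times the
    flux. Green's identity becomes
    \<open>\<integral> Gk h'(f) energy = \<integral> h(f) E k\<close>, whose right side is bounded
    by the supremum of \<open>h\<close> times the L1 norm of \<open>E k\<close>.\<close>
  define E where "E k y = l\<^sup>2 * (Gk k y * (?f y * sg c y)) - gradv (Gk k) y \<bullet> ?b y" for k y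
  have greenE: "(\<integral>y. Gk k y * (h' (?f y) * energy c f y) \<partial>lborel) = (\<integral>y. h (?f y) * E k y \<partial>lborel)"
    "integrable lborel (\<lambda>y. h (?f y) * E k y)"
    if h: "\<And>t. (h has_real_derivative h' t) (at t)" "continuous_on UNIV h'" for h h' k
  proof -
    have eq: "h (?f y) * E k y = l\<^sup>2 * (Gk k y * (h (?f y) * ?f y * sg c y)) - h (?f y) * (gradv (Gk k) y \<bullet> ?b y)" for y
      by (simp add: E_def algebra_simps)
    show "integrable lborel (\<lambda>y. h (?f y) * E k y)"
      unfolding eq using green(3,4)[OF G0 h] by simp
    show "(\<integral>y. Gk k y * (h' (?f y) * energy c f y) \<partial>lborel) = (\<integral>y. h (?f y) * E k y \<partial>lborel)"
      unfolding eq using green[OF G0 h] by simp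
  qed
  have d1: "((\<lambda>t. 1) has_real_derivative 0) (at t)" for t :: real by simp
  have Eint: "integrable lborel (E k)" for k
    using greenE(2)[of "\<lambda>t. 1" "\<lambda>t. 0"] d1 by simp
  \<comment> \<open>The pointwise limit of \<open>E k\<close>: where the gradient is nonzero all
    cut-off terms die out, and where it vanishes so does the flux.\<close>
  define E0 where "E0 y = (if ?g y = 0 then l\<^sup>2 * (F y * (?f y * sg c y)) else 0)" for y
  have gG: "gradv (Gk k) y \<bullet> ?b y = cutoff (real (Suc k) * ?g y) * (gradv F y \<bullet> ?b y)
      + F y * (cutoff' (real (Suc k) * ?g y) * real (Suc k)) * (gradv ?g y \<bullet> ?b y)" if y: "y \<in> K" for k y
  proof -
    have yi: "y \<in> img c" using y K(2) by blast
    have dF: "F differentiable (at y)" using F by (simp add: C1_def)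
    have dg: "?g differentiable (at y)" using C1_differentiable[OF C1_grad_sq[OF c sm] yi] .
    have dkg: "(\<lambda>y. real (Suc k) * ?g y) differentiable (at y)" using dg by (intro differentiable_mult) auto
    have "partial i (Gk k) y = cutoff (real (Suc k) * ?g y) * partial i F y
        + F y * (cutoff' (real (Suc k) * ?g y) * real (Suc k)) * partial i ?g y" for i
    proof -
      have "partial i (\<lambda>y. cutoff (real (Suc k) * ?g y)) y = cutoff' (real (Suc k) * ?g y) * (real (Suc k) * partial i ?g y)"
        using partial_compose(1)[OF dkg cutoff_deriv] partial_mult[of "\<lambda>y. real (Suc k)" y ?g i] dg by simp
      then show ?thesis unfolding Gk_def[abs_def]
        using partial_mult[OF dF C1_differentiable[OF C1cut yi]] by (simp add: mult_ac)
    qed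
    then have "gradv (Gk k) y = cutoff (real (Suc k) * ?g y) *\<^sub>R gradv F y
       + (F y * (cutoff' (real (Suc k) * ?g y) * real (Suc k))) *\<^sub>R gradv ?g y"
      by (simp add: vec_eq_iff)
    then show ?thesis by (simp add: inner_add_left)
  qed
  have lim: "(\<lambda>k. E k y) \<longlonglongrightarrow> E0 y" for y
  proof (cases "y \<in> K")
    case False
    then show ?thesis by (simp add: E_def E0_def G0 gG0 F0)
  next
    case True
    show ?thesis
    proof (cases "?g y = 0")
      case True
      then show ?thesis using gG[OF \<open>y \<in> K\<close>] grad_sq_zero[OF True]
        by (simp add: E_def E0_def Gk_def cutoff_eq_1)
    next
      case False
      then have pos: "?g y > 0" using grad_sq_nonneg[of c f y] by simp
      have "(\<lambda>k. l\<^sup>2 * (F y * cutoff (real (Suc k) * ?g y) * (?f y * sg c y))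
         - (cutoff (real (Suc k) * ?g y) * (gradv F y \<bullet> ?b y)
          + F y * (cutoff' (real (Suc k) * ?g y) * real (Suc k)) * (gradv ?g y \<bullet> ?b y)))
        \<longlonglongrightarrow> l\<^sup>2 * (F y * 0 * (?f y * sg c y)) - (0 * (gradv F y \<bullet> ?b y) + F y * 0 * (gradv ?g y \<bullet> ?b y))"
        by (intro tendsto_intros cutoff_lim cutoff'_lim pos)
      then show ?thesis unfolding E_def gG[OF \<open>y \<in> K\<close>] Gk_def using False by (simp add: E0_def)
    qed
  qed
  have Fcont: "continuous_on UNIV F" using C1_continuous[OF F] .
  obtain MF where MF: "MF \<ge> 0" "\<And>y. y \<in> K \<Longrightarrow> \<bar>F y\<bar> \<le> MF"
    by (rule compact_bounded_real[OF K(1) continuous_on_subset[OF Fcont subset_UNIV]]) blast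
  have cf: "continuous_on K ?f" by (rule continuous_on_subset[OF C1_continuous[OF C1_coord_rep(1)[OF c sm]] K(2)])
  obtain Mf where Mf: "Mf \<ge> 0" "\<And>y. y \<in> K \<Longrightarrow> \<bar>?f y\<bar> \<le> Mf"
    by (rule compact_bounded_real[OF K(1) cf]) blast
  obtain M1 where M1: "M1 \<ge> 0" "\<And>y. y \<in> K \<Longrightarrow> \<bar>?f y * sg c y\<bar> \<le> M1"
    by (rule compact_bounded_real[OF K(1) continuous_on_mult[OF cf
          continuous_on_subset[OF C1_continuous[OF C1_sg[OF c]] K(2)]]]) blast
  have cgF: "continuous_on K (\<lambda>y. gradv F y \<bullet> ?b y)"
    unfolding gradv_def
    by (intro continuous_on_inner continuous_on_vec_lambda continuous_on_subset[OF C1_continuous_partial[OF F] subset_UNIV]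
        continuous_on_subset[OF continuous_flux[OF c sm] K(2)])
  obtain M2 where M2: "M2 \<ge> 0" "\<And>y. y \<in> K \<Longrightarrow> \<bar>gradv F y \<bullet> ?b y\<bar> \<le> M2"
    by (rule compact_bounded_real[OF K(1) cgF]) blast
  obtain CR where CR: "CR \<ge> 0" "\<And>y. y \<in> K \<Longrightarrow> \<bar>gradv ?g y \<bullet> ?b y\<bar> \<le> CR * ?g y"
    by (rule grad_sq_flux_bound[OF c sm K]) blast
  define M where "M = l\<^sup>2 * (MF * M1) + (M2 + MF * (3 * CR))"
  have dom: "\<bar>E k y\<bar> \<le> M * indicator K y" for k y
  proof (cases "y \<in> K")
    case True
    have cb: "\<bar>cutoff t\<bar> \<le> 1" for t using cutoff_bounds[of t] by simp
    have G: "\<bar>Gk k y\<bar> \<le> MF"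
      unfolding Gk_def abs_mult using mult_mono[OF MF(2)[OF True] cb MF(1)] by simp
    have a: "\<bar>l\<^sup>2 * (Gk k y * (?f y * sg c y))\<bar> \<le> l\<^sup>2 * (MF * M1)"
      unfolding abs_mult[of "l\<^sup>2"] abs_mult[of "Gk k y"]
      by (intro mult_mono G M1(2)[OF True] MF(1) mult_nonneg_nonneg) auto
    have b: "\<bar>cutoff (real (Suc k) * ?g y) * (gradv F y \<bullet> ?b y)\<bar> \<le> M2"
      unfolding abs_mult using mult_mono[OF cb M2(2)[OF True], of "real (Suc k) * ?g y"] by simp
    \<comment> \<open>The bound by \<open>CR * ?g y\<close> compensates the growing factor
      \<open>Suc k\<close>, so that \<open>cutoff'_bound\<close> applies.\<close>
    have d: "\<bar>cutoff' (real (Suc k) * ?g y) * real (Suc k) * (gradv ?g y \<bullet> ?b y)\<bar> \<le> 3 * CR"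
    proof -
      have "\<bar>cutoff' (real (Suc k) * ?g y) * real (Suc k) * (gradv ?g y \<bullet> ?b y)\<bar>
          \<le> \<bar>cutoff' (real (Suc k) * ?g y) * real (Suc k)\<bar> * (CR * ?g y)"
        unfolding abs_mult[of _ "gradv ?g y \<bullet> ?b y"] by (intro mult_left_mono CR(2)[OF True]) simp
      also have "\<dots> = \<bar>cutoff' (real (Suc k) * ?g y) * (real (Suc k) * ?g y)\<bar> * CR"
        using grad_sq_nonneg[of c f y] by (simp add: abs_mult mult_ac)
      also have "\<dots> \<le> 3 * CR" by (intro mult_right_mono cutoff'_bound CR(1))
      finally show ?thesis .
    qed
    have "\<bar>F y * (cutoff' (real (Suc k) * ?g y) * real (Suc k)) * (gradv ?g y \<bullet> ?b y)\<bar> \<le> MF * (3 * CR)"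
      using mult_mono[OF MF(2)[OF True] d MF(1)] by (simp add: abs_mult mult_ac)
    then show ?thesis using a b True unfolding E_def gG[OF True] M_def by simp
  qed (simp add: E_def G0 gG0)
  have intM: "integrable lborel (\<lambda>y. M * indicator K y)"
    by (intro integrable_mult_right integrable_real_indicator) (use borel_compact[OF K(1)] emeasure_compact_finite[OF K(1)] in auto)
  have Em: "E k \<in> borel_measurable lborel" for k using Eint by (rule borel_measurable_integrable)
  have E0m: "E0 \<in> borel_measurable lborel" by (rule borel_measurable_LIMSEQ_real[OF lim Em])
  have L1: "(\<lambda>k. \<integral>y. \<bar>E k y\<bar> \<partial>lborel) \<longlonglongrightarrow> (\<integral>y. \<bar>E0 y\<bar> \<partial>lborel)"
    by (rule integral_dominated_convergence[OF _ _ intM])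
       (use Em E0m lim dom in \<open>auto intro!: borel_measurable_abs tendsto_rabs\<close>)
  have did: "((\<lambda>t. t) has_real_derivative 1) (at t)" for t :: real by simp
  have fE: "integrable lborel (\<lambda>y. ?f y * E k y)" for k
    using greenE(2)[of "\<lambda>t. t" "\<lambda>t. 1"] did by simp
  have fEm: "(\<lambda>y. ?f y * E k y) \<in> borel_measurable lborel" for k using fE by (rule borel_measurable_integrable)
  have limf: "(\<lambda>k. ?f y * E k y) \<longlonglongrightarrow> ?f y * E0 y" for y by (intro tendsto_mult_left lim)
  have fE0m: "(\<lambda>y. ?f y * E0 y) \<in> borel_measurable lborel"
    by (rule borel_measurable_LIMSEQ_real[OF limf fEm])
  have fdom: "\<bar>?f y * E k y\<bar> \<le> Mf * (M * indicator K y)" for k y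
  proof (cases "y \<in> K")
    case True
    then show ?thesis unfolding abs_mult using dom[of k y] Mf(2)[OF True] by (intro mult_mono) (use Mf in auto)
  qed (use dom[of k y] in simp)
  have intfM: "integrable lborel (\<lambda>y. Mf * (M * indicator K y))" using intM by (rule integrable_mult_right)
  have L2: "(\<lambda>k. \<integral>y. ?f y * E k y \<partial>lborel) \<longlonglongrightarrow> (\<integral>y. ?f y * E0 y \<partial>lborel)"
    and fE0i: "integrable lborel (\<lambda>y. ?f y * E0 y)"
    by (rule integral_dominated_convergence[OF _ _ intfM]
          integrable_dominated_convergence[where s = "\<lambda>k y. ?f y * E k y", OF _ _ intfM],
        use fEm fE0m limf fdom in auto)+
  have FE: "integrable lborel (\<lambda>y. F y * energy c f y)"
    using local_green(2)[OF c f F K F0 did] by simp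
  have en: "0 \<le> F y * energy c f y" for y
  proof (cases "y \<in> K")
    case True then show ?thesis using energy_nonneg[OF c, of y f] K(2) Fnn[of y] by auto
  qed (simp add: F0)
  have GE: "integrable lborel (\<lambda>y. Gk k y * energy c f y)" for k
    using green(2)[OF G0 did] by simp
  \<comment> \<open>For \<open>h = id\<close> the left side of Green's identity tends to 0:
    \<open>energy\<close> vanishes where the gradient does, and elsewhere the cut-off tends to
    0.\<close>
  have "(\<lambda>k. \<integral>y. Gk k y * energy c f y \<partial>lborel) \<longlonglongrightarrow> (\<integral>y. 0 \<partial>(lborel :: (real^'n) measure))"
  proof (rule integral_dominated_convergence[OF _ _ FE])
    show "AE y in lborel. (\<lambda>k. Gk k y * energy c f y) \<longlonglongrightarrow> 0"
    proof (rule AE_I2)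
      fix y
      show "(\<lambda>k. Gk k y * energy c f y) \<longlonglongrightarrow> 0"
      proof (cases "?g y = 0")
        case True then show ?thesis by (simp add: grad_sq_zero)
      next
        case False
        then have pos: "?g y > 0" using grad_sq_nonneg[of c f y] by simp
        have "(\<lambda>k. F y * cutoff (real (Suc k) * ?g y) * energy c f y) \<longlonglongrightarrow> F y * 0 * energy c f y"
          by (intro tendsto_intros cutoff_lim pos)
        then show ?thesis by (simp add: Gk_def)
      qed
    qed
    show "AE y in lborel. norm (Gk k y * energy c f y) \<le> F y * energy c f y" for k
    proof (rule AE_I2)
      fix y
      have eq: "Gk k y * energy c f y = cutoff (real (Suc k) * ?g y) * (F y * energy c f y)" by (simp add: Gk_def)
      have "norm (Gk k y * energy c f y) = cutoff (real (Suc k) * ?g y) * (F y * energy c f y)"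
        unfolding eq real_norm_def
        by (intro abs_of_nonneg mult_nonneg_nonneg less_imp_le[OF cutoff_bounds(1)] en)
      also have "\<dots> \<le> 1 * (F y * energy c f y)" by (intro mult_right_mono cutoff_bounds en)
      finally show "norm (Gk k y * energy c f y) \<le> F y * energy c f y" by simp
    qed
  qed (use GE borel_measurable_integrable in auto)
  moreover have "(\<integral>y. Gk k y * energy c f y \<partial>lborel) = (\<integral>y. ?f y * E k y \<partial>lborel)" for k
    using greenE(1)[of "\<lambda>t. t" "\<lambda>t. 1"] did by simp
  ultimately have "(\<lambda>k. \<integral>y. ?f y * E k y \<partial>lborel) \<longlonglongrightarrow> 0" by simp
  then have z: "(\<integral>y. ?f y * E0 y \<partial>lborel) = 0" using L2 LIMSEQ_unique by blast
  have nn: "0 \<le> ?f y * E0 y" for y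
  proof (cases "y \<in> K")
    case True
    then have "sg c y > 0" using sg_pos[OF c] K(2) by blast
    then have "0 \<le> l\<^sup>2 * (F y * ((?f y)\<^sup>2 * sg c y))" using Fnn[of y] by simp
    then show ?thesis by (simp add: E0_def power2_eq_square mult_ac)
  qed (simp add: E0_def F0)
  have "AE y in lborel. ?f y * E0 y = 0"
    using integral_nonneg_eq_0_iff_AE[OF fE0i] nn z by simp
  \<comment> \<open>\<open>E0\<close> contains the factor \<open>?f y\<close>, so it vanishes
    wherever the product \<open>?f y * E0 y\<close> does.\<close>
  then have "AE y in lborel. \<bar>E0 y\<bar> = 0" by eventually_elim (auto simp: E0_def)
  then have "(\<integral>y. \<bar>E0 y\<bar> \<partial>lborel) = 0" by (rule integral_eq_zero_AE)
  then have "(\<lambda>k. \<integral>y. \<bar>E k y\<bar> \<partial>lborel) \<longlonglongrightarrow> 0" using L1 by simp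
  then have "\<forall>\<^sub>F k in sequentially. (\<integral>y. \<bar>E k y\<bar> \<partial>lborel) < \<tau> / 2"
    using \<tau> by (intro order_tendstoD(2)[of _ 0]) auto
  then obtain k where k: "(\<integral>y. \<bar>E k y\<bar> \<partial>lborel) < \<tau> / 2" by (auto simp: eventually_sequentially)
  show thesis
  proof (rule that[of "Suc k"])
    show "C1 UNIV (\<lambda>y. F y * cutoff (real (Suc k) * ?g y))" using C1G[of k] by (simp only: Gk_def[abs_def])
    fix h h' assume "bounded_C1_pair h h'"
    note h = bounded_C1_pairD[OF this]
    \<comment> \<open>Of \<open>h\<close> only the bound 2 enters, so the same \<open>N\<close>
      serves all admissible pairs.\<close>
    have "(\<integral>y. h (?f y) * E k y \<partial>lborel) \<le> (\<integral>y. 2 * \<bar>E k y\<bar> \<partial>lborel)"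
    proof (rule integral_mono[OF greenE(2)[OF h(1,2)]])
      show "integrable lborel (\<lambda>y. 2 * \<bar>E k y\<bar>)" using Eint by simp
      fix y
      have "h (?f y) * E k y \<le> \<bar>h (?f y)\<bar> * \<bar>E k y\<bar>" by (simp add: abs_mult[symmetric])
      also have "\<dots> \<le> 2 * \<bar>E k y\<bar>" by (intro mult_right_mono h(3)) simp
      finally show "h (?f y) * E k y \<le> 2 * \<bar>E k y\<bar>" .
    qed
    also have "\<dots> \<le> \<tau>" using k by simp
    finally show "(\<integral>y. F y * cutoff (real (Suc k) * ?g y) * (h' (?f y) * energy c f y) \<partial>lborel) \<le> \<tau>"
      using greenE(1)[OF h(1,2), of k] by (simp only: Gk_def)
  qed simp
qed

end

section \<open>Flux through small balls\<close>

lemma bump_gradient: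
  "gradv (bump y0 R) y = (- 4 * max 0 (R\<^sup>2 - (y - y0) \<bullet> (y - y0))) *\<^sub>R (y - y0)"
proof -
  define q where "q = (\<lambda>y. R\<^sup>2 - (y - y0) \<bullet> (y - y0))"
  have d: "(q has_derivative (\<lambda>v. - 2 * ((y - y0) \<bullet> v))) (at y)"
    unfolding q_def by (auto intro!: derivative_eq_intros simp: inner_commute)
  have "partial i (bump y0 R) y = 2 * max 0 (q y) * (- 2 * ((y - y0) \<bullet> axis i 1))" for i
    using partial_compose(1)[OF _ DERIV_max0_square, of q y i] d partial_eqI[OF d, of i]
    by (simp add: differentiable_def bump_def[abs_def] q_def[symmetric]) (auto simp: q_def)
  then show ?thesis by (simp add: vec_eq_iff inner_axis_right q_def algebra_simps)
qed

text \<open>The positive part of \<open>R^2 - |y - y0|^2\<close> is at most \<open>R^2\<close>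
  everywhere and at least \<open>3 (R/2)^2\<close> on the ball of half the radius; squaring yields
  \<open>R^4\<close> and \<open>9 (R/2)^4\<close>.\<close>

lemma bump_bounds:
  assumes "R > 0"
  shows "bump y0 R y \<le> R ^ 4" "norm (gradv (bump y0 R) y) \<le> 4 * R ^ 3"
    "y \<notin> cball y0 R \<Longrightarrow> bump y0 R y = 0"
    "dist y0 y \<le> R / 2 \<Longrightarrow> 9 * (R / 2) ^ 4 \<le> bump y0 R y"
proof -
  define n where "n = norm (y - y0)"
  define m where "m = max 0 (R\<^sup>2 - n\<^sup>2)"
  have e: "(y - y0) \<bullet> (y - y0) = n\<^sup>2" by (simp add: n_def dot_square_norm)
  have m: "0 \<le> m" "m \<le> R\<^sup>2" by (auto simp: m_def)
  have "m\<^sup>2 \<le> (R\<^sup>2)\<^sup>2" using m by (intro power_mono) auto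
  then show "bump y0 R y \<le> R ^ 4" by (simp add: bump_def e m_def[symmetric] power_mult[symmetric])
  have "m * n \<le> R\<^sup>2 * R"
  proof (cases "n \<le> R")
    case True then show ?thesis using m by (intro mult_mono) (auto simp: n_def)
  next
    case False
    then have "R\<^sup>2 \<le> n\<^sup>2" using assms by (intro power_mono) auto
    then have "m = 0" by (simp add: m_def)
    then show ?thesis using assms by simp
  qed
  then show "norm (gradv (bump y0 R) y) \<le> 4 * R ^ 3"
    unfolding bump_gradient e m_def[symmetric] using m
    by (simp add: n_def[symmetric] power3_eq_cube power2_eq_square)
  show "bump y0 R y = 0" if "y \<notin> cball y0 R"
  proof -
    have "R \<le> n" using that by (simp add: n_def dist_norm norm_minus_commute)
    then have "R\<^sup>2 \<le> n\<^sup>2" using assms by (intro power_mono) auto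
    then show ?thesis by (simp add: bump_def e)
  qed
  show "9 * (R / 2) ^ 4 \<le> bump y0 R y" if "dist y0 y \<le> R / 2"
  proof -
    have "n \<le> R / 2" using that by (simp add: n_def dist_norm norm_minus_commute)
    then have "n\<^sup>2 \<le> (R / 2)\<^sup>2" by (intro power_mono) (auto simp: n_def)
    then have "3 * (R / 2)\<^sup>2 \<le> R\<^sup>2 - n\<^sup>2" by (simp add: power_divide)
    then have "3 * (R / 2)\<^sup>2 \<le> m" unfolding m_def by (rule max.coboundedI2)
    then have "(3 * (R / 2)\<^sup>2)\<^sup>2 \<le> m\<^sup>2" by (intro power_mono) auto
    then show ?thesis by (simp add: bump_def e m_def[symmetric] power_mult_distrib power_mult[symmetric])
  qed
qed

text \<open>Leaves room for balls of a fixed radius about the points of \<open>K\<close> inside a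
  compact \<open>K'\<close>, on which coefficients can be bounded.\<close>

lemma compact_thickening:
  fixes K :: "'b::euclidean_space set"
  assumes "compact K" "open W" "K \<subseteq> W"
  obtains \<rho> K' where "\<rho> > 0" "compact K'" "K' \<subseteq> W" "\<And>y. y \<in> K \<Longrightarrow> cball y \<rho> \<subseteq> K'"
proof -
  obtain \<rho> where \<rho>: "\<rho> > 0" "(\<Union>x\<in>K. cball x \<rho>) \<subseteq> W"
    using compact_subset_open_imp_cball_epsilon_subset[OF assms] by metis
  define K' where "K' = (\<lambda>z. fst z + snd z) ` (K \<times> cball 0 \<rho>)"
  have "K' = (\<Union>x\<in>K. cball x \<rho>)"
  proof
    show "K' \<subseteq> (\<Union>x\<in>K. cball x \<rho>)" by (auto simp: K'_def dist_norm)
    show "(\<Union>x\<in>K. cball x \<rho>) \<subseteq> K'"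
    proof
      fix y assume "y \<in> (\<Union>x\<in>K. cball x \<rho>)"
      then obtain x where "x \<in> K" "dist x y \<le> \<rho>" by auto
      then show "y \<in> K'" unfolding K'_def
        by (intro image_eqI[of _ _ "(x, y - x)"]) (auto simp: dist_norm norm_minus_commute)
    qed
  qed
  moreover have "compact K'" unfolding K'_def using assms(1)
    by (intro compact_continuous_image compact_Times compact_cball continuous_intros) auto
  ultimately show thesis using that[of \<rho> K'] \<rho> by auto
qed

context riem begin

text \<open>The mean value inequality for the first partials, with a constant that bounds the second
  derivatives of \<open>f\<close>. It is applied in balls because \<open>K'\<close> need not be
  convex.\<close>

lemma gradv_lipschitz_on_balls:
  assumes c: "c \<in> A" and f: "smooth_fun A f" and K': "compact K'" "K' \<subseteq> img c"
  obtains L where "L \<ge> 0" "\<And>y0 r y. cball y0 r \<subseteq> K' \<Longrightarrow> y \<in> cball y0 r \<Longrightarrow>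
     norm (gradv (coord_rep c f) y) \<le> norm (gradv (coord_rep c f) y0) + L * dist y0 y"
proof -
  have "\<exists>M\<ge>0. \<forall>y\<in>K'. \<bar>norm (gradv (partial j (coord_rep c f)) y)\<bar> \<le> M" for j
  proof -
    have "continuous_on K' (\<lambda>y. norm (gradv (partial j (coord_rep c f)) y))"
      unfolding gradv_def
      by (intro continuous_on_norm continuous_on_vec_lambda
          continuous_on_subset[OF C1_continuous_partial[OF C1_coord_rep(2)[OF c f]] K'(2)])
    then show ?thesis by (rule compact_bounded_real[OF K'(1)]) blast
  qed
  then obtain M where M: "\<And>j. M j \<ge> 0" "\<And>j y. y \<in> K' \<Longrightarrow> norm (gradv (partial j (coord_rep c f)) y) \<le> M j"
    by (metis abs_norm_cancel)
  have "norm (gradv (coord_rep c f) y) \<le> norm (gradv (coord_rep c f) y0) + (\<Sum>j\<in>UNIV. M j) * dist y0 y"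
    if B: "cball y0 r \<subseteq> K'" and y: "y \<in> cball y0 r" for y0 r y
  proof -
    have y0: "y0 \<in> cball y0 r" using y by (simp, meson dist_le_zero_iff order_trans zero_le_dist dist_self)
    have "\<bar>partial j (coord_rep c f) y - partial j (coord_rep c f) y0\<bar> \<le> M j * norm (y - y0)" for j
    proof -
      have "norm (partial j (coord_rep c f) y - partial j (coord_rep c f) y0) \<le> M j * norm (y - y0)"
      proof (rule differentiable_bound[OF convex_cball[of y0 r] _ _ y y0])
        fix z assume z: "z \<in> cball y0 r"
        have "(partial j (coord_rep c f) has_derivative (\<lambda>v. gradv (partial j (coord_rep c f)) z \<bullet> v)) (at z)"
          by (rule frechet_gradv[OF C1_differentiable[OF C1_coord_rep(2)[OF c f]]]) (use z B K'(2) in blast)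
        then show "(partial j (coord_rep c f) has_derivative (\<lambda>v. gradv (partial j (coord_rep c f)) z \<bullet> v)) (at z within cball y0 r)"
          by (rule has_derivative_at_withinI)
        have zK: "z \<in> K'" using z B by blast
        show "onorm (\<lambda>v. gradv (partial j (coord_rep c f)) z \<bullet> v) \<le> M j"
        proof (rule onorm_le)
          fix v
          have "norm (gradv (partial j (coord_rep c f)) z \<bullet> v) \<le> norm (gradv (partial j (coord_rep c f)) z) * norm v"
            using Cauchy_Schwarz_ineq2 by simp
          also have "\<dots> \<le> M j * norm v" by (intro mult_right_mono M(2)[OF zK]) simp
          finally show "norm (gradv (partial j (coord_rep c f)) z \<bullet> v) \<le> M j * norm v" .
        qed
      qed
      then show ?thesis by simp
    qed
    then have "norm (gradv (coord_rep c f) y - gradv (coord_rep c f) y0) \<le> (\<Sum>j\<in>UNIV. M j * norm (y - y0))"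
      by (intro order_trans[OF norm_le_l1_cart] sum_mono) simp
    moreover have "norm (gradv (coord_rep c f) y) \<le> norm (gradv (coord_rep c f) y0) + norm (gradv (coord_rep c f) y - gradv (coord_rep c f) y0)"
      using norm_triangle_ineq[of "gradv (coord_rep c f) y0" "gradv (coord_rep c f) y - gradv (coord_rep c f) y0"] by simp
    ultimately show ?thesis by (simp add: sum_distrib_right dist_norm norm_minus_commute)
  qed
  moreover have "(\<Sum>j\<in>UNIV. M j) \<ge> 0" by (intro sum_nonneg M(1))
  ultimately show thesis using that by blast
qed

text \<open>Division by \<open>9 * r^4\<close> makes the bump of radius \<open>2 * r\<close> at
  least 1 on the ball of radius \<open>r\<close>. Of the two constants, \<open>C\<close> will be
  independent of \<open>f\<close>, while \<open>Cf\<close>, which depends on \<open>f\<close>,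
  carries an extra factor \<open>r\<close>.\<close>

definition ball_estimate :: "('a, 'n) chart \<Rightarrow> ('a \<Rightarrow> real) \<Rightarrow> real \<Rightarrow> real \<Rightarrow> real ^ 'n \<Rightarrow> real \<Rightarrow> bool" where
  "ball_estimate c f C Cf y0 r \<longleftrightarrow> cball y0 (2 * r) \<subseteq> img c \<and> (\<forall>h h'. bounded_C1_pair h h' \<longrightarrow>
     integrable lborel (\<lambda>y. bump y0 (2 * r) y / (9 * r ^ 4) * (h' (coord_rep c f y) * energy c f y)) \<and>
     (\<integral>y. bump y0 (2 * r) y / (9 * r ^ 4) * (h' (coord_rep c f y) * energy c f y) \<partial>lborel)
       \<le> C * r ^ (CARD('n) - 1) * (norm (gradv (coord_rep c f) y0) + Cf * r))"

text \<open>Testing Green's identity with a bump on a ball of radius \<open>r\<close> bounds the nodal flux through the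
  ball by \<open>r\<^sup>n\<^sup>-\<^sup>1\<close> times the gradient at the centre.\<close>

lemma ball_energy_estimate:
  assumes c: "c \<in> A" and K: "compact K" "K \<subseteq> img c"
  obtains C \<rho> where "C > 0" "\<rho> > 0"
    "\<And>f l. eigenfunction A G f l \<Longrightarrow> \<exists>Cf\<ge>0. \<forall>y0\<in>K. \<forall>r>0. 2 * r \<le> \<rho> \<longrightarrow> ball_estimate c f C Cf y0 r"
proof -
  obtain \<rho> K' where \<rho>: "\<rho> > 0" "compact K'" "K' \<subseteq> img c" "\<And>y. y \<in> K \<Longrightarrow> cball y \<rho> \<subseteq> K'"
    by (rule compact_thickening[OF K(1) open_img[OF c] K(2)]) blast
  obtain CB where CB: "CB > 0" "\<And>y f. y \<in> K' \<Longrightarrow> norm (flux c f y) \<le> CB * norm (gradv (coord_rep c f) y)"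
    "\<And>y. y \<in> K' \<Longrightarrow> sg c y \<le> CB" by (rule flux_bounds[OF c \<rho>(2,3)]) blast
  \<comment> \<open>The volume of a Euclidean ball of radius 2, so that a ball of radius
    \<open>2 * r\<close> has volume \<open>\<omega> * r ^ CARD('n)\<close>.\<close>
  define \<omega> where "\<omega> = unit_ball_vol (real CARD('n)) * 2 ^ CARD('n)"
  have \<omega>: "\<omega> > 0" unfolding \<omega>_def using unit_ball_vol_pos[of "real CARD('n)"] by simp
  show thesis
  proof (rule that[of "\<omega> * (8 * CB)" \<rho>])
    fix f l assume f: "eigenfunction A G f l"
    have sm: "smooth_fun A f" using f by (rule eigen_smooth)
    let ?f = "coord_rep c f"
    obtain L where L: "L \<ge> 0" "\<And>y0 r y. cball y0 r \<subseteq> K' \<Longrightarrow> y \<in> cball y0 r \<Longrightarrow>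
     norm (gradv ?f y) \<le> norm (gradv ?f y0) + L * dist y0 y"
      by (rule gradv_lipschitz_on_balls[OF c sm \<rho>(2,3)]) blast
    obtain Mf where Mf: "Mf \<ge> 0" "\<And>y. y \<in> K' \<Longrightarrow> \<bar>?f y\<bar> \<le> Mf"
      by (rule compact_bounded_real[OF \<rho>(2) continuous_on_subset[OF C1_continuous[OF C1_coord_rep(1)[OF c sm]] \<rho>(3)]]) blast
    \<comment> \<open>Change of the gradient over the distance \<open>2 * r\<close>, plus the
      zeroth-order term of Green's identity, after \<open>8 * CB\<close> has been factored
      out.\<close>
    define Cf where "Cf = 2 * L + l\<^sup>2 * Mf / 2"
    have main: "ball_estimate c f (\<omega> * (8 * CB)) Cf y0 r"
      if y0: "y0 \<in> K" and r: "r > 0" "2 * r \<le> \<rho>" for y0 r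
    proof -
      have B: "cball y0 (2 * r) \<subseteq> K'" using \<rho>(4)[OF y0] r by (meson cball_subset_cball_iff order_refl order_trans subset_cball)
      have Bi: "cball y0 (2 * r) \<subseteq> img c" using B \<rho>(3) by blast
      define b where "b y = bump y0 (2 * r) y * (1 / (9 * r ^ 4))" for y
      have C1b: "C1 UNIV b" unfolding b_def by (intro C1_mult C1_bump C1_const)
      have r2: "2 * r > 0" using r by simp
      have b0: "b y = 0" if "y \<notin> cball y0 (2 * r)" for y
        unfolding b_def bump_bounds(3)[OF r2 that] by simp
      have bn: "0 \<le> b y" for y unfolding b_def using bump_nonneg[of y0 "2 * r" y] r by simp
      have b2: "b y \<le> 2" for y
      proof -
        have "b y \<le> (2 * r) ^ 4 * (1 / (9 * r ^ 4))" unfolding b_def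
          using bump_bounds(1)[OF r2] r by (intro mult_right_mono) auto
        also have "\<dots> \<le> 2" using r by (simp add: power_mult_distrib)
        finally show ?thesis .
      qed
      have gb: "norm (gradv b y) \<le> 4 / r" for y
      proof -
        have "partial i b y = partial i (bump y0 (2 * r)) y * (1 / (9 * r ^ 4))" for i
          unfolding b_def using C1_bump[of UNIV y0 "2 * r"]
          by (subst partial_mult) (auto simp: C1_def)
        then have "gradv b y = (1 / (9 * r ^ 4)) *\<^sub>R gradv (bump y0 (2 * r)) y" by (simp add: vec_eq_iff)
        then have "norm (gradv b y) = (1 / (9 * r ^ 4)) * norm (gradv (bump y0 (2 * r)) y)" using r by simp
        also have "\<dots> \<le> (1 / (9 * r ^ 4)) * (4 * (2 * r) ^ 3)"
          by (intro mult_left_mono bump_bounds(2)[OF r2]) (use r in auto)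
        also have "\<dots> = (32 / 9) / r"
          using r by (simp add: power_mult_distrib power3_eq_cube power4_eq_xxxx field_simps)
        also have "\<dots> \<le> 4 / r" using r by (intro divide_right_mono) auto
        finally show ?thesis .
      qed
      define D0 where "D0 = norm (gradv ?f y0)"
      \<comment> \<open>A bound for the right side of Green's identity on the ball, from
        \<open>b \<le> 2\<close>, \<open>\<bar>h\<bar> \<le> 2\<close> and
        \<open>|\<nabla>b| \<le> 4 / r\<close>.\<close>
      define M where "M = l\<^sup>2 * (2 * (2 * (Mf * CB))) + 2 * (4 / r * (CB * (D0 + L * (2 * r))))"
      have "integrable lborel (\<lambda>y. b y * (h' (?f y) * energy c f y)) \<and>
         (\<integral>y. b y * (h' (?f y) * energy c f y) \<partial>lborel)
           \<le> \<omega> * (8 * CB) * r ^ (CARD('n) - 1) * (D0 + Cf * r)"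
        if "bounded_C1_pair h h'" for h h'
      proof
        note h = bounded_C1_pairD[OF that]
        note green = local_green[OF c f C1b compact_cball Bi b0 h(1,2)]
        show "integrable lborel (\<lambda>y. b y * (h' (?f y) * energy c f y))" using green(2) by simp
        have pw: "l\<^sup>2 * (b y * (h (?f y) * ?f y * sg c y)) - h (?f y) * (gradv b y \<bullet> flux c f y)
            \<le> M * indicator (cball y0 (2 * r)) y" for y
        proof (cases "y \<in> cball y0 (2 * r)")
          case True
          then have yK: "y \<in> K'" using B by blast
          have sgp: "sg c y > 0" using sg_pos[OF c] yK \<rho>(3) by blast
          have "\<bar>b y * (h (?f y) * ?f y * sg c y)\<bar> = b y * (\<bar>h (?f y)\<bar> * (\<bar>?f y\<bar> * sg c y))"
            using bn[of y] sgp by (simp add: abs_mult)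
          also have "\<dots> \<le> 2 * (2 * (Mf * CB))"
            by (intro mult_mono b2 h(3) Mf(2)[OF yK] CB(3)[OF yK])
               (use Mf(1) CB(1) sgp in \<open>auto intro!: mult_nonneg_nonneg\<close>)
          finally have 1: "l\<^sup>2 * (b y * (h (?f y) * ?f y * sg c y)) \<le> l\<^sup>2 * (2 * (2 * (Mf * CB)))"
            by (intro mult_left_mono) auto
          have "norm (gradv ?f y) \<le> D0 + L * dist y0 y" unfolding D0_def by (rule L(2)[OF B True])
          also have "\<dots> \<le> D0 + L * (2 * r)" using True L(1) by (intro add_left_mono mult_left_mono) auto
          finally have Dy: "norm (gradv ?f y) \<le> D0 + L * (2 * r)" .
          have fl: "norm (flux c f y) \<le> CB * (D0 + L * (2 * r))"
            using CB(2)[OF yK, of f] mult_left_mono[OF Dy, of CB] CB(1) by linarith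
          have "\<bar>h (?f y) * (gradv b y \<bullet> flux c f y)\<bar> \<le> \<bar>h (?f y)\<bar> * (norm (gradv b y) * norm (flux c f y))"
            unfolding abs_mult by (intro mult_left_mono Cauchy_Schwarz_ineq2) simp
          also have "\<dots> \<le> 2 * (4 / r * (CB * (D0 + L * (2 * r))))"
            by (intro mult_mono h(3) gb fl) (use r in \<open>auto intro!: mult_nonneg_nonneg\<close>)
          finally show ?thesis using 1 True unfolding M_def by simp
        next
          case False
          have "partial i b y = 0" for i by (rule partial_zero_off[OF compact_cball _ False]) (rule b0)
          then have "gradv b y = 0" by (simp add: vec_eq_iff)
          then show ?thesis using b0[OF False] False by simp
        qed
        have "(\<integral>y. b y * (h' (?f y) * energy c f y) \<partial>lborel) =
          (\<integral>y. l\<^sup>2 * (b y * (h (?f y) * ?f y * sg c y)) - h (?f y) * (gradv b y \<bullet> flux c f y) \<partial>lborel)"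
          using green by simp
        also have "\<dots> \<le> (\<integral>y. M * indicator (cball y0 (2 * r)) y \<partial>lborel)"
        proof (rule integral_mono[OF _ _ pw])
          show "integrable lborel (\<lambda>y. l\<^sup>2 * (b y * (h (?f y) * ?f y * sg c y)) - h (?f y) * (gradv b y \<bullet> flux c f y))"
            using green(3,4) by simp
          show "integrable lborel (\<lambda>y. M * indicator (cball y0 (2 * r)) y)"
            by (intro integrable_mult_right integrable_real_indicator)
               (use emeasure_compact_finite[OF compact_cball[of y0 "2 * r"]] in auto)
        qed
        also have "\<dots> = M * measure lborel (cball y0 (2 * r))" by simp
        also have "measure lborel (cball y0 (2 * r)) = \<omega> * r ^ CARD('n)"
          using content_cball[of "2 * r" y0] r by (simp add: \<omega>_def power_mult_distrib)
        \<comment> \<open>One factor \<open>r\<close> of the volume cancels the \<open>1 / r\<close>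
          in the gradient of the bump; the remaining power \<open>n - 1\<close> is the order of
          hypersurface measure.\<close>
        also have "r ^ CARD('n) = r * r ^ (CARD('n) - 1)"
          by (subst power_eq_if) simp
        also have "M * (\<omega> * (r * r ^ (CARD('n) - 1))) = \<omega> * (8 * CB) * r ^ (CARD('n) - 1) * (D0 + Cf * r)"
        proof -
          have "M * r = 8 * CB * (D0 + Cf * r)" using r by (simp add: M_def Cf_def field_simps)
          then have "(M * r) * (\<omega> * r ^ (CARD('n) - 1)) = (8 * CB * (D0 + Cf * r)) * (\<omega> * r ^ (CARD('n) - 1))"
            by (rule arg_cong)
          then show ?thesis by (simp only: mult_ac)
        qed
        finally show "(\<integral>y. b y * (h' (?f y) * energy c f y) \<partial>lborel)
           \<le> \<omega> * (8 * CB) * r ^ (CARD('n) - 1) * (D0 + Cf * r)" .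
      qed
      note est = this
      have bump_b: "bump y0 (2 * r) y / (9 * r ^ 4) = b y" for y by (simp add: b_def)
      show ?thesis
        unfolding ball_estimate_def bump_b D0_def[symmetric]
        by (intro conjI allI impI Bi est[THEN conjunct1] est[THEN conjunct2])
    qed
    have "Cf \<ge> 0" using L(1) Mf(1) by (simp add: Cf_def)
    then show "\<exists>Cf\<ge>0. \<forall>y0\<in>K. \<forall>r>0. 2 * r \<le> \<rho> \<longrightarrow> ball_estimate c f (\<omega> * (8 * CB)) Cf y0 r"
      using main by blast
  qed (use \<omega> CB(1) \<rho>(1) in auto)
qed

end

section \<open>Covering the nodal set\<close>

text \<open>Turns a closed bound on distances into an open ball of positive radius, also around
  covering sets of diameter 0, at an arbitrarily small cost in the m-th power.\<close>

lemma exists_slightly_larger: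
  fixes x s e :: real
  assumes "x < s" "0 < e"
  shows "\<exists>r>x. r < s \<and> r ^ m \<le> x ^ m + e"
proof -
  have "((\<lambda>r. r ^ m) \<longlongrightarrow> x ^ m) (at_right x)" by (intro tendsto_intros)
  then have "\<forall>\<^sub>F r in at_right x. r ^ m < x ^ m + e" using assms(2) by (intro order_tendstoD) auto
  moreover have "\<forall>\<^sub>F r in at_right x. r \<in> {x<..<s}" by (rule eventually_at_right_real[OF assms(1)])
  ultimately have "\<forall>\<^sub>F r in at_right x. r > x \<and> r < s \<and> r ^ m \<le> x ^ m + e"
    by eventually_elim auto
  then show ?thesis using eventually_happens trivial_limit_at_right_real by blast
qed

lemma half_powers_le_1: "(\<Sum>i<n. (1 / 2) ^ Suc i) \<le> (1 :: real)"
proof -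
  have "(\<Sum>i<n. (1 / 2) ^ Suc i) = 1 - (1 / 2 :: real) ^ n" by (induction n) auto
  then show ?thesis by simp
qed

context riem begin

text \<open>\<open>I0\<close> stands for \<open>\<integral>\<^sub>Z |\<nabla>f| dS\<close>.\<close>

definition nodal_cover_bound :: "('a, 'n) chart \<Rightarrow> (real ^ 'n) set \<Rightarrow> real \<Rightarrow> bool" where
  "nodal_cover_bound c K C \<longleftrightarrow> (\<forall>f Z g0 I0 s0 \<tau>. smooth_fun A f \<longrightarrow> compact Z \<longrightarrow> Z \<subseteq> K \<longrightarrow>
     (\<forall>y\<in>Z. f (iv c y) = 0) \<longrightarrow> 0 < g0 \<longrightarrow> (\<forall>y\<in>Z. g0 \<le> grad_norm A G f (iv c y)) \<longrightarrow>
     emeasure (grad_nodal_measure A G f) UNIV = ennreal I0 \<longrightarrow> 0 \<le> I0 \<longrightarrow> 0 < s0 \<longrightarrow> 0 < \<tau> \<longrightarrow>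
     (\<exists>(J :: (nat \<times> nat) set) yy rr. finite J \<and> (\<forall>j\<in>J. yy j \<in> Z \<and> 0 < rr j \<and> rr j < s0) \<and>
       Z \<subseteq> (\<Union>j\<in>J. ball (yy j) (rr j)) \<and>
       (\<Sum>j\<in>J. rr j ^ (CARD('n) - 1) * grad_norm A G f (iv c (yy j))) \<le> C * I0 + \<tau>))"

text \<open>A cover almost optimal for the Hausdorff measure of each dyadic level
  \<open>{2\<^sup>k g0 \<le> |\<nabla>f| < 2\<^sup>k\<^sup>+\<^sup>1 g0}\<close> of the nodal set is replaced by coordinate balls.\<close>

lemma nodal_cover:
  assumes c: "c \<in> A" and K: "compact K" "K \<subseteq> img c"
  obtains C where "C > 0" "nodal_cover_bound c K C"
proof -
  obtain \<rho> K' where \<rho>: "\<rho> > 0" "compact K'" "K' \<subseteq> img c" "\<And>y. y \<in> K \<Longrightarrow> cball y \<rho> \<subseteq> K'"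
    by (rule compact_thickening[OF K(1) open_img[OF c] K(2)]) blast
  let ?d = "riemannian_dist A G"
  obtain L where L: "L > 0"
    "\<And>y r p q. cball y r \<subseteq> K' \<Longrightarrow> ennreal \<bar>cone_fun c y r p - cone_fun c y r q\<bar> \<le> ennreal L * ?d p q"
    by (rule cone_fun_lipschitz[OF c \<rho>(2,3)]) blast
  define m where "m = CARD('n) - 1"
  define \<kappa> where "\<kappa> = unit_ball_vol (real m) / 2 ^ m"
  have \<kappa>: "\<kappa> > 0" unfolding \<kappa>_def by simp
  \<comment> \<open>Converts the Hausdorff weight \<open>\<kappa> * D^m\<close> of a set of diameter
    \<open>D\<close> into the m-th power of the coordinate radius \<open>L * D\<close>.\<close>
  define C0 where "C0 = L ^ m / \<kappa>"
  have C0: "C0 > 0" unfolding C0_def using L(1) \<kappa> by simp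
  have "nodal_cover_bound c K (2 * C0)"
    unfolding nodal_cover_bound_def
  proof (intro allI impI)
    fix f :: "'a \<Rightarrow> real" and Z :: "(real ^ 'n) set" and g0 I0 s0 \<tau> :: real
    assume sm: "smooth_fun A f" and Z: "compact Z" "Z \<subseteq> K" "\<forall>y\<in>Z. f (iv c y) = 0"
      and g0: "0 < g0" "\<forall>y\<in>Z. g0 \<le> grad_norm A G f (iv c y)"
      and I0: "emeasure (grad_nodal_measure A G f) UNIV = ennreal I0" "0 \<le> I0"
      and s0: "0 < s0" and \<tau>: "0 < \<tau>"
    define g where "g = grad_norm A G f"
    have gcont: "continuous_on UNIV g" unfolding g_def by (rule grad_norm_continuous[OF sm])
    then have gm [measurable]: "g \<in> borel_measurable borel" by (rule borel_measurable_continuous_onI)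
    obtain Gm where Gm: "Gm \<ge> 0" "\<And>p. \<bar>g p\<bar> \<le> Gm"
      by (rule compact_bounded_real[OF compact_M gcont]) blast
    obtain N :: nat where "Gm / g0 < real N" using reals_Archimedean2 by blast
    then have N: "Gm < g0 * 2 ^ N"
    proof -
      assume "Gm / g0 < real N"
      also have "real N \<le> 2 ^ N" by (rule of_nat_less_two_power[THEN less_imp_le])
      finally have "Gm / g0 < 2 ^ N" .
      then show ?thesis using g0(1) by (simp add: divide_less_eq mult.commute)
    qed
    define w where "w k = g0 * 2 ^ k" for k :: nat
    have wpos: "w k > 0" for k using g0(1) by (simp add: w_def)
    have wmono: "w (Suc k) \<le> w k'" if "k < k'" for k k'
      unfolding w_def using g0(1) that by (intro mult_left_mono power_increasing) auto
    have w2: "w (Suc k) = 2 * w k" for k by (simp add: w_def)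
    define P where "P = iv c ` Z"
    have Zi: "Z \<subseteq> img c" using Z(2) K(2) by blast
    have Pc: "compact P" unfolding P_def
      by (rule compact_continuous_image[OF continuous_on_subset[OF cont_iv[OF c] Zi] Z(1)])
    define Pk where "Pk k = P \<inter> {p. w k \<le> g p \<and> g p < w (Suc k)}" for k
    have Pkb [measurable]: "Pk k \<in> sets borel" for k
    proof -
      have "{p. w k \<le> g p \<and> g p < w (Suc k)} \<in> sets borel" by measurable
      then show ?thesis unfolding Pk_def using borel_compact[OF Pc] by blast
    qed
    have Pcov: "\<exists>k<N. p \<in> Pk k" if p: "p \<in> P" for p
    proof -
      define Q where "Q k \<longleftrightarrow> g p < w k" for k
      have "Q N" using Gm(2)[of p] N by (simp add: Q_def w_def)
      then have 1: "Q (LEAST k. Q k)" "(LEAST k. Q k) \<le> N" by (rule LeastI, rule Least_le)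
      have g0p: "g0 \<le> g p" using p g0(2) by (auto simp: P_def g_def)
      have "\<not> Q 0" using g0p by (simp add: Q_def w_def)
      then obtain k where k: "(LEAST k. Q k) = Suc k" using 1(1) by (metis not0_implies_Suc)
      then have "\<not> Q k" by (metis lessI not_less_Least)
      then have "p \<in> Pk k" using p 1(1) unfolding k by (simp add: Pk_def Q_def)
      then show ?thesis using 1(2) k by (intro exI[of _ k]) simp
    qed
    define H where "H = hausdorff_measure ?d m"
    have sH [measurable_cong]: "sets H = sets borel" "space H = UNIV"
      unfolding H_def hausdorff_measure_def
      using sets.sigma_sets_eq[of "borel :: 'a measure"] by simp_all
    have HP: "emeasure H (Pk k) = hausdorff_outer ?d m (Pk k)" for k
      unfolding H_def by (rule emeasure_hausdorff_riemannian[OF Pkb])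
    have "closed (nodal_set f)"
      unfolding nodal_set_def using smooth_fun_continuous[OF sm] by (intro closed_Collect_eq continuous_on_const)
    then have nb [measurable]: "nodal_set f \<in> sets borel" by simp
    have disj: "k = k'" if "p \<in> Pk k" "p \<in> Pk k'" for k k' p
      using that wmono[of k k'] wmono[of k' k] by (auto simp: Pk_def) (metis linorder_neqE_nat not_less order_le_less_trans order_trans)
    \<comment> \<open>The sets \<open>Pk k\<close> are disjoint parts of the nodal set with
      \<open>g \<ge> w k\<close> on the k-th, so their weighted measures add up to at most the total
      nodal mass.\<close>
    have low: "(\<Sum>k<N. ennreal (w k) * emeasure H (Pk k)) \<le> ennreal I0"
    proof -
      have "(\<Sum>k<N. ennreal (w k) * emeasure H (Pk k)) = (\<Sum>k<N. \<integral>\<^sup>+p. ennreal (w k) * indicator (Pk k) p \<partial>H)"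
        by (intro sum.cong refl nn_integral_cmult_indicator[symmetric]) (simp add: sH)
      also have "\<dots> = (\<integral>\<^sup>+p. (\<Sum>k<N. ennreal (w k) * indicator (Pk k) p) \<partial>H)"
        by (intro nn_integral_sum[symmetric]) measurable
      also have "\<dots> \<le> (\<integral>\<^sup>+p. ennreal (g p) * indicator (nodal_set f) p \<partial>H)"
      proof (rule nn_integral_mono)
        fix p
        show "(\<Sum>k<N. ennreal (w k) * indicator (Pk k) p) \<le> ennreal (g p) * indicator (nodal_set f) p"
        proof (cases "\<exists>k. p \<in> Pk k")
          case False
          then have "(\<Sum>k<N. ennreal (w k) * indicator (Pk k) p) = 0" by (intro sum.neutral) auto
          then show ?thesis by simp
        next
          case True
          then obtain k0 where k0: "p \<in> Pk k0" by blast
          have "(\<Sum>k<N. ennreal (w k) * indicator (Pk k) p) = (\<Sum>k<N. if k = k0 then ennreal (w k0) else 0)"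
            using disj k0 by (intro sum.cong) (auto simp: indicator_def)
          also have "\<dots> \<le> ennreal (w k0)" by simp
          also have "\<dots> \<le> ennreal (g p)" using k0 by (intro ennreal_leI) (simp add: Pk_def)
          also have "\<dots> = ennreal (g p) * indicator (nodal_set f) p"
            using k0 Z(3) by (auto simp: Pk_def P_def nodal_set_def)
          finally show ?thesis .
        qed
      qed
      also have "\<dots> = (\<integral>\<^sup>+p. ennreal (g p) * indicator (nodal_set f) p * indicator UNIV p \<partial>H)" by simp
      also have "\<dots> = emeasure (grad_nodal_measure A G f) UNIV"
        unfolding grad_nodal_measure_def H_def[symmetric] m_def[symmetric] g_def[symmetric]
        by (subst emeasure_density) (auto simp: sH)
      finally show ?thesis using I0(1) by simp
    qed
    have Hfin: "emeasure H (Pk k) \<noteq> top" if "k < N" for k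
    proof
      assume "emeasure H (Pk k) = top"
      then have "ennreal (w k) * emeasure H (Pk k) = top" using wpos[of k] by (simp add: ennreal_mult_top)
      moreover have "ennreal (w k) * emeasure H (Pk k) \<le> (\<Sum>k<N. ennreal (w k) * emeasure H (Pk k))"
        using that by (intro member_le_sum) auto
      ultimately have "top \<le> ennreal I0" using low by (metis order_trans)
      then show False by (simp add: top_unique)
    qed
    define a where "a k = enn2real (emeasure H (Pk k))" for k
    have ha: "emeasure H (Pk k) = ennreal (a k)" "a k \<ge> 0" if "k < N" for k
      using Hfin[OF that] by (simp_all add: a_def less_top)
    have "(\<Sum>k<N. ennreal (w k) * emeasure H (Pk k)) = ennreal (\<Sum>k<N. w k * a k)"
      using ha less_imp_le[OF wpos] by (subst sum_ennreal[symmetric]) (auto simp: ennreal_mult intro!: sum.cong mult_nonneg_nonneg)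
    then have lowr: "(\<Sum>k<N. w k * a k) \<le> I0" using low I0(2) by (simp add: ennreal_le_iff)
    \<comment> \<open>The factor that multiplies \<open>\<epsilon>\<close> in the final sum: each
      level has one error in its cover, scaled by \<open>C0\<close>, and one in the radii.\<close>
    define S where "S = (\<Sum>k<N. 2 * w k * (C0 + 1))"
    have S: "S \<ge> 0" unfolding S_def using wpos C0 by (intro sum_nonneg) (simp add: less_imp_le)
    define \<epsilon> where "\<epsilon> = \<tau> / (S + 1)"
    have \<epsilon>: "\<epsilon> > 0" "\<epsilon> * S \<le> \<tau>"
      using \<tau> S by (auto simp: \<epsilon>_def field_simps)
    define s1 where "s1 = min s0 \<rho>"
    have s1: "s1 > 0" "s1 \<le> s0" "s1 \<le> \<rho>" using s0 \<rho>(1) by (auto simp: s1_def)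
    \<comment> \<open>Sets of diameter at most \<open>\<delta>\<close> get a coordinate radius below
      both \<open>s0\<close> and \<open>\<rho>\<close>.\<close>
    define \<delta> where "\<delta> = s1 / (2 * L)"
    have \<delta>: "\<delta> > 0" "L * \<delta> < s1" using s1 L(1) by (auto simp: \<delta>_def)
    have "\<exists>C. Pk k \<subseteq> (\<Union>i. C i) \<and> (\<forall>i. set_diam ?d (C i) \<le> ennreal \<delta>) \<and>
        (\<Sum>i. cover_weight ?d m (C i)) < ennreal (a k + \<epsilon>)" if k: "k < N" for k
    proof -
      have "hausdorff_content ?d m (ennreal \<delta>) (Pk k) \<le> hausdorff_outer ?d m (Pk k)"
        by (rule hausdorff_content_le_outer) (simp add: \<delta>)
      also have "\<dots> = ennreal (a k)" using HP ha(1)[OF k] by simp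
      also have "\<dots> < ennreal (a k + \<epsilon>)" using ha(2)[OF k] \<epsilon> by (simp add: ennreal_less_iff)
      finally show ?thesis by (rule fine_cover_approx) blast
    qed
    then obtain Cv where Cv: "\<And>k. k < N \<Longrightarrow> Pk k \<subseteq> (\<Union>i. Cv k i)"
      "\<And>k i. k < N \<Longrightarrow> set_diam ?d (Cv k i) \<le> ennreal \<delta>"
      "\<And>k. k < N \<Longrightarrow> (\<Sum>i. cover_weight ?d m (Cv k i)) < ennreal (a k + \<epsilon>)"
      by metis
    define D where "D k i = enn2real (set_diam ?d (Cv k i))" for k i
    have D: "set_diam ?d (Cv k i) = ennreal (D k i)" "0 \<le> D k i" "D k i \<le> \<delta>" if "k < N" for k i
    proof -
      have "set_diam ?d (Cv k i) < top" using Cv(2)[OF that, of i] by (rule order_le_less_trans) simp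
      then show 1: "set_diam ?d (Cv k i) = ennreal (D k i)" "0 \<le> D k i" by (simp_all add: D_def)
      show "D k i \<le> \<delta>" using Cv(2)[OF that, of i] \<delta> unfolding 1(1) by (simp add: ennreal_le_iff)
    qed
    \<comment> \<open>Only covering sets that meet the level set are kept, with a centre chosen in
      it; there the gradient norm is below \<open>2 * w k\<close>. This dyadic loss is the factor 2
      in the constant.\<close>
    define good where "good k i \<longleftrightarrow> k < N \<and> Cv k i \<inter> Pk k \<noteq> {}" for k i
    define pt where "pt k i = (SOME p. p \<in> Cv k i \<inter> Pk k)" for k i
    have pt: "pt k i \<in> Cv k i" "pt k i \<in> Pk k" if "good k i" for k i
      using that someI_ex[of "\<lambda>p. p \<in> Cv k i \<inter> Pk k"] unfolding good_def pt_def by auto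
    have LD: "L * D k i < s1" if "k < N" for k i
      using D(3)[OF that, of i] \<delta> L(1) mult_left_mono[of "D k i" \<delta> L] by linarith
    have "\<exists>r. k < N \<longrightarrow> L * D k i < r \<and> r < s1 \<and> r ^ m \<le> (L * D k i) ^ m + \<epsilon> * (1 / 2) ^ Suc i" for k i
      using exists_slightly_larger[OF LD, of k "\<epsilon> * (1 / 2) ^ Suc i" i m] \<epsilon> by auto
    then obtain r where r: "\<And>k i. k < N \<Longrightarrow> L * D k i < r k i" "\<And>k i. k < N \<Longrightarrow> r k i < s1"
      "\<And>k i. k < N \<Longrightarrow> r k i ^ m \<le> (L * D k i) ^ m + \<epsilon> * (1 / 2) ^ Suc i"
      by metis
    have rpos: "r k i > 0" if "k < N" for k i
    proof -
      have "0 \<le> L * D k i" using L(1) D(2)[OF that, of i] by simp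
      then show ?thesis using r(1)[OF that, of i] by linarith
    qed
    define yy where "yy j = snd c (pt (fst j) (snd j))" for j
    define rr where "rr j = r (fst j) (snd j)" for j
    have yyZ: "yy (k, i) \<in> Z \<and> iv c (yy (k, i)) = pt k i \<and> pt k i \<in> fst c" if gd: "good k i" for k i
    proof -
      obtain y where y: "y \<in> Z" "pt k i = iv c y" using pt(2)[OF gd] by (auto simp: Pk_def P_def)
      have "snd c (iv c y) = y" "iv c y \<in> fst c" using y(1) Zi chart_iv iv_in by auto
      then show ?thesis using y by (simp add: yy_def)
    qed
    have cov: "Z \<subseteq> (\<Union>j\<in>{(k, i). good k i}. ball (yy j) (rr j))"
    proof
      fix y assume y: "y \<in> Z"
      have yi: "y \<in> img c" using y Zi by blast
      obtain k where k: "k < N" "iv c y \<in> Pk k" using Pcov[of "iv c y"] y by (auto simp: P_def)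
      then obtain i where i: "iv c y \<in> Cv k i" using Cv(1) by blast
      have gd: "good k i" using k i by (auto simp: good_def)
      have B: "cball (snd c (pt k i)) \<rho> \<subseteq> K'" using yyZ[OF gd] Z(2) \<rho>(4) by (auto simp: yy_def)
      have "dist (snd c (pt k i)) (snd c (iv c y)) \<le> L * D k i"
      proof (rule small_diam_in_ball(2)[OF c L(2)[OF B]])
        show "pt k i \<in> fst c" using yyZ[OF gd] by simp
        show "pt k i \<in> Cv k i" by (rule pt(1)[OF gd])
        show "iv c y \<in> Cv k i" by fact
        show "set_diam ?d (Cv k i) \<le> ennreal (D k i)" using D(1)[OF k(1)] by simp
        show "L * D k i < \<rho>" using LD[OF k(1), of i] s1 by linarith
      qed (use L D(2)[OF k(1)] in auto)
      also have "\<dots> < r k i" by (rule r(1)[OF k(1)])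
      finally have "y \<in> ball (yy (k, i)) (rr (k, i))" using chart_iv[OF yi] by (simp add: yy_def rr_def)
      then show "y \<in> (\<Union>j\<in>{(k, i). good k i}. ball (yy j) (rr j))" using gd by blast
    qed
    obtain J where J: "J \<subseteq> {(k, i). good k i}" "finite J" "Z \<subseteq> (\<Union>j\<in>J. ball (yy j) (rr j))"
      by (rule compactE_image[OF Z(1) _ cov]) auto
    have Jgood: "good k i" if "(k, i) \<in> J" for k i using J(1) that by auto
    \<comment> \<open>The case distinction matters for \<open>m = 0\<close>, where
      \<open>D^0 = 1\<close> but empty sets have weight 0.\<close>
    define t where "t k i = (if good k i then \<kappa> * D k i ^ m else 0)" for k i
    have tnn: "t k i \<ge> 0" if "k < N" for k i using \<kappa> D(2)[OF that] by (simp add: t_def)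
    have tsum: "(\<Sum>i<n. t k i) \<le> a k + \<epsilon>" if k: "k < N" for k n
    proof -
      have le: "ennreal (t k i) \<le> cover_weight ?d m (Cv k i)" for i
      proof (cases "good k i")
        case True
        then have ne: "Cv k i \<noteq> {}" by (auto simp: good_def)
        have "ennreal (t k i) = ennreal \<kappa> * ennreal (D k i) ^ m"
          using True \<kappa> D(2)[OF k, of i] by (simp add: t_def ennreal_mult ennreal_power)
        then show ?thesis using ne by (simp add: cover_weight_def D(1)[OF k] \<kappa>_def)
      qed (simp add: t_def)
      have "ennreal (\<Sum>i<n. t k i) = (\<Sum>i<n. ennreal (t k i))" using tnn[OF k] by (simp add: sum_ennreal)
      also have "\<dots> \<le> (\<Sum>i<n. cover_weight ?d m (Cv k i))" by (intro sum_mono le)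
      also have "\<dots> \<le> (\<Sum>i. cover_weight ?d m (Cv k i))" by (intro sum_le_suminf) auto
      also have "\<dots> \<le> ennreal (a k + \<epsilon>)" using Cv(3)[OF k] by simp
      finally have "ennreal (\<Sum>i<n. t k i) \<le> ennreal (a k + \<epsilon>)" .
      moreover have "0 \<le> a k + \<epsilon>" using ha(2)[OF k] \<epsilon> by linarith
      ultimately show ?thesis by (simp only: ennreal_le_iff)
    qed
    obtain n where n: "snd ` J \<subseteq> {..<n}" using finite_nat_iff_bounded[of "snd ` J"] J(2) by auto
    have Jsub: "J \<subseteq> {..<N} \<times> {..<n}"
      using n Jgood by (force simp: good_def)
    define T where "T k i = (C0 * t k i + \<epsilon> * (1 / 2) ^ Suc i) * (2 * w k)" for k i
    have Tnn: "T k i \<ge> 0" if "k < N" for k i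
      unfolding T_def using tnn[OF that, of i] C0 \<epsilon> wpos[of k] by (intro mult_nonneg_nonneg add_nonneg_nonneg) auto
    have each: "rr j ^ m * g (iv c (yy j)) \<le> T (fst j) (snd j)" if j: "j \<in> J" for j
    proof -
      obtain k i where ki: "j = (k, i)" by force
      have gd: "good k i" using Jgood j ki by simp
      have k: "k < N" using gd by (simp add: good_def)
      have "r k i ^ m \<le> (L * D k i) ^ m + \<epsilon> * (1 / 2) ^ Suc i" by (rule r(3)[OF k])
      also have "(L * D k i) ^ m = C0 * t k i" using gd \<kappa> by (simp add: C0_def t_def power_mult_distrib)
      finally have 1: "r k i ^ m \<le> C0 * t k i + \<epsilon> * (1 / 2) ^ Suc i" .
      have "g (pt k i) \<le> 2 * w k" using pt(2)[OF gd] w2[of k] by (simp add: Pk_def)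
      moreover have "0 \<le> g (pt k i)" using pt(2)[OF gd] wpos[of k] by (simp add: Pk_def)
      ultimately have "r k i ^ m * g (pt k i) \<le> T k i"
        unfolding T_def using 1 rpos[OF k, of i] tnn[OF k, of i] C0 \<epsilon>
        by (intro mult_mono) auto
      then show ?thesis using yyZ[OF gd] ki by (simp add: rr_def)
    qed
    have "(\<Sum>j\<in>J. rr j ^ m * g (iv c (yy j))) \<le> (\<Sum>j\<in>J. T (fst j) (snd j))" by (intro sum_mono each)
    also have "\<dots> \<le> (\<Sum>j\<in>{..<N} \<times> {..<n}. T (fst j) (snd j))"
      using Jsub Tnn by (intro sum_mono2) auto
    also have "\<dots> = (\<Sum>k<N. \<Sum>i<n. T k i)" by (simp add: sum.cartesian_product split_beta)
    also have "\<dots> \<le> (\<Sum>k<N. (C0 * (a k + \<epsilon>) + \<epsilon>) * (2 * w k))"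
    proof (intro sum_mono)
      fix k assume "k \<in> {..<N}"
      then have k: "k < N" by simp
      have "(\<Sum>i<n. T k i) = (C0 * (\<Sum>i<n. t k i) + \<epsilon> * (\<Sum>i<n. (1 / 2) ^ Suc i)) * (2 * w k)"
        unfolding T_def by (simp only: sum_distrib_right[symmetric] sum.distrib sum_distrib_left[symmetric])
      also have "\<dots> \<le> (C0 * (a k + \<epsilon>) + \<epsilon> * 1) * (2 * w k)"
        using tsum[OF k] half_powers_le_1 C0 \<epsilon> wpos[of k]
        by (intro mult_right_mono add_mono mult_left_mono) auto
      finally show "(\<Sum>i<n. T k i) \<le> (C0 * (a k + \<epsilon>) + \<epsilon>) * (2 * w k)" by simp
    qed
    also have "\<dots> = 2 * C0 * (\<Sum>k<N. w k * a k) + \<epsilon> * S"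
      unfolding S_def by (simp add: sum_distrib_left sum.distrib[symmetric] algebra_simps)
    also have "\<dots> \<le> 2 * C0 * I0 + \<tau>"
      using lowr C0 \<epsilon>(2) by (intro add_mono mult_left_mono) auto
    finally have fin: "(\<Sum>j\<in>J. rr j ^ m * g (iv c (yy j))) \<le> 2 * C0 * I0 + \<tau>" .
    have "\<forall>j\<in>J. yy j \<in> Z \<and> 0 < rr j \<and> rr j < s0"
    proof
      fix j assume j: "j \<in> J"
      obtain k i where ki: "j = (k, i)" by force
      have gd: "good k i" using Jgood j ki by simp
      have k: "k < N" using gd by (simp add: good_def)
      show "yy j \<in> Z \<and> 0 < rr j \<and> rr j < s0"
        using yyZ[OF gd] rpos[OF k, of i] r(2)[OF k, of i] s1(2) ki by (simp add: rr_def)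
    qed
    then show "\<exists>(J :: (nat \<times> nat) set) yy rr. finite J \<and> (\<forall>j\<in>J. yy j \<in> Z \<and> 0 < rr j \<and> rr j < s0) \<and>
        Z \<subseteq> (\<Union>j\<in>J. ball (yy j) (rr j)) \<and>
        (\<Sum>j\<in>J. rr j ^ (CARD('n) - 1) * grad_norm A G f (iv c (yy j))) \<le> 2 * C0 * I0 + \<tau>"
      using J(2,3) fin unfolding m_def[symmetric] g_def[symmetric] by blast
  qed
  then show thesis using that[of "2 * C0"] C0 by simp
qed

end

section \<open>Nodal mass and the mean of the modulus\<close>

context riem begin

text \<open>\<open>C\<close> is chosen before \<open>f\<close>, while the threshold
  \<open>k0\<close> may depend on \<open>f\<close> and \<open>\<tau>\<close>. The kernel is the
  derivative of \<open>arctan (k t)\<close>, which concentrates at \<open>t = 0\<close>.\<close>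

definition nodal_bound :: "('a, 'n) chart \<Rightarrow> (real ^ 'n \<Rightarrow> real) \<Rightarrow> real \<Rightarrow> bool" where
  "nodal_bound c F C \<longleftrightarrow> C > 0 \<and> (\<forall>f l I0 \<tau>. eigenfunction A G f l \<longrightarrow>
     emeasure (grad_nodal_measure A G f) UNIV = ennreal I0 \<longrightarrow> 0 \<le> I0 \<longrightarrow> \<tau> > 0 \<longrightarrow> (\<exists>k0. \<forall>k\<ge>k0. k > 0 \<longrightarrow>
       (\<integral>y. F y * (real k / (1 + (real k * coord_rep c f y)\<^sup>2) * energy c f y) \<partial>lborel) \<le> C * I0 + \<tau>))"

text \<open>The integral is split in three. The part cut off to small gradient contributes at most
  \<open>\<tau> / 3\<close>. Nodal points with larger gradient are covered by finitely many balls,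
  whose estimates sum to \<open>B * CN * I0 + \<tau> / 3\<close>. On the compact remainder
  \<open>\<bar>f\<bar>\<close> is bounded below, so the kernel is of order
  \<open>1 / k\<close>.\<close>

lemma local_nodal_bound:
  assumes c: "c \<in> A" and K: "compact K" "K \<subseteq> img c"
    and F: "C1 UNIV F" "\<And>y. y \<notin> K \<Longrightarrow> F y = 0" "\<And>y. 0 \<le> F y" "\<And>y. F y \<le> 1"
  shows "\<exists>C. nodal_bound c F C"
proof -
  obtain CB \<rho> where CB: "CB > 0" "\<rho> > 0"
    "\<And>f l. eigenfunction A G f l \<Longrightarrow> \<exists>Cf\<ge>0. \<forall>y0\<in>K. \<forall>r>0. 2 * r \<le> \<rho> \<longrightarrow> ball_estimate c f CB Cf y0 r"
    by (rule ball_energy_estimate[OF c K]) blast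
  obtain CN where CN: "CN > 0" "nodal_cover_bound c K CN" by (rule nodal_cover[OF c K])
  obtain CD where CD: "CD > 0"
    "\<And>y f. y \<in> K \<Longrightarrow> norm (gradv (coord_rep c f) y) \<le> CD * sqrt (gip c f f (iv c y))"
    by (rule flux_bounds[OF c K]) blast
  \<comment> \<open>\<open>CB\<close> is the constant of the ball estimate, 2 comes from absorbing
    its error term, and \<open>CD\<close> compares Euclidean and Riemannian gradient norms.\<close>
  define B where "B = CB * 2 * CD"
  have B: "B > 0" using CB(1) CD(1) by (simp add: B_def)
  have "nodal_bound c F (B * CN)"
    unfolding nodal_bound_def
  proof (intro conjI allI impI)
    show "B * CN > 0" using B CN(1) by simp
    fix f l I0 \<tau>
    assume f: "eigenfunction A G f l" and I0: "emeasure (grad_nodal_measure A G f) UNIV = ennreal I0" "0 \<le> I0"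
      and \<tau>: "(\<tau> :: real) > 0"
    have sm: "smooth_fun A f" using f by (rule eigen_smooth)
    let ?f = "coord_rep c f" and ?E = "energy c f" and ?q = "grad_sq c f"
    define h where "h k t = arctan (real k * t)" for k t
    define h' where "h' k t = real k / (1 + (real k * t)\<^sup>2)" for k t
    have pair: "bounded_C1_pair (h k) (h' k)" for k
      unfolding h_def[abs_def] h'_def[abs_def] by (rule bounded_C1_pair_arctan)
    note hd = bounded_C1_pairD(1)[OF pair] and hc = bounded_C1_pairD(2)[OF pair]
    have h'nn: "0 \<le> h' k t" for k t unfolding h'_def using one_plus_square_pos[of "real k * t"] by simp
    obtain N :: nat where N: "N > 0" "C1 UNIV (\<lambda>y. F y * cutoff (real N * ?q y))"
      "\<And>h h'. bounded_C1_pair h h' \<Longrightarrow>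
        (\<integral>y. F y * cutoff (real N * ?q y) * (h' (?f y) * ?E y) \<partial>lborel) \<le> \<tau> / 3"
      by (rule small_gradient[OF c f F(1) K F(2) F(3), of "\<tau> / 3"]) (use \<tau> in auto)
    \<comment> \<open>Where \<open>cutoff (real N * ?q y)\<close> differs from 1, the Euclidean
      gradient norm exceeds \<open>e0\<close>.\<close>
    define e0 where "e0 = 1 / sqrt (real N)"
    have e0: "e0 > 0" "e0\<^sup>2 = 1 / real N" using N(1) by (simp_all add: e0_def power_divide)
    have qcont: "continuous_on K ?q" using C1_continuous[OF C1_grad_sq[OF c sm]] K(2) continuous_on_subset by blast
    have fcont: "continuous_on K ?f" using C1_continuous[OF C1_coord_rep(1)[OF c sm]] K(2) continuous_on_subset by blast
    have clK: "closed K" using K(1) by (rule compact_imp_closed)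
    define KN where "KN = K \<inter> ?q -` {1 / real N..}"
    have KN: "compact KN"
    proof -
      have "closed KN" unfolding KN_def by (rule continuous_closed_preimage[OF qcont clK closed_atLeast])
      then have "compact (K \<inter> KN)" using K(1) by (rule compact_Int_closed[rotated])
      moreover have "K \<inter> KN = KN" by (auto simp: KN_def)
      ultimately show ?thesis by simp
    qed
    define Z where "Z = KN \<inter> ?f -` {0}"
    have KNK: "KN \<subseteq> K" by (auto simp: KN_def)
    have Z: "compact Z"
    proof -
      have "closed Z" unfolding Z_def
        by (rule continuous_closed_preimage[OF continuous_on_subset[OF fcont KNK] compact_imp_closed[OF KN] closed_singleton])
      then have "compact (KN \<inter> Z)" using KN by (rule compact_Int_closed[rotated])
      moreover have "KN \<inter> Z = Z" by (auto simp: Z_def)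
      ultimately show ?thesis by simp
    qed
    have ZK: "Z \<subseteq> K" using KNK by (auto simp: Z_def)
    have Z0: "f (iv c y) = 0" if "y \<in> Z" for y using that by (simp add: Z_def coord_rep_def)
    have De0: "e0 \<le> norm (gradv ?f y)" if "y \<in> Z" for y
    proof -
      have "e0\<^sup>2 \<le> (norm (gradv ?f y))\<^sup>2" using that by (simp add: Z_def KN_def e0(2) grad_sq_norm[symmetric])
      then show ?thesis by (rule power2_le_imp_le) simp
    qed
    have gn: "norm (gradv ?f y) \<le> CD * grad_norm A G f (iv c y)" if "y \<in> K" for y
    proof -
      have "iv c y \<in> fst c" using that K(2) iv_in by blast
      then show ?thesis using CD(2)[OF that, of f] by (simp add: grad_norm_chart[OF c _ sm])
    qed
    have Zg: "e0 / CD \<le> grad_norm A G f (iv c y)" if "y \<in> Z" for y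
    proof -
      have "e0 \<le> CD * grad_norm A G f (iv c y)" using De0[OF that] gn[of y] that ZK by (meson order_trans subsetD)
      then show ?thesis using CD(1) by (simp add: divide_le_eq mult.commute)
    qed
    obtain Cf where Cf: "Cf \<ge> 0" "\<forall>y0\<in>K. \<forall>r>0. 2 * r \<le> \<rho> \<longrightarrow> ball_estimate c f CB Cf y0 r"
      using CB(3)[OF f] by blast
    \<comment> \<open>Radii below \<open>s0\<close> satisfy \<open>2 * r \<le> \<rho>\<close> and
      \<open>Cf * r \<le> e0\<close>. As \<open>e0\<close> is at most the gradient norm at the
      centre, the error term depending on \<open>f\<close> is absorbed into the main one.\<close>
    define s0 where "s0 = min (\<rho> / 2) (e0 / (Cf + 1))"
    have s0: "s0 > 0" "2 * s0 \<le> \<rho>" "Cf * s0 \<le> e0"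
    proof -
      show "s0 > 0" using CB(2) e0(1) Cf(1) by (simp add: s0_def)
      have "s0 \<le> \<rho> / 2" unfolding s0_def by (rule min.cobounded1)
      then show "2 * s0 \<le> \<rho>" by linarith
      have "Cf * s0 \<le> Cf * (e0 / (Cf + 1))" unfolding s0_def using Cf(1) by (intro mult_left_mono) auto
      also have "\<dots> \<le> e0" using Cf(1) e0(1) by (simp add: field_simps)
      finally show "Cf * s0 \<le> e0" .
    qed
    have \<tau>B: "\<tau> / (3 * B) > 0" using \<tau> B by simp
    have e0CD: "0 < e0 / CD" using e0 CD by simp
    have "\<exists>(J :: (nat \<times> nat) set) yy rr. finite J \<and> (\<forall>j\<in>J. yy j \<in> Z \<and> 0 < rr j \<and> rr j < s0) \<and>
        Z \<subseteq> (\<Union>j\<in>J. ball (yy j) (rr j)) \<and>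
        (\<Sum>j\<in>J. rr j ^ (CARD('n) - 1) * grad_norm A G f (iv c (yy j))) \<le> CN * I0 + \<tau> / (3 * B)"
      by (rule CN(2)[unfolded nodal_cover_bound_def, rule_format, OF sm Z ZK _ e0CD _ I0 s0(1) \<tau>B])
         (erule Z0 Zg)+
    then
    obtain J :: "(nat \<times> nat) set" and yy rr where J: "finite J" "\<forall>j\<in>J. yy j \<in> Z \<and> 0 < rr j \<and> rr j < s0"
      "Z \<subseteq> (\<Union>j\<in>J. ball (yy j) (rr j))"
      "(\<Sum>j\<in>J. rr j ^ (CARD('n) - 1) * grad_norm A G f (iv c (yy j))) \<le> CN * I0 + \<tau> / (3 * B)"
      by (elim exE conjE)
    define b where "b j y = bump (yy j) (2 * rr j) y / (9 * rr j ^ 4)" for j y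
    have bj: "cball (yy j) (2 * rr j) \<subseteq> img c \<and> integrable lborel (\<lambda>y. b j y * (h' k (?f y) * ?E y)) \<and>
       (\<integral>y. b j y * (h' k (?f y) * ?E y) \<partial>lborel) \<le> B * (rr j ^ (CARD('n) - 1) * grad_norm A G f (iv c (yy j)))"
      if j: "j \<in> J" for j k
    proof -
      have jj: "yy j \<in> Z" "0 < rr j" "rr j < s0" using J(2) j by blast+
      have yK: "yy j \<in> K" using jj ZK by blast
      have "2 * rr j \<le> \<rho>" using jj s0 by linarith
      then have "ball_estimate c f CB Cf (yy j) (rr j)" using Cf(2) yK jj(2) by blast
      then have *: "cball (yy j) (2 * rr j) \<subseteq> img c"
        and 1: "integrable lborel (\<lambda>y. b j y * (h' k (?f y) * ?E y)) \<and>
         (\<integral>y. b j y * (h' k (?f y) * ?E y) \<partial>lborel)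
           \<le> CB * rr j ^ (CARD('n) - 1) * (norm (gradv ?f (yy j)) + Cf * rr j)"
        unfolding ball_estimate_def b_def using pair by blast+
      have "Cf * rr j \<le> Cf * s0" using jj Cf(1) by (intro mult_left_mono) auto
      then have "norm (gradv ?f (yy j)) + Cf * rr j \<le> 2 * norm (gradv ?f (yy j))"
        using De0[OF jj(1)] s0(3) by linarith
      also have "\<dots> \<le> 2 * (CD * grad_norm A G f (iv c (yy j)))" using gn[OF yK] by simp
      finally have "CB * rr j ^ (CARD('n) - 1) * (norm (gradv ?f (yy j)) + Cf * rr j)
          \<le> CB * rr j ^ (CARD('n) - 1) * (2 * (CD * grad_norm A G f (iv c (yy j))))"
        using CB(1) jj(2) by (intro mult_left_mono) auto
      also have "\<dots> = B * (rr j ^ (CARD('n) - 1) * grad_norm A G f (iv c (yy j)))"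
        by (simp add: B_def mult_ac)
      finally show ?thesis using 1 * by (meson order_trans)
    qed
    have bnn: "0 \<le> b j y" for j y unfolding b_def by (simp add: bump_nonneg)
    have b1: "1 \<le> b j y" if j: "j \<in> J" and y: "y \<in> ball (yy j) (rr j)" for j y
    proof -
      have r: "0 < rr j" using J(2) j by blast
      then have "9 * rr j ^ 4 \<le> bump (yy j) (2 * rr j) y"
        using bump_bounds(4)[of "2 * rr j" "yy j" y] y by simp
      then show ?thesis unfolding b_def using r by (simp add: le_divide_eq)
    qed
    have bE: "0 \<le> b j y * (h' k (?f y) * ?E y)" if j: "j \<in> J" for j y k
    proof (cases "y \<in> img c")
      case True
      then show ?thesis using bnn h'nn energy_nonneg[OF c] by (intro mult_nonneg_nonneg) auto
    next
      case False
      have r: "0 < 2 * rr j" using J(2) j by simp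
      have "y \<notin> cball (yy j) (2 * rr j)" using bj[OF j] False by blast
      then have "b j y = 0" unfolding b_def by (subst bump_bounds(3)[OF r]) simp_all
      then show ?thesis by simp
    qed
    define R where "R = KN - (\<Union>j\<in>J. ball (yy j) (rr j))"
    have Rc: "compact R" unfolding R_def using KN by (intro compact_diff) auto
    \<comment> \<open>\<open>R\<close> is compact and contains no zero of \<open>f\<close>, all
      zeros in \<open>KN\<close> being covered by the balls.\<close>
    have "\<exists>\<mu>>0. \<forall>y\<in>R. \<mu> \<le> \<bar>?f y\<bar>"
    proof (cases "R = {}")
      case True then show ?thesis by (intro exI[of _ 1]) simp
    next
      case False
      have "continuous_on R (\<lambda>y. \<bar>?f y\<bar>)"
        by (intro continuous_on_rabs continuous_on_subset[OF fcont]) (use KNK in \<open>auto simp: R_def\<close>)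
      then obtain y where y: "y \<in> R" "\<forall>y'\<in>R. \<bar>?f y\<bar> \<le> \<bar>?f y'\<bar>"
        using continuous_attains_inf[OF Rc False] by blast
      have "?f y \<noteq> 0" using y(1) J(3) by (auto simp: R_def Z_def)
      then show ?thesis using y(2) by (intro exI[of _ "\<bar>?f y\<bar>"]) auto
    qed
    then obtain \<mu> where \<mu>: "\<mu> > 0" "\<And>y. y \<in> R \<Longrightarrow> \<mu> \<le> \<bar>?f y\<bar>" by blast
    have FEi: "integrable lborel (\<lambda>y. F y * ?E y)"
      using local_green(2)[OF c f F(1) K F(2), of "\<lambda>t. t" "\<lambda>t. 1"] by simp
    define Q where "Q = (\<integral>y. F y * ?E y \<partial>lborel)"
    have FE: "0 \<le> F y * ?E y" for y
    proof (cases "y \<in> K")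
      case True then show ?thesis using energy_nonneg[OF c, of y f] K(2) F(3)[of y] by auto
    qed (simp add: F(2))
    obtain k0 :: nat where k0: "3 * Q / (\<mu>\<^sup>2 * \<tau>) < real k0" using reals_Archimedean2 by blast
    show "\<exists>k0. \<forall>k\<ge>k0. k > 0 \<longrightarrow>
        (\<integral>y. F y * (real k / (1 + (real k * ?f y)\<^sup>2) * ?E y) \<partial>lborel) \<le> B * CN * I0 + \<tau>"
    proof (intro exI[of _ k0] allI impI)
      fix k assume k: "k0 \<le> k" "0 < k"
      have i1: "integrable lborel (\<lambda>y. F y * (h' k (?f y) * ?E y))"
        by (rule local_green(2)[OF c f F(1) K F(2) hd hc])
      have i2: "integrable lborel (\<lambda>y. F y * cutoff (real N * ?q y) * (h' k (?f y) * ?E y))"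
        by (rule local_green(2)[OF c f N(2) K _ hd hc]) (simp add: F(2))
      have i3: "integrable lborel (\<lambda>y. (\<Sum>j\<in>J. b j y * (h' k (?f y) * ?E y)) + 1 / (real k * \<mu>\<^sup>2) * (F y * ?E y))"
        using bj FEi by (intro Bochner_Integration.integrable_add Bochner_Integration.integrable_sum integrable_mult_right) auto
      \<comment> \<open>With the cut-off part subtracted, the integrand vanishes off
        \<open>KN\<close>, where either \<open>F\<close> is 0 or the cut-off is 1; a point of
        \<open>KN\<close> lies in a ball or in \<open>R\<close>.\<close>
      have pw: "F y * (h' k (?f y) * ?E y) - F y * cutoff (real N * ?q y) * (h' k (?f y) * ?E y)
          \<le> (\<Sum>j\<in>J. b j y * (h' k (?f y) * ?E y)) + 1 / (real k * \<mu>\<^sup>2) * (F y * ?E y)" for y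
      proof -
        have s1: "0 \<le> (\<Sum>j\<in>J. b j y * (h' k (?f y) * ?E y))" by (intro sum_nonneg bE)
        have s2: "0 \<le> 1 / (real k * \<mu>\<^sup>2) * (F y * ?E y)" by (intro mult_nonneg_nonneg FE) simp
        consider "y \<notin> K" | "y \<in> K" "y \<notin> KN" | j where "y \<in> K" "j \<in> J" "y \<in> ball (yy j) (rr j)" | "y \<in> R" "y \<in> K"
          using KNK unfolding R_def by blast
        then show ?thesis
        proof cases
          case 1 then show ?thesis using s1 by (simp add: F(2))
        next
          case 2
          then have "?q y < 1 / real N" by (auto simp: KN_def)
          then have "real N * ?q y \<le> 1" using N(1) by (simp add: field_simps)
          then show ?thesis using s1 s2 by (simp add: cutoff_eq_1)
        next
          case 3
          have hE: "0 \<le> h' k (?f y) * ?E y"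
            using 3(1) K(2) by (intro mult_nonneg_nonneg h'nn energy_nonneg[OF c]) auto
          have "F y * (h' k (?f y) * ?E y) - F y * cutoff (real N * ?q y) * (h' k (?f y) * ?E y)
              \<le> 1 * (h' k (?f y) * ?E y)"
          proof -
            have "F y * (h' k (?f y) * ?E y) \<le> 1 * (h' k (?f y) * ?E y)" by (intro mult_right_mono F(4) hE)
            moreover have "0 \<le> F y * cutoff (real N * ?q y) * (h' k (?f y) * ?E y)"
              by (intro mult_nonneg_nonneg[OF _ hE] mult_nonneg_nonneg F(3) less_imp_le[OF cutoff_bounds(1)])
            ultimately show ?thesis by linarith
          qed
          also have "\<dots> \<le> b j y * (h' k (?f y) * ?E y)" by (intro mult_right_mono b1[OF 3(2,3)] hE)
          also have "\<dots> \<le> (\<Sum>j\<in>J. b j y * (h' k (?f y) * ?E y))"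
            using J(1) 3(2) bE by (intro member_le_sum) auto
          finally show ?thesis using s2 by linarith
        next
          case 4
          have "(real k * \<mu>)\<^sup>2 \<le> (real k * \<bar>?f y\<bar>)\<^sup>2"
            using \<mu>(1) \<mu>(2)[OF 4(1)] by (intro power_mono mult_left_mono) auto
          then have le: "(real k * \<mu>)\<^sup>2 \<le> 1 + (real k * ?f y)\<^sup>2" by (simp add: power_mult_distrib)
          have "h' k (?f y) \<le> real k / (real k * \<mu>)\<^sup>2"
            unfolding h'_def using le k(2) \<mu>(1) by (intro divide_left_mono) (auto intro!: mult_pos_pos one_plus_square_pos)
          also have "\<dots> = 1 / (real k * \<mu>\<^sup>2)" using k(2) by (simp add: power2_eq_square)
          finally have hk: "h' k (?f y) \<le> 1 / (real k * \<mu>\<^sup>2)" .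
          have "F y * (h' k (?f y) * ?E y) - F y * cutoff (real N * ?q y) * (h' k (?f y) * ?E y)
             \<le> F y * (h' k (?f y) * ?E y)"
          proof -
            have "0 \<le> cutoff (real N * ?q y) * (h' k (?f y) * (F y * ?E y))"
              by (intro mult_nonneg_nonneg less_imp_le[OF cutoff_bounds(1)] h'nn FE)
            then show ?thesis by (simp add: mult_ac)
          qed
          also have "\<dots> = h' k (?f y) * (F y * ?E y)" by (simp add: mult_ac)
          also have "\<dots> \<le> 1 / (real k * \<mu>\<^sup>2) * (F y * ?E y)" by (intro mult_right_mono hk FE)
          finally show ?thesis using s1 by linarith
        qed
      qed
      have "(\<integral>y. F y * (h' k (?f y) * ?E y) \<partial>lborel) - (\<integral>y. F y * cutoff (real N * ?q y) * (h' k (?f y) * ?E y) \<partial>lborel)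
         = (\<integral>y. F y * (h' k (?f y) * ?E y) - F y * cutoff (real N * ?q y) * (h' k (?f y) * ?E y) \<partial>lborel)"
        using i1 i2 by simp
      also have "\<dots> \<le> (\<integral>y. (\<Sum>j\<in>J. b j y * (h' k (?f y) * ?E y)) + 1 / (real k * \<mu>\<^sup>2) * (F y * ?E y) \<partial>lborel)"
        by (rule integral_mono[OF _ i3 pw]) (use i1 i2 in simp)
      also have "\<dots> = (\<Sum>j\<in>J. \<integral>y. b j y * (h' k (?f y) * ?E y) \<partial>lborel) + 1 / (real k * \<mu>\<^sup>2) * Q"
      proof -
        have "integrable lborel (\<lambda>y. \<Sum>j\<in>J. b j y * (h' k (?f y) * ?E y))"
          using bj by (intro Bochner_Integration.integrable_sum) blast
        moreover have "integrable lborel (\<lambda>y. 1 / (real k * \<mu>\<^sup>2) * (F y * ?E y))"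
          by (intro integrable_mult_right FEi)
        moreover have "(\<integral>y. (\<Sum>j\<in>J. b j y * (h' k (?f y) * ?E y)) \<partial>lborel) = (\<Sum>j\<in>J. \<integral>y. b j y * (h' k (?f y) * ?E y) \<partial>lborel)"
          using bj by (intro Bochner_Integration.integral_sum) blast
        moreover have "(\<integral>y. 1 / (real k * \<mu>\<^sup>2) * (F y * ?E y) \<partial>lborel) = 1 / (real k * \<mu>\<^sup>2) * Q"
          unfolding Q_def by (rule integral_mult_right_zero)
        ultimately show ?thesis by (simp only: Bochner_Integration.integral_add)
      qed
      also have "(\<Sum>j\<in>J. \<integral>y. b j y * (h' k (?f y) * ?E y) \<partial>lborel)
          \<le> (\<Sum>j\<in>J. B * (rr j ^ (CARD('n) - 1) * grad_norm A G f (iv c (yy j))))"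
        using bj by (intro sum_mono) blast
      also have "\<dots> = B * (\<Sum>j\<in>J. rr j ^ (CARD('n) - 1) * grad_norm A G f (iv c (yy j)))"
        by (rule sum_distrib_left[symmetric])
      also have "\<dots> \<le> B * (CN * I0 + \<tau> / (3 * B))" using J(4) B by (intro mult_left_mono) auto
      also have "\<dots> = B * CN * I0 + \<tau> / 3" using B by (simp add: field_simps)
      also have "1 / (real k * \<mu>\<^sup>2) * Q \<le> \<tau> / 3"
      proof -
        have "3 * Q / (\<mu>\<^sup>2 * \<tau>) < real k" using k0 k(1) by linarith
        then have "3 * Q < real k * (\<mu>\<^sup>2 * \<tau>)" using \<mu>(1) \<tau> by (subst (asm) divide_less_eq) auto
        then show ?thesis using \<mu>(1) k(2) by (simp add: field_simps)
      qed
      finally have "(\<integral>y. F y * (h' k (?f y) * ?E y) \<partial>lborel) \<le>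
          (\<integral>y. F y * cutoff (real N * ?q y) * (h' k (?f y) * ?E y) \<partial>lborel) + (B * CN * I0 + \<tau> / 3 + \<tau> / 3)"
        by simp
      also have "(\<integral>y. F y * cutoff (real N * ?q y) * (h' k (?f y) * ?E y) \<partial>lborel) \<le> \<tau> / 3"
        by (rule N(3)[OF pair])
      finally show "(\<integral>y. F y * (real k / (1 + (real k * ?f y)\<^sup>2) * ?E y) \<partial>lborel) \<le> B * CN * I0 + \<tau>"
        unfolding h'_def by simp
    qed
  qed
  then show ?thesis ..
qed

end

text \<open>For \<open>k \<bar>s\<bar> \<ge> 1\<close> the arctangent of
  \<open>k \<bar>s\<bar>\<close> is at least \<open>pi / 4\<close>, which exceeds 1/2; for smaller
  \<open>\<bar>s\<bar>\<close> the left side is not positive.\<close>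

lemma arctan_mult_lower_bound:
  assumes "k > 0" shows "(\<bar>s\<bar> - 1 / k) / 2 \<le> s * arctan (k * s)"
proof -
  have ev: "s * arctan (k * s) = \<bar>s\<bar> * arctan (k * \<bar>s\<bar>)"
    by (cases "s \<ge> 0") (auto simp: arctan_minus)
  show ?thesis
  proof (cases "\<bar>s\<bar> \<le> 1 / k")
    case True
    have "0 \<le> \<bar>s\<bar> * arctan (k * \<bar>s\<bar>)" using assms by (intro mult_nonneg_nonneg) auto
    then show ?thesis using True ev by simp
  next
    case False
    then have "1 \<le> k * \<bar>s\<bar>" using assms by (simp add: field_simps)
    then have "arctan 1 \<le> arctan (k * \<bar>s\<bar>)" by (rule arctan_monotone')
    then have "1 / 2 \<le> arctan (k * \<bar>s\<bar>)" using arctan_one pi_gt3 by simp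
    then have "\<bar>s\<bar> * (1 / 2) \<le> \<bar>s\<bar> * arctan (k * \<bar>s\<bar>)" by (intro mult_left_mono) auto
    moreover have "(\<bar>s\<bar> - 1 / k) / 2 \<le> \<bar>s\<bar> * (1 / 2)" using assms by simp
    ultimately have "(\<bar>s\<bar> - 1 / k) / 2 \<le> \<bar>s\<bar> * arctan (k * \<bar>s\<bar>)" by (rule order_trans[rotated])
    then show ?thesis unfolding ev .
  qed
qed

text \<open>A positive value would persist on a nonempty open set, which is not negligible.\<close>

lemma continuous_nonneg_integral_zero:
  fixes u :: "'b::euclidean_space \<Rightarrow> real"
  assumes u: "continuous_on UNIV u" "\<And>y. 0 \<le> u y" "integrable lborel u" "(\<integral>y. u y \<partial>lborel) = 0"
  shows "u y = 0"
proof (rule ccontr)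
  assume "u y \<noteq> 0"
  then have ne: "{y. u y > 0} \<noteq> {}" using u(2)[of y] by (auto intro: exI[of _ y])
  have o: "open {y. u y > 0}" by (intro open_Collect_less continuous_on_const u(1))
  have "AE y in lborel. u y = 0" using integral_nonneg_eq_0_iff_AE[OF u(3)] u(2,4) by simp
  then have "{y. u y \<noteq> 0} \<in> null_sets lborel" using o u(1)
    using borel_open[OF open_Collect_neq[OF u(1) continuous_on_const]]
    by (subst (asm) AE_iff_null) auto
  then have "{y. u y > 0} \<in> null_sets lborel"
    by (rule null_sets_subset) (use o in auto)
  then have "negligible {y. u y > 0}" by (simp add: negligible_iff_null_sets null_sets_completionI)
  then show False using open_not_negligible[OF o ne] by blast
qed

text \<open>If \<open>\<integral>|\<phi>\<^sub>j| \<rightarrow> 0\<close> fast along a subsequence, then the subsequence tends to \<open>0\<close> uniformly outside a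
  set of small measure; the complement of this set violates quantum ergodicity.\<close>

lemma quantum_ergodic_L1_lower_bound:
  assumes fin: "finite_measure V" and pos: "measure V (space V) > 0"
    and int: "\<And>j. integrable V (\<phi> j)" and qe: "Linfty_quantum_ergodic V \<phi>"
  obtains c where "c > 0" "\<forall>\<^sub>F j in sequentially. c \<le> (\<integral>p. \<bar>\<phi> j p\<bar> \<partial>V)"
proof -
  interpret finite_measure V by fact
  have meas [measurable]: "\<phi> j \<in> borel_measurable V" for j using int by (rule borel_measurable_integrable)
  have "\<exists>c>0. \<forall>\<^sub>F j in sequentially. c \<le> (\<integral>p. \<bar>\<phi> j p\<bar> \<partial>V)"
  proof (rule ccontr)
    assume n: "\<not> (\<exists>c>0. \<forall>\<^sub>F j in sequentially. c \<le> (\<integral>p. \<bar>\<phi> j p\<bar> \<partial>V))"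
    have "\<exists>j\<ge>k. (\<integral>p. \<bar>\<phi> j p\<bar> \<partial>V) < (1 / 4) ^ k" for k :: nat
    proof (rule ccontr)
      assume "\<not> ?thesis"
      then have "\<forall>\<^sub>F j in sequentially. (1 / 4) ^ k \<le> (\<integral>p. \<bar>\<phi> j p\<bar> \<partial>V)"
        unfolding eventually_sequentially by (meson not_le)
      then show False using n by (meson divide_pos_pos zero_less_numeral zero_less_one zero_less_power)
    qed
    \<comment> \<open>By Markov's inequality, an L1 norm below \<open>4^-k\<close> makes the
      function smaller than \<open>2^-k\<close> outside a set of measure at most
      \<open>2^-k\<close>.\<close>
    then obtain s where s: "\<And>k. s k \<ge> k" "\<And>k. (\<integral>p. \<bar>\<phi> (s k) p\<bar> \<partial>V) < (1 / 4) ^ k" by metis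
    define B where "B k = {p \<in> space V. (1 / 2) ^ k \<le> \<bar>\<phi> (s k) p\<bar>}" for k
    have Bm: "B k \<in> sets V" for k unfolding B_def by measurable
    have mB: "measure V (B k) \<le> (1 / 2) ^ k" for k
    proof -
      have "measure V (B k) \<le> (\<integral>p. \<bar>\<phi> (s k) p\<bar> \<partial>V) / (1 / 2) ^ k"
        unfolding B_def by (rule integral_Markov_inequality_measure[OF _ Bm]) (use int in auto)
      also have "\<dots> \<le> (1 / 4) ^ k / (1 / 2) ^ k" using s(2)[of k] by (intro divide_right_mono) auto
      also have "\<dots> = (1 / 2) ^ k" by (simp add: power_divide[symmetric])
      finally show ?thesis .
    qed
    have "(\<lambda>K. 2 * (1 / 2 :: real) ^ K) \<longlonglongrightarrow> 0" by (intro tendsto_mult_right_zero LIMSEQ_power_zero) auto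
    then have "\<forall>\<^sub>F K in sequentially. 2 * (1 / 2 :: real) ^ K < measure V (space V)"
      using pos by (rule order_tendstoD)
    then obtain K where K: "2 * (1 / 2 :: real) ^ K < measure V (space V)"
      by (auto simp: eventually_sequentially)
    \<comment> \<open>The exceptional sets are removed from index \<open>K\<close> on, where their
      total measure \<open>2 * 2^-K\<close> is less than the volume; so \<open>E\<close> has
      positive measure.\<close>
    define U where "U = (\<Union>i. B (i + K))"
    define E where "E = space V - U"
    have Um: "U \<in> sets V" unfolding U_def using Bm by auto
    have Em [measurable]: "E \<in> sets V" unfolding E_def using Um by auto
    have sm: "summable (\<lambda>i. (1 / 2 :: real) ^ (i + K))"
      by (rule summable_ignore_initial_segment) (auto intro: summable_geometric)
    have smB: "summable (\<lambda>i. measure V (B (i + K)))"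
      by (rule summable_comparison_test'[OF sm]) (use mB in auto)
    have "measure V U \<le> (\<Sum>i. measure V (B (i + K)))"
      unfolding U_def by (rule finite_measure_subadditive_countably[OF _ smB]) (use Bm in auto)
    also have "\<dots> \<le> (\<Sum>i. (1 / 2) ^ (i + K))" by (rule suminf_le[OF mB smB sm])
    also have "\<dots> = (\<Sum>i. (1 / 2) ^ i) * (1 / 2) ^ K"
      by (simp only: power_add) (rule suminf_mult2[symmetric], simp)
    also have "\<dots> = 2 * (1 / 2) ^ K" by (subst suminf_geometric) auto
    finally have "measure V U < measure V (space V)" using K by linarith
    then have Epos: "measure V E > 0" unfolding E_def using Um by (simp add: finite_measure_compl)
    \<comment> \<open>\<open>E\<close> has no topological regularity, so its indicator is a genuine
      L^infinity test function. Along \<open>s\<close> the integrals tend to 0, whereas ergodicity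
      demands the positive limit \<open>measure V E\<close> divided by the volume.\<close>
    have "(\<lambda>j. \<integral>p. indicator E p * (\<phi> j p)\<^sup>2 \<partial>V) \<longlonglongrightarrow> (1 / measure V (space V)) * (\<integral>p. indicator E p \<partial>V)"
    proof -
      have ind: "indicat_real E \<in> borel_measurable V" by simp
      have bdd: "\<exists>B. AE p in V. \<bar>indicat_real E p\<bar> \<le> B"
        by (intro exI[of _ 1] AE_I2) (simp add: indicator_def)
      show ?thesis by (rule mp[OF bspec[OF qe[unfolded Linfty_quantum_ergodic_def] ind] bdd])
    qed
    moreover have "filterlim s at_top sequentially"
      using s(1) by (intro filterlim_at_top_mono[OF filterlim_ident]) (auto intro: always_eventually)
    ultimately have lim: "(\<lambda>k. \<integral>p. indicator E p * (\<phi> (s k) p)\<^sup>2 \<partial>V) \<longlonglongrightarrow> (1 / measure V (space V)) * (\<integral>p. indicator E p \<partial>V)"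
      by (rule filterlim_compose)
    have "(\<lambda>k. \<integral>p. indicator E p * (\<phi> (s k) p)\<^sup>2 \<partial>V) \<longlonglongrightarrow> 0"
    proof (rule Lim_null_comparison)
      show "(\<lambda>k. (1 / 4) ^ k * measure V (space V)) \<longlonglongrightarrow> 0"
        by (intro tendsto_mult_left_zero LIMSEQ_power_zero) auto
      show "\<forall>\<^sub>F k in sequentially. norm (\<integral>p. indicator E p * (\<phi> (s k) p)\<^sup>2 \<partial>V) \<le> (1 / 4) ^ k * measure V (space V)"
        unfolding eventually_sequentially
      proof (intro exI[of _ K] allI impI)
        fix k assume k: "K \<le> k"
        have pw: "norm (indicator E p * (\<phi> (s k) p)\<^sup>2) \<le> (1 / 4) ^ k" if "p \<in> space V" for p
        proof (cases "p \<in> E")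
          case True
          then have "p \<notin> B (k - K + K)" unfolding E_def U_def by blast
          then have "\<bar>\<phi> (s k) p\<bar> < (1 / 2) ^ k" using that k by (simp add: B_def not_le)
          then have "\<bar>\<phi> (s k) p\<bar>\<^sup>2 \<le> ((1 / 2) ^ k)\<^sup>2" by (intro power_mono) auto
          also have "((1 / 2 :: real) ^ k)\<^sup>2 = (1 / 4) ^ k"
            by (simp add: power2_eq_square power_mult_distrib[symmetric])
          finally show ?thesis using True by simp
        qed simp
        have i: "integrable V (\<lambda>p. indicator E p * (\<phi> (s k) p)\<^sup>2)"
          by (rule integrable_const_bound[of _ "(1 / 4) ^ k"]) (use pw in auto)
        have "norm (\<integral>p. indicator E p * (\<phi> (s k) p)\<^sup>2 \<partial>V) \<le> (\<integral>p. norm (indicator E p * (\<phi> (s k) p)\<^sup>2) \<partial>V)"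
          by (rule integral_norm_bound)
        also have "\<dots> \<le> (\<integral>p. (1 / 4) ^ k \<partial>V)"
          by (rule integral_mono) (use i pw in auto)
        finally show "norm (\<integral>p. indicator E p * (\<phi> (s k) p)\<^sup>2 \<partial>V) \<le> (1 / 4) ^ k * measure V (space V)"
          by (simp add: mult.commute)
      qed
    qed
    then have "(1 / measure V (space V)) * (\<integral>p. indicator E p \<partial>V) = 0" using lim LIMSEQ_unique by blast
    moreover have "(\<integral>p. indicator E p \<partial>V) = measure V E"
      using Em sets.sets_into_space[OF Em] by (simp add: Int_absorb2)
    ultimately show False using Epos pos by simp
  qed
  then show thesis using that by blast
qed

context riem_vol begin

text \<open>Letting \<open>h\<close> approximate the sign function in Green's identity gives
  \<open>\<lambda>\<^sup>2 \<integral>|\<phi>| \<le> C \<integral>\<^sub>Z |\<nabla>\<phi>| dS\<close>; the sharp form of this is an equality with \<open>C = 2\<close>.\<close>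

lemma L1_le_nodal_mass:
  obtains C where "C > 0"
    "\<And>f l I0. eigenfunction A G f l \<Longrightarrow> emeasure (grad_nodal_measure A G f) UNIV = ennreal I0 \<Longrightarrow> 0 \<le> I0 \<Longrightarrow>
      l\<^sup>2 * (\<integral>p. \<bar>f p\<bar> \<partial>V) \<le> C * I0"
proof -
  obtain I K th where part: "chart_partition I K th" by (rule partition_of_unity)
  note P = chart_partitionD[OF part]
  define F where "F i = chart_part (chart_at A i) (th i)" for i
  have FC1: "C1 UNIV (F i)" for i
    unfolding F_def by (rule chart_part_C1(1)[OF chart_at(1) P(7)[OF chart_at(1)] P(2) P(3) P(6)])
  have F0: "F i y = 0" if "y \<notin> K i" for i y
    unfolding F_def by (rule chart_part_C1(2)[OF chart_at(1) P(7)[OF chart_at(1)] P(2) P(3) P(6) that])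
  have th1: "th i p \<le> 1" if "i \<in> I" for i p
    using member_le_sum[OF that, of "\<lambda>i. th i p"] P(1,4,5) by simp
  define bd where "bd i f k = (\<integral>y. F i y * (real k / (1 + (real k * coord_rep (chart_at A i) f y)\<^sup>2) *
      energy (chart_at A i) f y) \<partial>lborel)" for i f k
  have ex: "\<exists>C. nodal_bound (chart_at A i) (F i) C" if i: "i \<in> I" for i
  proof (rule local_nodal_bound[OF chart_at(1) P(2) P(3) FC1 F0])
    show "0 \<le> F i y" "F i y \<le> 1" for y
      using P(4) th1[OF i] by (simp_all add: F_def chart_part_def)
  qed
  define C where "C i = (SOME C. nodal_bound (chart_at A i) (F i) C)" for i
  have okC: "nodal_bound (chart_at A i) (F i) (C i)" if "i \<in> I" for i
    unfolding C_def using ex[OF that] by (rule someI_ex)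
  have C: "C i > 0" if "i \<in> I" for i using okC[OF that] by (simp add: nodal_bound_def)
  define CS where "CS = (\<Sum>i\<in>I. C i)"
  have CS: "CS \<ge> 0" unfolding CS_def using C less_imp_le by (intro sum_nonneg) blast
  interpret V: finite_measure V by (rule finite_V)
  \<comment> \<open>The factor 2 undoes the 1/2 in \<open>arctan_mult_lower_bound\<close>; the added
    1 guarantees positivity.\<close>
  show thesis
  proof (rule that[of "2 * CS + 1"])
    show "2 * CS + 1 > 0" using CS by simp
    fix f l I0
    assume f: "eigenfunction A G f l" and I0: "emeasure (grad_nodal_measure A G f) UNIV = ennreal I0" "(0::real) \<le> I0"
    have cf: "continuous_on UNIV f" by (rule smooth_fun_continuous[OF eigen_smooth[OF f]])
    have "l\<^sup>2 * (\<integral>p. \<bar>f p\<bar> \<partial>V) \<le> 2 * CS * I0 + \<tau>" if \<tau>: "\<tau> > 0" for \<tau>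
    proof -
      \<comment> \<open>Summed over the charts, these errors stay below
        \<open>\<tau> / 4\<close>.\<close>
      define \<tau>' where "\<tau>' = \<tau> / (4 * (real (card I) + 1))"
      have \<tau>': "\<tau>' > 0" unfolding \<tau>'_def using \<tau> by (intro divide_pos_pos) auto
      have "\<exists>k0. \<forall>k\<ge>k0. k > 0 \<longrightarrow> bd i f k \<le> C i * I0 + \<tau>'" if "i \<in> I" for i
        using okC[OF that] f I0 \<tau>' unfolding nodal_bound_def bd_def by blast
      then have "\<forall>i\<in>I. \<exists>k0. \<forall>k\<ge>k0. k > 0 \<longrightarrow> bd i f k \<le> C i * I0 + \<tau>'" by (rule ballI)
      then obtain k0 where "\<forall>i\<in>I. \<forall>k\<ge>k0 i. k > 0 \<longrightarrow> bd i f k \<le> C i * I0 + \<tau>'"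
        unfolding bchoice_iff by (elim exE)
      then have k0: "bd i f k \<le> C i * I0 + \<tau>'" if "i \<in> I" "k0 i \<le> k" "k > 0" for i k using that by blast
      define W where "W = measure V (space V)"
      \<comment> \<open>For \<open>k \<ge> k1\<close> the error \<open>W / k\<close> from comparing
        \<open>\<bar>f\<bar>\<close> with \<open>f arctan (k f)\<close> costs at most
        \<open>\<tau> / 2\<close> after multiplication by \<open>l^2\<close>.\<close>
      obtain k1 :: nat where k1: "2 * l\<^sup>2 * W / \<tau> < real k1" using reals_Archimedean2 by blast
      define k where "k = Suc (k1 + (\<Sum>i\<in>I. k0 i))"
      have kk: "k > 0" "real k1 \<le> real k" "\<And>i. i \<in> I \<Longrightarrow> k0 i \<le> k"
      proof -
        fix i assume "i \<in> I"
        then have "k0 i \<le> (\<Sum>i\<in>I. k0 i)" using P(1) by (intro member_le_sum) auto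
        then show "k0 i \<le> k" by (simp add: k_def)
      next
        have "k1 \<le> k" by (simp add: k_def)
        then show "real k1 \<le> real k" by simp
      qed (simp add: k_def)
      note pair = bounded_C1_pair_arctan[of "real k"]
      have "l\<^sup>2 * (\<integral>p. f p * arctan (real k * f p) \<partial>V) = (\<Sum>i\<in>I. bd i f k)"
        unfolding F_def bd_def by (rule global_green[OF part f bounded_C1_pairD(1,2)[OF pair]])
      also have "\<dots> \<le> (\<Sum>i\<in>I. C i * I0 + \<tau>')" using k0 kk by (intro sum_mono) blast
      also have "\<dots> = CS * I0 + real (card I) * \<tau>'" by (simp add: CS_def sum.distrib sum_distrib_right)
      also have "\<dots> \<le> CS * I0 + \<tau> / 4" using \<tau> by (simp add: \<tau>'_def field_simps)
      finally have up: "l\<^sup>2 * (\<integral>p. f p * arctan (real k * f p) \<partial>V) \<le> CS * I0 + \<tau> / 4" .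
      have ca: "continuous_on UNIV (\<lambda>p. f p * arctan (real k * f p))" using cf by (intro continuous_intros)
      have ab: "integrable V (\<lambda>p. \<bar>f p\<bar>)" using cf by (intro continuous_integrable_V continuous_intros)
      have "((\<integral>p. \<bar>f p\<bar> \<partial>V) - W / real k) / 2 = (\<integral>p. (\<bar>f p\<bar> - 1 / real k) / 2 \<partial>V)"
        using ab by (simp add: W_def)
      also have "\<dots> \<le> (\<integral>p. f p * arctan (real k * f p) \<partial>V)"
        using ab by (intro integral_mono continuous_integrable_V[OF ca] arctan_mult_lower_bound) (auto simp: kk)
      finally have "l\<^sup>2 * (((\<integral>p. \<bar>f p\<bar> \<partial>V) - W / real k) / 2) \<le> l\<^sup>2 * (\<integral>p. f p * arctan (real k * f p) \<partial>V)"
        by (intro mult_left_mono) auto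
      then have 1: "l\<^sup>2 * (((\<integral>p. \<bar>f p\<bar> \<partial>V) - W / real k) / 2) \<le> CS * I0 + \<tau> / 4" using up by linarith
      have "2 * l\<^sup>2 * W / \<tau> < real k" using k1 kk(2) by linarith
      then have 2: "l\<^sup>2 * (W / real k) \<le> \<tau> / 2" using \<tau> kk(1) by (simp add: field_simps)
      have gen: "a * x = 2 * (a * ((x - y) / 2)) + a * y" for a x y :: real
        by (simp add: field_simps)
      have "l\<^sup>2 * (\<integral>p. \<bar>f p\<bar> \<partial>V) = 2 * (l\<^sup>2 * (((\<integral>p. \<bar>f p\<bar> \<partial>V) - W / real k) / 2)) + l\<^sup>2 * (W / real k)"
        by (rule gen)
      also have "\<dots> \<le> 2 * (CS * I0 + \<tau> / 4) + \<tau> / 2" using mult_left_mono[OF 1, of 2] 2 by (intro add_mono) auto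
      finally show ?thesis by simp
    qed
    then have "l\<^sup>2 * (\<integral>p. \<bar>f p\<bar> \<partial>V) \<le> 2 * CS * I0" by (rule field_le_epsilon)
    then show "l\<^sup>2 * (\<integral>p. \<bar>f p\<bar> \<partial>V) \<le> (2 * CS + 1) * I0" using I0(2) by (simp add: algebra_simps)
  qed
qed

text \<open>Green's identity with \<open>h = id\<close> and eigenvalue 0 says that the integrals of
  \<open>th i * |\<nabla>f|^2\<close> add up to 0. Hence the gradient vanishes wherever some
  \<open>th i\<close> is positive, that is everywhere; so \<open>f\<close> is locally constant, and
  connectedness makes it constant.\<close>

lemma harmonic_constant:
  assumes conn: "connected (UNIV :: 'a set)" and f: "eigenfunction A G f 0"
  obtains k where "\<And>p. f p = k"
proof -
  obtain I K th where part: "chart_partition I K th" by (rule partition_of_unity)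
  note P = chart_partitionD[OF part]
  define F where "F i = chart_part (chart_at A i) (th i)" for i
  have FC1: "C1 UNIV (F i)" for i
    unfolding F_def by (rule chart_part_C1(1)[OF chart_at(1) P(7)[OF chart_at(1)] P(2) P(3) P(6)])
  have F0: "F i y = 0" if "y \<notin> K i" for i y
    unfolding F_def by (rule chart_part_C1(2)[OF chart_at(1) P(7)[OF chart_at(1)] P(2) P(3) P(6) that])
  have sm: "smooth_fun A f" using f by (rule eigen_smooth)
  have did: "((\<lambda>t. t) has_real_derivative 1) (at t)" for t :: real by simp
  define u where "u i y = F i y * energy (chart_at A i) f y" for i y
  have unn: "0 \<le> u i y" for i y
    unfolding u_def F_def chart_part_def using energy_nonneg[OF chart_at(1)] P(4) by simp
  have uc: "continuous_on UNIV (u i)" for i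
    unfolding u_def
    by (rule continuous_on_mult_extend_zero[OF C1_continuous[OF FC1] continuous_energy[OF chart_at(1) sm]
          open_img[OF chart_at(1)] P(2) P(3)]) (rule F0)
  have u0: "y \<notin> K i \<Longrightarrow> u i y = 0" for i y using F0 by (simp add: u_def)
  have ui: "integrable lborel (u i)" for i
    by (rule continuous_compact_support_integrable[OF uc P(2) u0])
  have "(\<Sum>i\<in>I. \<integral>y. u i y \<partial>lborel) = 0"
    using global_green[OF part f did] by (simp add: u_def F_def)
  then have "(\<integral>y. u i y \<partial>lborel) = 0" if "i \<in> I" for i
    using P(1) that unn by (subst (asm) sum_nonneg_eq_0_iff) (auto intro: integral_nonneg)
  then have uz: "u i y = 0" if "i \<in> I" for i y
    using continuous_nonneg_integral_zero[OF uc unn ui] that by blast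
  have "f constant_on UNIV"
  proof (rule locally_constant_imp_constant[OF conn])
    fix p :: 'a
    obtain i where i: "i \<in> I" "th i p > 0"
    proof (rule ccontr)
      assume "\<not> thesis"
      then have "\<forall>i\<in>I. th i p = 0" using that P(4) by (metis less_eq_real_def)
      then show False using P(5)[of p] by simp
    qed
    let ?c = "chart_at A i"
    have c: "?c \<in> A" by (rule chart_at)
    have pin: "p \<in> iv ?c ` K i" using i(2) P(6)[of p i] by force
    have p: "p \<in> fst ?c" using pin P(3)[of i] iv_in by blast
    define S where "S = {y. F i y > 0}"
    have S: "open S" unfolding S_def by (intro open_Collect_less continuous_on_const C1_continuous[OF FC1])
    have SK: "S \<subseteq> img ?c" unfolding S_def F_def chart_part_def by auto
    have "snd ?c p \<in> S" using i(2) p by (simp add: S_def F_def chart_part_def iv_chart[OF c])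
    then obtain e where e: "e > 0" "ball (snd ?c p) e \<subseteq> S" using S open_contains_ball by blast
    have grad0: "gradv (coord_rep ?c f) y = 0" if y: "y \<in> S" for y
    proof (rule ccontr)
      assume ne: "gradv (coord_rep ?c f) y \<noteq> 0"
      have yi: "y \<in> img ?c" using y SK by blast
      have "energy ?c f y > 0"
        unfolding energy_gip[OF c yi] gip_iv[OF c yi]
        by (intro mult_pos_pos sg_pos[OF c yi] posdef_inv_pos[OF posdef_Gr[OF c yi] ne])
      then have "u i y > 0" using y by (simp add: u_def S_def)
      then show False using uz[OF i(1)] by simp
    qed
    have "\<exists>k. \<forall>y\<in>ball (snd ?c p) e. coord_rep ?c f y = k"
    proof (rule has_derivative_zero_constant[OF convex_ball])
      fix y assume "y \<in> ball (snd ?c p) e"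
      then have y: "y \<in> S" using e by blast
      have "(coord_rep ?c f has_derivative (\<lambda>v. gradv (coord_rep ?c f) y \<bullet> v)) (at y)"
        by (rule frechet_gradv[OF C1_differentiable[OF C1_coord_rep(1)[OF c sm]]]) (use y SK in blast)
      then show "(coord_rep ?c f has_derivative (\<lambda>h. 0)) (at y within ball (snd ?c p) e)"
        using grad0[OF y] by (simp add: has_derivative_at_withinI)
    qed
    then obtain k where k: "\<And>y. y \<in> ball (snd ?c p) e \<Longrightarrow> coord_rep ?c f y = k" by blast
    define T where "T = fst ?c \<inter> snd ?c -` ball (snd ?c p) e"
    have T: "open T" unfolding T_def by (rule continuous_open_preimage[OF cont_chart[OF c] open_dom[OF c] open_ball])
    have fk: "f q = k" if "q \<in> T" for q
      using that k[of "snd ?c q"] by (auto simp: T_def coord_rep_def iv_chart[OF c])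
    have "p \<in> T" using p e by (simp add: T_def)
    then show "\<exists>T. openin (top_of_set UNIV) T \<and> p \<in> T \<and> (\<forall>x\<in>T. f x = f p)"
      using T fk by (intro exI[of _ T]) auto
  qed
  then show thesis using that unfolding constant_on_def by blast
qed

end

section \<open>Passage to the weak* limit\<close>

theorem corollary4p7:
  fixes A :: "('a::{t2_space, second_countable_topology}, 'n::finite) chart set"
    and G :: "('a, 'n) chart \<Rightarrow> 'a \<Rightarrow> real ^ 'n ^ 'n"
    and V :: "'a measure"
    and \<phi> :: "nat \<Rightarrow> 'a \<Rightarrow> real"
    and lam :: "nat \<Rightarrow> real"
  assumes "compact (UNIV :: 'a set)"
    and "connected (UNIV :: 'a set)"
    and "smooth_atlas A"
    and "riemannian_metric A G"
    and "riemannian_volume A G V"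
    and "\<And>j. eigenfunction A G (\<phi> j) (lam j)"
    and "\<And>j. (\<integral>p. (\<phi> j p)\<^sup>2 \<partial>V) = 1"
    and "\<exists>e l k. orthonormal_eigenbasis A G V e l \<and> inj k \<and>
           (\<forall>j. \<phi> j = e (k j) \<and> lam j = l (k j))"
    and "Linfty_quantum_ergodic V \<phi>"
  shows "\<exists>C>0. \<forall>r \<nu>. strict_mono r \<and>
           weak_star_limit (\<lambda>j. scale_measure (ennreal (1 / (lam (r j))\<^sup>2))
                                  (grad_nodal_measure A G (\<phi> (r j)))) \<nu> \<longrightarrow>
           measure \<nu> (space \<nu>) \<ge> C"
proof -
  interpret riem_vol A G V using assms(1,3,4,5) by unfold_locales
  interpret V: finite_measure V by (rule finite_V)
  have cont: "continuous_on UNIV (\<phi> j)" for j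
    by (rule smooth_fun_continuous[OF eigen_smooth[OF assms(6)]])
  \<comment> \<open>A zero volume would contradict the normalization of the eigenfunctions.\<close>
  have Vpos: "measure V (space V) > 0"
  proof (rule ccontr)
    assume "\<not> measure V (space V) > 0"
    then have "measure V (space V) = 0" using measure_nonneg[of V "space V"] by linarith
    then have "emeasure V (space V) = 0" by (simp add: V.emeasure_eq_measure)
    then have "AE p in V. (\<phi> 0 p)\<^sup>2 = 0" by (intro AE_I[where N = "space V"]) auto
    then have "(\<integral>p. (\<phi> 0 p)\<^sup>2 \<partial>V) = 0" by (rule integral_eq_zero_AE)
    then show False using assms(7) by simp
  qed
  obtain c where c: "c > 0" "\<forall>\<^sub>F j in sequentially. c \<le> (\<integral>p. \<bar>\<phi> j p\<bar> \<partial>V)"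
    by (rule quantum_ergodic_L1_lower_bound[OF finite_V Vpos continuous_integrable_V[OF cont] assms(9)]) blast
  obtain C where C: "C > 0"
    "\<And>f l I0. eigenfunction A G f l \<Longrightarrow> emeasure (grad_nodal_measure A G f) UNIV = ennreal I0 \<Longrightarrow> 0 \<le> I0 \<Longrightarrow>
      l\<^sup>2 * (\<integral>p. \<bar>f p\<bar> \<partial>V) \<le> C * I0"
    by (rule L1_le_nodal_mass) blast
  \<comment> \<open>Normalized eigenfunctions for 0 are nonzero constants, and two of these are not
    orthogonal. Distinct positions in the sequence carry distinct basis elements because
    \<open>k\<close> is injective.\<close>
  have uniq: "a = b" if zero: "lam a = 0" "lam b = 0" for a b
  proof (rule ccontr)
    assume ab: "a \<noteq> b"
    obtain e l k where e: "orthonormal_eigenbasis A G V e l" "inj k" "\<And>j. \<phi> j = e (k j)"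
      using assms(8) by blast
    have "k a \<noteq> k b" using ab e(2) by (simp add: inj_eq)
    then have o: "(\<integral>p. \<phi> a p * \<phi> b p \<partial>V) = 0"
      using e(1) unfolding orthonormal_eigenbasis_def e(3) by simp
    obtain x where x: "\<And>p. \<phi> a p = x" by (rule harmonic_constant[OF assms(2)]) (use assms(6)[of a] zero in auto)
    obtain y where y: "\<And>p. \<phi> b p = y" by (rule harmonic_constant[OF assms(2)]) (use assms(6)[of b] zero in auto)
    have "x \<noteq> 0" "y \<noteq> 0" using assms(7)[of a] assms(7)[of b] by (auto simp: x y)
    then show False using o Vpos by (simp add: x y)
  qed
  \<comment> \<open>At \<open>lam j = 0\<close> the scaling factor is \<open>1 / 0 = 0\<close> and
    annihilates the measure; at most one index is affected.\<close>
  have ev0: "\<forall>\<^sub>F j in sequentially. lam j \<noteq> 0"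
  proof (cases "\<exists>j0. lam j0 = 0")
    case True
    then obtain j0 where "lam j0 = 0" by blast
    then have "\<forall>j\<ge>Suc j0. lam j \<noteq> 0" using uniq by fastforce
    then show ?thesis unfolding eventually_sequentially by blast
  qed simp
  show ?thesis
  proof (intro exI[of _ "c / C"] conjI allI impI)
    show "c / C > 0" using c C by simp
    fix r :: "nat \<Rightarrow> nat" and \<nu> :: "'a measure"
    define \<mu> where "\<mu> j = scale_measure (ennreal (1 / (lam (r j))\<^sup>2)) (grad_nodal_measure A G (\<phi> (r j)))" for j
    assume "strict_mono r \<and> weak_star_limit (\<lambda>j. scale_measure (ennreal (1 / (lam (r j))\<^sup>2))
                                  (grad_nodal_measure A G (\<phi> (r j)))) \<nu>"
    then have r: "strict_mono r" and w: "weak_star_limit \<mu> \<nu>" unfolding \<mu>_def by auto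
    \<comment> \<open>With the constant 1 as test function the integrals are the total masses, and
      the integrability demanded by \<open>weak_star_limit\<close> makes the masses finite for large
      \<open>j\<close>.\<close>
    have "(\<forall>\<^sub>F j in sequentially. integrable (\<mu> j) (\<lambda>p. 1 :: real)) \<and> (\<lambda>j. \<integral>p. 1 \<partial>\<mu> j) \<longlonglongrightarrow> (\<integral>p. (1::real) \<partial>\<nu>)"
      using w unfolding weak_star_limit_def by (elim conjE allE[of _ "\<lambda>p. 1"]) simp
    then have int: "\<forall>\<^sub>F j in sequentially. integrable (\<mu> j) (\<lambda>p. 1 :: real)"
      and lim: "(\<lambda>j. measure (\<mu> j) (space (\<mu> j))) \<longlonglongrightarrow> measure \<nu> (space \<nu>)" by auto
    have sp: "space (\<mu> j) = UNIV" for j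
      by (simp add: \<mu>_def space_scale_measure grad_nodal_measure_def hausdorff_measure_def)
    note sub = filterlim_subseq[OF r]
    have "\<forall>\<^sub>F j in sequentially. c / C \<le> measure (\<mu> j) (space (\<mu> j))"
      using int eventually_compose_filterlim[OF c(2) sub] eventually_compose_filterlim[OF ev0 sub]
    proof eventually_elim
      case (elim j)
      define x where "x = 1 / (lam (r j))\<^sup>2"
      have x: "x > 0" using elim(3) by (simp add: x_def)
      have em: "emeasure (\<mu> j) UNIV = ennreal x * emeasure (grad_nodal_measure A G (\<phi> (r j))) UNIV"
        unfolding \<mu>_def x_def by simp
      have "(\<integral>\<^sup>+p. ennreal (norm (1 :: real)) \<partial>\<mu> j) < \<infinity>" using elim(1) unfolding integrable_iff_bounded by blast
      then have "emeasure (\<mu> j) UNIV \<noteq> top" using sp[of j] by simp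
      then have "emeasure (grad_nodal_measure A G (\<phi> (r j))) UNIV \<noteq> top"
        unfolding em using x by (auto simp: ennreal_mult_top)
      then obtain I0 where I0: "emeasure (grad_nodal_measure A G (\<phi> (r j))) UNIV = ennreal I0" "0 \<le> I0"
        by (cases "emeasure (grad_nodal_measure A G (\<phi> (r j))) UNIV") auto
      have "(lam (r j))\<^sup>2 * c \<le> (lam (r j))\<^sup>2 * (\<integral>p. \<bar>\<phi> (r j) p\<bar> \<partial>V)"
        using elim(2) by (intro mult_left_mono) auto
      also have "\<dots> \<le> C * I0" by (rule C(2)[OF assms(6) I0])
      finally have "c / C \<le> x * I0" using C(1) elim(3) by (simp add: x_def field_simps)
      moreover have "measure (\<mu> j) (space (\<mu> j)) = x * I0"
        unfolding measure_def sp em I0(1) using x I0(2) by (simp add: ennreal_mult[symmetric])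
      ultimately show ?case by simp
    qed
    then show "c / C \<le> measure \<nu> (space \<nu>)"
      by (rule tendsto_lowerbound[OF lim]) simp
  qed
qed

end
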